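(* Let $0<\beta<\alpha<\pi/2$. Let $\mu$ be a symmetric complex Borel measure with compact support contained in $S_\beta$ such that $\int_{S_\beta} d\mu(z)=0$, let $\varphi\in H(S_\alpha)'$ be the functional induced by $\mu$, i.e. $\langle f,\varphi\rangle=\int f\,d\mu$, and let $F=\mathcal{F}\mathcal{B}(\varphi)$ be its Fourier--Borel transform. Let $(T(t))_{t\in S_\alpha}=(\exp(tA))_{t\in S_\alpha}$ be an analytic non-quasinilpotent semigroup and let $\mathcal A_T$ be the Banach algebra generated by $(T(t))_{t\in S_\alpha}$. If there exists $t_0>0$ such that $$\sup_{t\in S_{\alpha-\beta},\,|t|\le t_0}\rho(F(-tA))<\sup_{z\in S_{\alpha-\beta}}|F(z)|,$$ then $\mathcal A_T/\operatorname{Rad}\mathcal A_T$ is unital and the generator of $(\pi(T(t)))_{t\in S_\alpha}$ is bounded, where $\pi:\mathcal A_T\to\mathcal A_T/\operatorname{Rad}\mathcal A_T$ denotes the canonical surjection.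
   Context: For $0<\gamma<\pi/2$, $S_\gamma=\{z\in\mathbb C:\operatorname{Re}z>0,\ |\arg z|<\gamma\}$. $H(S_\alpha)$ is the Fr\'echet space of analytic functions on $S_\alpha$ with the topology of local uniform convergence, and $H(S_\alpha)'$ is its dual. A measure $\mu$ is symmetric if $\mu(\overline S)=\overline{\mu(S)}$ for all Borel sets $S\subset S_\alpha$, where $\overline S=\{\overline z: z\in S\}$. The Fourier--Borel transform of $\varphi$ (induced by $\mu$) is the entire function $F(z)=\mathcal{F}\mathcal{B}(\varphi)(z)=\langle e_{-z},\varphi\rangle=\int e^{-z\xi}\,d\mu(\xi)$, where $e_{-z}(\xi)=e^{-z\xi}$. An analytic semigroup $(T(t))_{t\in S_\alpha}$ is an analytic map from $S_\alpha$ to the bounded operators on a Banach space $\mathcal X$ with $T(s+t)=T(s)T(t)$ for $s,t\in S_\alpha$; its infinitesimal generator is denoted by $A$ and one writes $T(t)=\exp(tA)$. It is non-quasinilpotent if the operators $T(t)$ are not all quasinilpotent. $\mathcal A_T$ is the (commutative) Banach algebra generated by the elements $T(t)$, $t\in S_\alpha$ (the norm-closed subalgebra they generate, no identity being adjoined). If $\operatorname{supp}\mu\subset S_\beta$ and $t\in S_{\alpha-\beta}$, then $F(-tA)$ is defined by the Bochner integral $F(-tA)=\int T(t\xi)\,d\mu(\xi)\in\mathcal A_T$. $\rho$ denotes the spectral radius and $\operatorname{Rad}$ the (Jacobson) radical. The generator of $(\pi(T(t)))_{t\in S_\alpha}$ is bounded means that there is an element $B$ of the unital Banach algebra $\mathcal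 A_T/\operatorname{Rad}\mathcal A_T$ with $\pi(T(t))=e^{tB}$ for all $t\in S_\alpha$. *)

theory Defs
  imports "HOL-Analysis.Analysis"
begin

section \<open>Complex Banach spaces and bounded operators\<close>

class scaleC =
  fixes scaleC :: "complex \<Rightarrow> 'a \<Rightarrow> 'a" (infixr \<open>*\<^sub>C\<close> 75)

class complex_normed_vector = real_normed_vector + scaleC +
  assumes scaleC_add_right: "a *\<^sub>C (x + y) = a *\<^sub>C x + a *\<^sub>C y"
    and scaleC_add_left: "(a + b) *\<^sub>C x = a *\<^sub>C x + b *\<^sub>C x"
    and scaleC_scaleC: "a *\<^sub>C (b *\<^sub>C x) = (a * b) *\<^sub>C x"
    and scaleC_of_real: "complex_of_real r *\<^sub>C x = r *\<^sub>R x"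
    and norm_scaleC: "norm (a *\<^sub>C x) = cmod a * norm x"

class complex_banach = complex_normed_vector + banach

instantiation complex :: complex_banach
begin

definition scaleC_complex :: "complex \<Rightarrow> complex \<Rightarrow> complex" where
  "scaleC_complex a x = a * x"

instance
  by standard (auto simp: scaleC_complex_def algebra_simps norm_mult scaleR_conv_of_real)

end

lemma bounded_linear_scaleC_right:
  "bounded_linear (\<lambda>x :: 'a :: complex_normed_vector. c *\<^sub>C x)"
proof (rule bounded_linear_intro[where K = "cmod c"])
  fix x y :: 'a and r :: real
  show "c *\<^sub>C (x + y) = c *\<^sub>C x + c *\<^sub>C y"
    by (rule scaleC_add_right)
  show "c *\<^sub>C (r *\<^sub>R x) = r *\<^sub>R (c *\<^sub>C x)"
    by (metis scaleC_of_real scaleC_scaleC mult.commute)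
  show "norm (c *\<^sub>C x) \<le> norm x * cmod c"
    by (simp add: norm_scaleC mult.commute)
qed

(* 'a \<Rightarrow>\<^sub>L 'b consists of the real-linear bounded maps; it is a complex normed space
   through the scalar multiplication of its codomain. The bounded operators of a complex
   Banach space are its elements satisfying complex_linear below, with the same norm. *)

instantiation blinfun :: (real_normed_vector, complex_normed_vector) complex_normed_vector
begin

lift_definition scaleC_blinfun :: "complex \<Rightarrow> 'a \<Rightarrow>\<^sub>L 'b \<Rightarrow> 'a \<Rightarrow>\<^sub>L 'b"
  is "\<lambda>c f x. c *\<^sub>C f x"
  by (rule bounded_linear_compose[OF bounded_linear_scaleC_right])

instance
proof
  fix a b :: complex and r :: real and x y :: "'a \<Rightarrow>\<^sub>L 'b"
  show "a *\<^sub>C (x + y) = a *\<^sub>C x + a *\<^sub>C y"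
    by transfer (simp add: scaleC_add_right)
  show "(a + b) *\<^sub>C x = a *\<^sub>C x + b *\<^sub>C x"
    by transfer (simp add: scaleC_add_left)
  show "a *\<^sub>C (b *\<^sub>C x) = (a * b) *\<^sub>C x"
    by transfer (simp add: scaleC_scaleC)
  show "complex_of_real r *\<^sub>C x = r *\<^sub>R x"
    by transfer (simp add: scaleC_of_real)
  show "norm (a *\<^sub>C x) = cmod a * norm x"
  proof (cases "a = 0")
    case True
    have "(0 :: complex) *\<^sub>C x = 0"
      by transfer (simp add: scaleC_of_real[of 0, simplified])
    then show ?thesis using True by simp
  next
    case False
    have le: "norm (c *\<^sub>C z) \<le> cmod c * norm z" for c and z :: "'a \<Rightarrow>\<^sub>L 'b"
    proof (rule norm_blinfun_bound)
      fix v
      have "norm (blinfun_apply z v) \<le> norm z * norm v"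
        by (rule norm_blinfun)
      then show "norm (blinfun_apply (c *\<^sub>C z) v) \<le> cmod c * norm z * norm v"
        by (simp add: scaleC_blinfun.rep_eq norm_scaleC mult.assoc mult_left_mono)
    qed simp
    have "inverse a *\<^sub>C (a *\<^sub>C x) = x"
      using False
      by transfer (simp add: scaleC_scaleC scaleC_of_real[of 1, simplified])
    then have "norm x \<le> inverse (cmod a) * norm (a *\<^sub>C x)"
      using le[of "inverse a" "a *\<^sub>C x"] by (simp only: norm_inverse)
    then have "cmod a * norm x \<le> norm (a *\<^sub>C x)"
      using False by (simp add: divide_simps mult.commute)
    with le[of a x] show ?thesis by simp
  qed
qed

end

instance blinfun :: (real_normed_vector, complex_banach) complex_banach ..

definition complex_linear :: "('a :: complex_banach \<Rightarrow>\<^sub>L 'a) \<Rightarrow> bool" where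
  "complex_linear a \<longleftrightarrow> (\<forall>c x. blinfun_apply a (c *\<^sub>C x) = c *\<^sub>C blinfun_apply a x)"

definition spectrum :: "('a :: complex_banach \<Rightarrow>\<^sub>L 'a) \<Rightarrow> complex set" where
  "spectrum a = {z. \<not> (\<exists>b. complex_linear b
      \<and> b o\<^sub>L (z *\<^sub>C id_blinfun - a) = id_blinfun
      \<and> (z *\<^sub>C id_blinfun - a) o\<^sub>L b = id_blinfun)}"

(* With values in ennreal, the (empty) spectrum on the zero space gives radius 0. *)
definition spectral_radius :: "('a :: complex_banach \<Rightarrow>\<^sub>L 'a) \<Rightarrow> ennreal" where
  "spectral_radius a = (SUP z\<in>spectrum a. ennreal (cmod z))"

definition quasinilpotent :: "('a :: complex_banach \<Rightarrow>\<^sub>L 'a) \<Rightarrow> bool" where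
  "quasinilpotent a \<longleftrightarrow> spectral_radius a = 0"


section \<open>Bochner integrals and complex measures\<close>

(* The library's has_bochner_integral requires a second countable codomain, which spaces of
   operators are not; this is the same definition without that sort constraint. *)

definition has_bochner_int ::
    "'m measure \<Rightarrow> ('m \<Rightarrow> 'b :: real_normed_vector) \<Rightarrow> 'b \<Rightarrow> bool" where
  "has_bochner_int M f x \<longleftrightarrow> f \<in> borel_measurable M \<and>
    (\<exists>s. (\<forall>i. Bochner_Integration.simple_bochner_integrable M (s i)) \<and>
      (\<lambda>i. \<integral>\<^sup>+ z. norm (f z - s i z) \<partial>M) \<longlonglongrightarrow> 0 \<and>
      (\<lambda>i::nat. Bochner_Integration.simple_bochner_integral M (s i)) \<longlonglongrightarrow> x)"

definition bochner_int :: "'m measure \<Rightarrow> ('m \<Rightarrow> 'b :: real_normed_vector) \<Rightarrow> 'b" where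
  "bochner_int M f =
    (if \<exists>x. has_bochner_int M f x then THE x. has_bochner_int M f x else 0)"

lemma bochner_int_eq_lebesgue_integral:
  fixes f :: "'m \<Rightarrow> 'b :: {real_normed_vector, second_countable_topology}"
  shows "bochner_int M f = integral\<^sup>L M f"
proof -
  have "has_bochner_int M f = has_bochner_integral M f"
    by (auto simp: fun_eq_iff has_bochner_int_def has_bochner_integral.simps)
  then show ?thesis
    by (simp add: bochner_int_def lebesgue_integral_def)
qed

(* Complex Borel measures on the plane, as countably additive set functions; the values on
   sets that are not Borel are irrelevant. *)

definition complex_measure :: "(complex set \<Rightarrow> complex) \<Rightarrow> bool" where
  "complex_measure \<mu> \<longleftrightarrow> (\<forall>E :: nat \<Rightarrow> complex set.
    range E \<subseteq> sets borel \<longrightarrow> disjoint_family E \<longrightarrow>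
      (\<lambda>n. \<mu> (E n)) sums \<mu> (\<Union>n. E n))"

(* The positive part of the Jordan decomposition of a real measure; the negative part is
   the positive part of its negative. *)
definition positive_part :: "(complex set \<Rightarrow> real) \<Rightarrow> complex measure" where
  "positive_part \<nu> = measure_of UNIV (sets borel)
    (\<lambda>E. SUP F\<in>{F \<in> sets borel. F \<subseteq> E}. ennreal (\<nu> F))"

definition cm_integral :: "(complex set \<Rightarrow> complex) \<Rightarrow> complex set \<Rightarrow>
    (complex \<Rightarrow> 'b :: complex_banach) \<Rightarrow> 'b" where
  "cm_integral \<mu> S f =
    (let g = (\<lambda>z. indicator S z *\<^sub>R f z) in
      bochner_int (positive_part (\<lambda>E. Re (\<mu> E))) g
      - bochner_int (positive_part (\<lambda>E. - Re (\<mu> E))) g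
      + \<i> *\<^sub>C (bochner_int (positive_part (\<lambda>E. Im (\<mu> E))) g
             - bochner_int (positive_part (\<lambda>E. - Im (\<mu> E))) g))"

definition cm_support :: "(complex set \<Rightarrow> complex) \<Rightarrow> complex set" where
  "cm_support \<mu> =
    {z. \<forall>U. open U \<longrightarrow> z \<in> U \<longrightarrow> (\<exists>E \<in> sets borel. E \<subseteq> U \<and> \<mu> E \<noteq> 0)}"

definition sector :: "real \<Rightarrow> complex set" where
  "sector \<gamma> = {z. Re z > 0 \<and> \<bar>Arg z\<bar> < \<gamma>}"

definition symmetric_on :: "complex set \<Rightarrow> (complex set \<Rightarrow> complex) \<Rightarrow> bool" where
  "symmetric_on D \<mu> \<longleftrightarrow> (\<forall>S \<in> sets borel. S \<subseteq> D \<longrightarrow> \<mu> (cnj ` S) = cnj (\<mu> S))"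


section \<open>Analytic functionals\<close>

(* The dual of the space of holomorphic functions on D. As the topology of local uniform
   convergence is metrizable, continuity is sequential continuity. *)
definition holo_dual :: "complex set \<Rightarrow> ((complex \<Rightarrow> complex) \<Rightarrow> complex) set" where
  "holo_dual D = {\<phi>.
    (\<forall>f g. f holomorphic_on D \<longrightarrow> g holomorphic_on D \<longrightarrow>
      \<phi> (\<lambda>z. f z + g z) = \<phi> f + \<phi> g) \<and>
    (\<forall>c f. f holomorphic_on D \<longrightarrow> \<phi> (\<lambda>z. c * f z) = c * \<phi> f) \<and>
    (\<forall>f g. (\<forall>n. f n holomorphic_on D) \<longrightarrow> g holomorphic_on D \<longrightarrow>
      (\<forall>K. compact K \<longrightarrow> K \<subseteq> D \<longrightarrow> uniform_limit K f g sequentially) \<longrightarrow>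
      (\<lambda>n. \<phi> (f n)) \<longlonglongrightarrow> \<phi> g)}"

definition induced_by :: "complex set \<Rightarrow> (complex set \<Rightarrow> complex) \<Rightarrow>
    ((complex \<Rightarrow> complex) \<Rightarrow> complex) \<Rightarrow> bool" where
  "induced_by D \<mu> \<phi> \<longleftrightarrow> (\<forall>f. f holomorphic_on D \<longrightarrow> \<phi> f = cm_integral \<mu> D f)"

definition fourier_borel :: "((complex \<Rightarrow> complex) \<Rightarrow> complex) \<Rightarrow> complex \<Rightarrow> complex" where
  "fourier_borel \<phi> z = \<phi> (\<lambda>\<xi>. exp (- (z * \<xi>)))"


section \<open>Analytic semigroups\<close>

definition analytic_semigroup ::
    "real \<Rightarrow> (complex \<Rightarrow> ('a :: complex_banach \<Rightarrow>\<^sub>L 'a)) \<Rightarrow> bool" where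
  "analytic_semigroup \<alpha> T \<longleftrightarrow>
    (\<forall>t \<in> sector \<alpha>. complex_linear (T t)) \<and>
    (\<forall>t \<in> sector \<alpha>. \<exists>D. ((\<lambda>s. inverse (s - t) *\<^sub>C (T s - T t)) \<longlongrightarrow> D) (at t)) \<and>
    (\<forall>s \<in> sector \<alpha>. \<forall>t \<in> sector \<alpha>. T (s + t) = T s o\<^sub>L T t)"

(* F(-tA) for the Fourier-Borel transform F of a measure supported in sector \<beta>. *)
definition fb_operator :: "(complex set \<Rightarrow> complex) \<Rightarrow> real \<Rightarrow>
    (complex \<Rightarrow> ('a :: complex_banach \<Rightarrow>\<^sub>L 'a)) \<Rightarrow> complex \<Rightarrow> ('a \<Rightarrow>\<^sub>L 'a)" where
  "fb_operator \<mu> \<beta> T t = cm_integral \<mu> (sector \<beta>) (\<lambda>\<xi>. T (t * \<xi>))"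

definition closed_subalgebra :: "('a :: complex_banach \<Rightarrow>\<^sub>L 'a) set \<Rightarrow> bool" where
  "closed_subalgebra A \<longleftrightarrow> closed A \<and> 0 \<in> A \<and> (\<forall>a\<in>A. \<forall>b\<in>A. a + b \<in> A) \<and>
    (\<forall>c. \<forall>a\<in>A. c *\<^sub>C a \<in> A) \<and> (\<forall>a\<in>A. \<forall>b\<in>A. a o\<^sub>L b \<in> A)"

definition semigroup_algebra ::
    "real \<Rightarrow> (complex \<Rightarrow> ('a :: complex_banach \<Rightarrow>\<^sub>L 'a)) \<Rightarrow> ('a \<Rightarrow>\<^sub>L 'a) set" where
  "semigroup_algebra \<alpha> T = closed_subalgebra hull (T ` sector \<alpha>)"


section \<open>The Jacobson radical of an algebra without identity\<close>

definition left_ideal ::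
    "('a :: complex_banach \<Rightarrow>\<^sub>L 'a) set \<Rightarrow> ('a \<Rightarrow>\<^sub>L 'a) set \<Rightarrow> bool" where
  "left_ideal A I \<longleftrightarrow> I \<subseteq> A \<and> 0 \<in> I \<and> (\<forall>x\<in>I. \<forall>y\<in>I. x + y \<in> I) \<and>
    (\<forall>c. \<forall>x\<in>I. c *\<^sub>C x \<in> I) \<and> (\<forall>a\<in>A. \<forall>x\<in>I. a o\<^sub>L x \<in> I)"

definition modular_left_ideal ::
    "('a :: complex_banach \<Rightarrow>\<^sub>L 'a) set \<Rightarrow> ('a \<Rightarrow>\<^sub>L 'a) set \<Rightarrow> bool" where
  "modular_left_ideal A I \<longleftrightarrow> left_ideal A I \<and> (\<exists>e\<in>A. \<forall>a\<in>A. a - (a o\<^sub>L e) \<in> I)"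

definition maximal_modular_left_ideal ::
    "('a :: complex_banach \<Rightarrow>\<^sub>L 'a) set \<Rightarrow> ('a \<Rightarrow>\<^sub>L 'a) set \<Rightarrow> bool" where
  "maximal_modular_left_ideal A I \<longleftrightarrow> modular_left_ideal A I \<and> I \<noteq> A \<and>
    (\<forall>J. left_ideal A J \<longrightarrow> I \<subseteq> J \<longrightarrow> J \<noteq> A \<longrightarrow> J = I)"

(* This is A itself when there is no maximal modular left ideal. *)
definition jacobson_radical ::
    "('a :: complex_banach \<Rightarrow>\<^sub>L 'a) set \<Rightarrow> ('a \<Rightarrow>\<^sub>L 'a) set" where
  "jacobson_radical A = A \<inter> \<Inter> {I. maximal_modular_left_ideal A I}"


section \<open>Quotient algebras\<close>

(* The elements of A/R are the cosets a + R. Scalar multiples and products of cosets are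
   completed by R, since elementwise they may only yield a part of a coset. *)

definition coset ::
    "('a :: complex_banach \<Rightarrow>\<^sub>L 'a) set \<Rightarrow> ('a \<Rightarrow>\<^sub>L 'a) \<Rightarrow> ('a \<Rightarrow>\<^sub>L 'a) set" where
  "coset R a = {a + r | r. r \<in> R}"

definition quotient_algebra ::
    "('a :: complex_banach \<Rightarrow>\<^sub>L 'a) set \<Rightarrow> ('a \<Rightarrow>\<^sub>L 'a) set \<Rightarrow> ('a \<Rightarrow>\<^sub>L 'a) set set" where
  "quotient_algebra A R = coset R ` A"

definition coset_add ::
    "('a :: complex_banach \<Rightarrow>\<^sub>L 'a) set \<Rightarrow> ('a \<Rightarrow>\<^sub>L 'a) set \<Rightarrow> ('a \<Rightarrow>\<^sub>L 'a) set" where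
  "coset_add X Y = {x + y | x y. x \<in> X \<and> y \<in> Y}"

definition coset_scale ::
    "('a :: complex_banach \<Rightarrow>\<^sub>L 'a) set \<Rightarrow> complex \<Rightarrow> ('a \<Rightarrow>\<^sub>L 'a) set \<Rightarrow> ('a \<Rightarrow>\<^sub>L 'a) set" where
  "coset_scale R c X = {c *\<^sub>C x + r | x r. x \<in> X \<and> r \<in> R}"

definition coset_mult ::
    "('a :: complex_banach \<Rightarrow>\<^sub>L 'a) set \<Rightarrow> ('a \<Rightarrow>\<^sub>L 'a) set \<Rightarrow> ('a \<Rightarrow>\<^sub>L 'a) set \<Rightarrow> ('a \<Rightarrow>\<^sub>L 'a) set" where
  "coset_mult R X Y = {(x o\<^sub>L y) + r | x y r. x \<in> X \<and> y \<in> Y \<and> r \<in> R}"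

definition coset_norm :: "('a :: complex_banach \<Rightarrow>\<^sub>L 'a) set \<Rightarrow> real" where
  "coset_norm X = (INF x\<in>X. norm x)"

definition quotient_identity :: "('a :: complex_banach \<Rightarrow>\<^sub>L 'a) set \<Rightarrow> ('a \<Rightarrow>\<^sub>L 'a) set \<Rightarrow>
    ('a \<Rightarrow>\<^sub>L 'a) set \<Rightarrow> bool" where
  "quotient_identity A R U \<longleftrightarrow> U \<in> quotient_algebra A R \<and>
    (\<forall>X \<in> quotient_algebra A R. coset_mult R U X = X \<and> coset_mult R X U = X)"

primrec coset_power :: "('a :: complex_banach \<Rightarrow>\<^sub>L 'a) set \<Rightarrow> ('a \<Rightarrow>\<^sub>L 'a) set \<Rightarrow>
    ('a \<Rightarrow>\<^sub>L 'a) set \<Rightarrow> nat \<Rightarrow> ('a \<Rightarrow>\<^sub>L 'a) set" where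
  "coset_power R U B 0 = U"
| "coset_power R U B (Suc n) = coset_mult R B (coset_power R U B n)"

primrec coset_exp_sum :: "('a :: complex_banach \<Rightarrow>\<^sub>L 'a) set \<Rightarrow> ('a \<Rightarrow>\<^sub>L 'a) set \<Rightarrow>
    ('a \<Rightarrow>\<^sub>L 'a) set \<Rightarrow> complex \<Rightarrow> nat \<Rightarrow> ('a \<Rightarrow>\<^sub>L 'a) set" where
  "coset_exp_sum R U B t 0 = R"
| "coset_exp_sum R U B t (Suc n) = coset_add (coset_exp_sum R U B t n)
     (coset_scale R (t ^ n / fact n) (coset_power R U B n))"

(* X = exp (t B) in the quotient algebra with identity U: the exponential series converges
   to X in the quotient norm. *)
definition is_coset_exp :: "('a :: complex_banach \<Rightarrow>\<^sub>L 'a) set \<Rightarrow> ('a \<Rightarrow>\<^sub>L 'a) set \<Rightarrow>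
    ('a \<Rightarrow>\<^sub>L 'a) set \<Rightarrow> complex \<Rightarrow> ('a \<Rightarrow>\<^sub>L 'a) set \<Rightarrow> bool" where
  "is_coset_exp R U B t X \<longleftrightarrow>
    (\<lambda>n. coset_norm (coset_add (coset_exp_sum R U B t n) (coset_scale R (-1) X)))
      \<longlonglongrightarrow> 0"

end

theory Submission
  imports Defs "HOL-Complex_Analysis.Complex_Analysis"
begin

text \<open>A character of a commutative algebra of operators takes \<open>T t\<close> either to \<open>0\<close> for all \<open>t\<close> or
  to \<open>exp (- (l * t))\<close> for some exponent \<open>l\<close>, and then it takes \<open>F(-tA)\<close> to \<open>F (t * l)\<close>. The growth
  of \<open>T\<close> confines the exponents of large modulus to a sector of half-angle slightly larger than
  \<open>\<pi>/2 - \<alpha>\<close>. As \<open>F\<close> is symmetric and decays in the sectors of half-angle less than \<open>\<pi>/2 - \<beta>\<close>,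
  the maximum principle shows that, for such an \<open>l\<close> of large modulus, the values \<open>F (t * l)\<close>
  with small \<open>t\<close> in the sector of half-angle \<open>\<alpha> - \<beta>\<close> come arbitrarily close to the supremum of
  \<open>|F|\<close>. The hypothesis therefore bounds the exponents. Then \<open>0\<close> is isolated in the spectrum of
  \<open>T \<tau>\<close> for small \<open>\<tau>\<close>, and holomorphic functional calculus yields a unit and a logarithm
  modulo the radical.\<close>

text \<open>The algebra \<open>A\<close> generated by the semigroup need not have an identity, and
  this shapes the constructions. Characters live on a larger unital commutative algebra, the
  bicommutant of the semigroup; it contains the inverses of its invertible elements, so the
  hypothesis on operator spectra bounds character values. Every power series applied to an element
  of \<open>A\<close> has zero constant term or is multiplied by an element of \<open>A\<close>, so
  the result stays in \<open>A\<close>. Membership in the radical is decided by the growth rate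
  \<open>spr\<close> of powers: a nonzero \<open>spr a\<close> is attained by some character at
  \<open>a\<close>, so elements killed by all characters have \<open>spr\<close> zero, and a Neumann
  series puts such elements of \<open>A\<close> in the radical. The angle \<alpha> - \<beta> enters
  because a large exponent has argument at most pi/2 - \<beta> in modulus, and a rotation by at most
  \<alpha> - \<beta> takes it to a ray strictly inside the range where \<open>F\<close> decays.
  Operator-valued integrals are handled as limits of Riemann sums, since finite sums are what
  characters and conjugation respect.\<close>

class complex_banach_algebra = complex_banach + real_normed_algebra + monoid_mult +
  assumes scaleC_mult_left: "(c *\<^sub>C x) * y = c *\<^sub>C (x * y)"
    and scaleC_mult_right: "x * (c *\<^sub>C y) = c *\<^sub>C (x * y)"

section \<open>Arithmetic of complex scalars\<close>

lemma scaleC_one [simp]: "(1::complex) *\<^sub>C (x::'a::complex_normed_vector) = x"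
  using scaleC_of_real[of 1 x] by simp

lemma scaleC_zero_left [simp]: "(0::complex) *\<^sub>C (x::'a::complex_normed_vector) = 0"
  using scaleC_of_real[of 0 x] by simp

lemma scaleC_zero_right [simp]: "c *\<^sub>C (0::'a::complex_normed_vector) = 0"
  using norm_scaleC[of c "0::'a"] by simp

lemma scaleC_minus_one: "(-1::complex) *\<^sub>C (x::'a::complex_normed_vector) = - x"
  using scaleC_of_real[of "-1" x] by simp

lemma scaleC_minus_left: "(- c) *\<^sub>C (x::'a::complex_normed_vector) = - (c *\<^sub>C x)"
  by (metis scaleC_minus_one scaleC_scaleC mult_minus1)

lemma scaleC_minus_right: "c *\<^sub>C (- x::'a::complex_normed_vector) = - (c *\<^sub>C x)"
  by (metis scaleC_minus_one scaleC_scaleC mult.commute)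

lemma scaleC_diff_right: "c *\<^sub>C (x - y::'a::complex_normed_vector) = c *\<^sub>C x - c *\<^sub>C y"
  using scaleC_add_right[of c x "- y"] by (simp add: scaleC_minus_right)

lemma scaleC_sum_right: "c *\<^sub>C (\<Sum>i\<in>I. f i :: 'a::complex_normed_vector) = (\<Sum>i\<in>I. c *\<^sub>C f i)"
  by (induction I rule: infinite_finite_induct) (auto simp: scaleC_add_right)

lemma tendsto_scaleC [tendsto_intros]:
  fixes f :: "'i \<Rightarrow> complex" and g :: "'i \<Rightarrow> 'a::complex_normed_vector"
  assumes "(f \<longlongrightarrow> a) F" "(g \<longlongrightarrow> b) F"
  shows "((\<lambda>x. f x *\<^sub>C g x) \<longlongrightarrow> a *\<^sub>C b) F"
proof -
  have "bounded_bilinear (\<lambda>(c::complex) (x::'a). c *\<^sub>C x)"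
  proof
    show "(r *\<^sub>R c) *\<^sub>C x = r *\<^sub>R (c *\<^sub>C x)" "c *\<^sub>C (r *\<^sub>R x) = r *\<^sub>R (c *\<^sub>C x)" for r c and x :: 'a
      by (metis scaleC_of_real scaleC_scaleC scaleR_conv_of_real mult.commute)+
    show "\<exists>K. \<forall>a (b::'a). norm (a *\<^sub>C b) \<le> norm a * norm b * K"
      by (intro exI[of _ 1]) (simp add: norm_scaleC)
  qed (simp_all add: scaleC_add_left scaleC_add_right)
  from bounded_bilinear.tendsto[OF this assms] show ?thesis .
qed

lemma complex_linear_scaleC: "complex_linear a \<Longrightarrow> complex_linear (c *\<^sub>C a)"
  by (simp add: complex_linear_def scaleC_blinfun.rep_eq scaleC_scaleC mult.commute)

lemma complex_linear_compose: "complex_linear a \<Longrightarrow> complex_linear b \<Longrightarrow> complex_linear (a o\<^sub>L b)"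
  by (simp add: complex_linear_def)

lemma complex_linear_add: "complex_linear a \<Longrightarrow> complex_linear b \<Longrightarrow> complex_linear (a + b)"
  by (simp add: complex_linear_def blinfun.add_left scaleC_add_right)

lemma closed_complex_linear: "closed {a :: 'a::complex_banach \<Rightarrow>\<^sub>L 'a. complex_linear a}"
proof -
  have "closed {a :: 'a \<Rightarrow>\<^sub>L 'a. blinfun_apply a (c *\<^sub>C x) = c *\<^sub>C blinfun_apply a x}" for c x
    by (intro closed_Collect_eq bounded_linear.continuous_on[OF bounded_linear_scaleC_right]
        continuous_intros blinfun.bounded_linear_left linear_continuous_on)
  then have "closed (\<Inter>c. \<Inter>x. {a :: 'a \<Rightarrow>\<^sub>L 'a. blinfun_apply a (c *\<^sub>C x) = c *\<^sub>C blinfun_apply a x})"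
    by (intro closed_INT) auto
  then show ?thesis
    by (simp add: complex_linear_def Collect_all_eq)
qed

section \<open>The Banach algebra of complex-linear operators\<close>

text \<open>For real-linear maps the law \<open>x * (c *\<^sub>C y) = c *\<^sub>C (x * y)\<close>
  fails in general; restricting to complex-linear operators gives a complex Banach algebra, and
  results are carried back along \<open>clop_apply\<close>.\<close>

typedef (overloaded) ('a::complex_banach) clop = "{a :: 'a \<Rightarrow>\<^sub>L 'a. complex_linear a}"
  morphisms clop_apply Clop
  by (intro exI[of _ 0]) (simp add: complex_linear_def)

setup_lifting type_definition_clop

instantiation clop :: (complex_banach) "{ring, monoid_mult, real_normed_vector, complex_normed_vector}"
begin

lift_definition zero_clop :: "'a clop" is 0 by (simp add: complex_linear_def)
lift_definition one_clop :: "'a clop" is id_blinfun by (simp add: complex_linear_def)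
lift_definition plus_clop :: "'a clop \<Rightarrow> 'a clop \<Rightarrow> 'a clop" is "(+)"
  by (rule complex_linear_add)
lift_definition uminus_clop :: "'a clop \<Rightarrow> 'a clop" is uminus
  by (simp add: complex_linear_def blinfun.minus_left scaleC_minus_right)
lift_definition minus_clop :: "'a clop \<Rightarrow> 'a clop \<Rightarrow> 'a clop" is "(-)"
  by (simp add: complex_linear_def blinfun.diff_left scaleC_diff_right)
lift_definition times_clop :: "'a clop \<Rightarrow> 'a clop \<Rightarrow> 'a clop" is "(o\<^sub>L)"
  by (rule complex_linear_compose)
lift_definition scaleC_clop :: "complex \<Rightarrow> 'a clop \<Rightarrow> 'a clop" is "(*\<^sub>C)"
  by (rule complex_linear_scaleC)
lift_definition scaleR_clop :: "real \<Rightarrow> 'a clop \<Rightarrow> 'a clop" is "(*\<^sub>R)"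
  by (metis complex_linear_scaleC scaleC_of_real)
lift_definition norm_clop :: "'a clop \<Rightarrow> real" is norm .
definition dist_clop :: "'a clop \<Rightarrow> 'a clop \<Rightarrow> real" where "dist_clop x y = norm (x - y)"
definition sgn_clop :: "'a clop \<Rightarrow> 'a clop" where "sgn_clop x = scaleR (inverse (norm x)) x"
definition uniformity_clop :: "('a clop \<times> 'a clop) filter" where
  "uniformity_clop = (INF e\<in>{0<..}. principal {(x, y). dist x y < e})"
definition open_clop :: "'a clop set \<Rightarrow> bool" where
  "open_clop S = (\<forall>x\<in>S. \<forall>\<^sub>F (x', y) in uniformity. x' = x \<longrightarrow> y \<in> S)"

instance
proof
  fix x y z :: "'a clop" and r s :: real and c d :: complex
  show "dist x y = norm (x - y)" by (rule dist_clop_def)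
  show "sgn x = inverse (norm x) *\<^sub>R x" by (rule sgn_clop_def)
  show "uniformity = (INF e\<in>{0<..}. principal {(x, y :: 'a clop). dist x y < e})"
    by (rule uniformity_clop_def)
  show "open U = (\<forall>x\<in>U. \<forall>\<^sub>F (x', y) in uniformity. x' = x \<longrightarrow> y \<in> U)" for U :: "'a clop set"
    by (rule open_clop_def)
  show "x + y + z = x + (y + z)" "x + y = y + x" "0 + x = x" "- x + x = 0" "x - y = x + - y"
    by (transfer; simp)+
  show "x * y * z = x * (y * z)" "1 * x = x" "x * 1 = x"
    by (transfer; rule blinfun_eqI; simp)+
  show "(x + y) * z = x * z + y * z" "x * (y + z) = x * y + x * z"
    by (transfer; simp add: bounded_bilinear.add_left[OF bounded_bilinear_blinfun_compose]
         bounded_bilinear.add_right[OF bounded_bilinear_blinfun_compose])+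
  show "r *\<^sub>R (x + y) = r *\<^sub>R x + r *\<^sub>R y" "(r + s) *\<^sub>R x = r *\<^sub>R x + s *\<^sub>R x"
    "r *\<^sub>R s *\<^sub>R x = (r * s) *\<^sub>R x" "1 *\<^sub>R x = x"
    by (transfer; simp add: scaleR_add_right scaleR_add_left)+
  show "c *\<^sub>C (x + y) = c *\<^sub>C x + c *\<^sub>C y" "(c + d) *\<^sub>C x = c *\<^sub>C x + d *\<^sub>C x"
    "c *\<^sub>C d *\<^sub>C x = (c * d) *\<^sub>C x" "complex_of_real r *\<^sub>C x = r *\<^sub>R x"
    by (transfer; simp add: scaleC_add_right scaleC_add_left scaleC_scaleC scaleC_of_real)+
  show "norm x = 0 \<longleftrightarrow> x = 0" "norm (x + y) \<le> norm x + norm y"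
    "norm (r *\<^sub>R x) = \<bar>r\<bar> * norm x" "norm (c *\<^sub>C x) = cmod c * norm x"
    by (transfer; simp add: norm_triangle_ineq norm_scaleC)+
qed

end

instance clop :: (complex_banach) complex_banach
proof
  fix X :: "nat \<Rightarrow> 'a clop"
  assume "Cauchy X"
  moreover have dist: "dist x y = dist (clop_apply x) (clop_apply y)" for x y :: "'a clop"
    unfolding dist_norm by transfer simp
  ultimately have "Cauchy (\<lambda>n. clop_apply (X n))"
    by (simp add: Cauchy_def)
  then obtain L where L: "(\<lambda>n. clop_apply (X n)) \<longlonglongrightarrow> L"
    using Cauchy_convergent_iff convergent_def by blast
  have "L \<in> {a. complex_linear a}"
    by (rule closed_sequentially[OF closed_complex_linear _ L]) (use clop_apply in auto)
  then have "clop_apply (Clop L) = L"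
    by (simp add: Clop_inverse)
  with L have "X \<longlonglongrightarrow> Clop L"
    by (simp add: lim_sequentially dist)
  then show "convergent X"
    by (auto simp: convergent_def)
qed

instance clop :: (complex_banach) complex_banach_algebra
proof
  fix x y :: "'a clop" and r :: real and c :: complex
  show "(r *\<^sub>R x) * y = r *\<^sub>R (x * y)" "x * (r *\<^sub>R y) = r *\<^sub>R (x * y)"
    by (transfer; simp add: bounded_bilinear.scaleR_left[OF bounded_bilinear_blinfun_compose]
         bounded_bilinear.scaleR_right[OF bounded_bilinear_blinfun_compose])+
  show "norm (x * y) \<le> norm x * norm y"
    by transfer (rule norm_blinfun_compose)
  show "(c *\<^sub>C x) * y = c *\<^sub>C (x * y)"
    by transfer (rule blinfun_eqI, simp add: scaleC_blinfun.rep_eq)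
  show "x * (c *\<^sub>C y) = c *\<^sub>C (x * y)"
    by transfer (rule blinfun_eqI, simp add: scaleC_blinfun.rep_eq complex_linear_def)
qed

lemma scaleC_diff_left: "(a - b) *\<^sub>C (x::'a::complex_normed_vector) = a *\<^sub>C x - b *\<^sub>C x"
  using scaleC_add_left[of "a - b" b x] by (simp add: algebra_simps)

section \<open>Spectral growth\<close>

text \<open>Geometric bounds with an explicit constant combine directly under sums and products of
  commuting elements, without forming limits of n-th roots.\<close>

definition growth :: "'a::complex_banach_algebra \<Rightarrow> real \<Rightarrow> bool" where
  "growth x s \<longleftrightarrow> s > 0 \<and> (\<exists>K. \<forall>n. norm (x ^ n) \<le> K * s ^ n)"

text \<open>This is the limit of the n-th roots of \<open>norm (x ^ n)\<close>, that is, the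
  spectral radius in the sense of Gelfand's formula. The infimum need not be attained.\<close>

definition spr :: "'a::complex_banach_algebra \<Rightarrow> real" where
  "spr x = Inf {s. growth x s}"

lemma growthE:
  assumes "growth x s"
  obtains K where "K \<ge> 0" "\<And>n. norm (x ^ n) \<le> K * s ^ n"
proof -
  from assms obtain K where K: "\<And>n. norm (x ^ n) \<le> K * s ^ n"
    by (auto simp: growth_def)
  from K[of 0] have "K \<ge> 0"
    by simp (meson norm_ge_zero order_trans)
  with K show ?thesis using that by blast
qed

lemma growth_pos: "growth x s \<Longrightarrow> s > 0"
  by (simp add: growth_def)

lemma growthI: "s > 0 \<Longrightarrow> (\<And>n. norm (x ^ n) \<le> K * s ^ n) \<Longrightarrow> growth x s"
  by (auto simp: growth_def)

lemma growth_mono: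
  assumes "growth x s" "s \<le> t" shows "growth x t"
proof -
  obtain K where K: "K \<ge> 0" "\<And>n. norm (x ^ n) \<le> K * s ^ n"
    using growthE assms(1) by blast
  show ?thesis
  proof (rule growthI[of _ _ K])
    show "t > 0" using assms growth_pos by fastforce
    show "norm (x ^ n) \<le> K * t ^ n" for n
    proof -
      have "K * s ^ n \<le> K * t ^ n"
        using assms growth_pos[of x s] K(1) by (intro mult_left_mono power_mono) auto
      with K(2)[of n] show ?thesis by linarith
    qed
  qed
qed

lemma growth_norm:
  assumes "s > 0" "norm x \<le> s" shows "growth x s"
\<comment> \<open>The constant is \<open>norm 1\<close>, which may differ from 1: for operators on
  the zero space, 1 = 0.\<close>
proof (rule growthI[of _ _ "norm (1::'a)"])
  show "norm (x ^ n) \<le> norm (1::'a) * s ^ n" for n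
  proof (induction n)
    case (Suc n)
    have "norm (x ^ Suc n) \<le> norm x * norm (x ^ n)"
      by (simp add: norm_mult_ineq)
    also have "\<dots> \<le> s * (norm (1::'a) * s ^ n)"
      using Suc assms by (intro mult_mono) auto
    finally show ?case by (simp add: mult_ac)
  qed simp
qed (use assms in auto)

lemma commuting_power_mult:
  fixes x y :: "'a::complex_banach_algebra"
  assumes "x * y = y * x" shows "(x * y) ^ n = x ^ n * y ^ n"
proof (induction n)
  case (Suc n)
  have "y * x ^ n = x ^ n * y"
    by (rule power_commuting_commutes[OF assms, symmetric])
  then have "x * y * (x ^ n * y ^ n) = x * x ^ n * (y * y ^ n)"
    by (metis mult.assoc)
  with Suc show ?case by (simp add: mult.assoc)
qed simp

lemma growth_mult:
  assumes "x * y = y * x" "growth x s" "growth y t" shows "growth (x * y) (s * t)"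
proof -
  obtain K L where K: "K \<ge> 0" "\<And>n. norm (x ^ n) \<le> K * s ^ n"
    and L: "L \<ge> 0" "\<And>n. norm (y ^ n) \<le> L * t ^ n"
    using growthE assms by metis
  have "norm ((x * y) ^ n) \<le> (K * L) * (s * t) ^ n" for n
  proof -
    have "norm ((x * y) ^ n) \<le> norm (x ^ n) * norm (y ^ n)"
      unfolding commuting_power_mult[OF assms(1)] by (rule norm_mult_ineq)
    also have "\<dots> \<le> (K * s ^ n) * (L * t ^ n)"
      using K L growth_pos[OF assms(2)] by (intro mult_mono) auto
    finally show ?thesis by (simp add: power_mult_distrib mult_ac)
  qed
  moreover have "s * t > 0" using growth_pos[OF assms(2)] growth_pos[OF assms(3)] by simp
  ultimately show ?thesis by (intro growthI)
qed

lemma growth_add: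
  assumes comm: "x * y = y * x" and "growth x s" "growth y t" shows "growth (x + y) (s + t)"
proof -
  obtain K L where K: "K \<ge> 0" "\<And>n. norm (x ^ n) \<le> K * s ^ n"
    and L: "L \<ge> 0" "\<And>n. norm (y ^ n) \<le> L * t ^ n"
    using growthE assms by metis
  have pos: "s > 0" "t > 0" using assms growth_pos by auto
  \<comment> \<open>With the prefactor \<open>x ^ i * y ^ j\<close>, splitting off one factor
    \<open>x + y\<close> gives two terms of the same shape; induction with \<open>i\<close> and
    \<open>j\<close> arbitrary replaces the binomial expansion.\<close>
  have "norm (x ^ i * y ^ j * (x + y) ^ n) \<le> (K * L) * (s ^ i * t ^ j * (s + t) ^ n)" for i j n
  proof (induction n arbitrary: i j)
    case 0
    have "norm (x ^ i * y ^ j) \<le> norm (x ^ i) * norm (y ^ j)"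
      by (rule norm_mult_ineq)
    also have "\<dots> \<le> (K * s ^ i) * (L * t ^ j)"
      using K L pos by (intro mult_mono) auto
    finally show ?case by (simp add: mult_ac)
  next
    case (Suc n)
    have c: "x * y ^ j = y ^ j * x"
      by (metis comm power_commuting_commutes)
    have "x ^ i * y ^ j * (x + y) ^ Suc n
        = x ^ i * (y ^ j * x) * (x + y) ^ n + x ^ i * (y ^ j * y) * (x + y) ^ n"
      by (simp add: distrib_left distrib_right mult.assoc)
    also have "\<dots> = x ^ Suc i * y ^ j * (x + y) ^ n + x ^ i * y ^ Suc j * (x + y) ^ n"
      by (simp only: c[symmetric] power_Suc2 mult.assoc)
    finally have "norm (x ^ i * y ^ j * (x + y) ^ Suc n)
        \<le> norm (x ^ Suc i * y ^ j * (x + y) ^ n) + norm (x ^ i * y ^ Suc j * (x + y) ^ n)"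
      by (metis norm_triangle_ineq)
    also have "\<dots> \<le> (K * L) * (s ^ Suc i * t ^ j * (s + t) ^ n)
        + (K * L) * (s ^ i * t ^ Suc j * (s + t) ^ n)"
      by (intro add_mono Suc.IH)
    also have "\<dots> = (K * L) * (s ^ i * t ^ j * (s + t) ^ Suc n)"
      by (simp add: algebra_simps)
    finally show ?case .
  qed
  from this[of 0 0] show ?thesis
    using pos by (intro growthI[of _ _ "K * L"]) auto
qed

lemma scaleC_power: "(c *\<^sub>C (x::'a::complex_banach_algebra)) ^ n = c ^ n *\<^sub>C x ^ n"
  by (induction n) (simp_all add: scaleC_mult_left scaleC_mult_right scaleC_scaleC mult.commute)

lemma growth_scaleC:
  assumes "growth x s" "c \<noteq> 0" shows "growth (c *\<^sub>C x) (cmod c * s)"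
proof -
  obtain K where K: "K \<ge> 0" "\<And>n. norm (x ^ n) \<le> K * s ^ n"
    using growthE assms by metis
  have "norm ((c *\<^sub>C x) ^ n) \<le> K * (cmod c * s) ^ n" for n
    using mult_left_mono[OF K(2)[of n], of "cmod c ^ n"]
    by (simp add: scaleC_power norm_scaleC norm_power power_mult_distrib mult_ac)
  moreover have "cmod c * s > 0" using growth_pos[OF assms(1)] assms(2) by simp
  ultimately show ?thesis by (intro growthI)
qed

lemma growth_square:
  assumes "growth (x * x) (s * s)" "s > 0" shows "growth x s"
proof -
  obtain K where K: "K \<ge> 0" "\<And>n. norm ((x * x) ^ n) \<le> K * (s * s) ^ n"
    using growthE assms by metis
  \<comment> \<open>\<open>K\<close> serves the even exponents; an odd power has one factor
    \<open>x\<close> left over, which costs \<open>norm x / s\<close>.\<close>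
  define L where "L = K + K * norm x / s"
  have KL: "K \<le> L" using K assms by (simp add: L_def)
  have "norm (x ^ n) \<le> L * s ^ n" for n
  proof (cases "even n")
    case True
    then obtain m where m: "n = 2 * m" by blast
    have "norm (x ^ n) \<le> K * s ^ n"
      using K(2)[of m] by (simp add: m power_mult power2_eq_square)
    also have "\<dots> \<le> L * s ^ n" using KL assms by (intro mult_right_mono) auto
    finally show ?thesis .
  next
    case False
    then obtain m where m: "n = Suc (2 * m)" by (auto elim: oddE)
    have "norm (x ^ n) \<le> norm x * norm ((x * x) ^ m)"
      by (simp add: m power_mult power2_eq_square norm_mult_ineq)
    also have "\<dots> \<le> norm x * (K * (s * s) ^ m)"
      by (intro mult_left_mono K) auto
    also have "\<dots> = (K * norm x / s) * s ^ n"
      using assms by (simp add: m power_mult power2_eq_square)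
    also have "\<dots> \<le> L * s ^ n"
      using assms K by (intro mult_right_mono) (auto simp: L_def)
    finally show ?thesis .
  qed
  then show ?thesis using assms by (intro growthI)
qed

lemma growth_set:
  fixes x :: "'a::complex_banach_algebra"
  shows "{s. growth x s} \<noteq> {}" "bdd_below {s. growth x s}"
proof -
  have "growth x (norm x + 1)" by (rule growth_norm) (auto intro: add_nonneg_pos)
  then have "norm x + 1 \<in> {s. growth x s}" by simp
  then show "{s. growth x s} \<noteq> {}" by (metis empty_iff)
  show "bdd_below {s. growth x s}"
    by (intro bdd_belowI[of _ 0]) (auto dest: growth_pos)
qed

lemma spr_nonneg: "spr x \<ge> 0"
  unfolding spr_def by (rule cInf_greatest[OF growth_set(1)]) (auto dest: growth_pos)

lemma spr_le_growth: "growth x s \<Longrightarrow> spr x \<le> s"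
  unfolding spr_def by (rule cInf_lower[OF _ growth_set(2)]) auto

lemma growth_if_spr_less: "spr x < s \<Longrightarrow> growth x s"
  unfolding spr_def using cInf_lessD[OF growth_set(1)] growth_mono by fastforce

lemma spr_le_norm: "spr x \<le> norm x"
proof (rule dense_ge)
  fix s assume "norm x < s"
  then show "spr x \<le> s"
    by (intro spr_le_growth growth_norm) (auto intro: le_less_trans[OF norm_ge_zero])
qed

lemma spr_add:
  assumes "x * y = y * x" shows "spr (x + y) \<le> spr x + spr y"
proof (rule field_le_epsilon)
  fix e :: real assume "e > 0"
  then have "growth x (spr x + e/2)" "growth y (spr y + e/2)"
    by (auto intro: growth_if_spr_less)
  from spr_le_growth[OF growth_add[OF assms this]]
  show "spr (x + y) \<le> spr x + spr y + e" by simp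
qed

lemma spr_mult:
  assumes "x * y = y * x" shows "spr (x * y) \<le> spr x * spr y"
proof -
  have "(\<lambda>n. (spr x + inverse (real (Suc n))) * (spr y + inverse (real (Suc n))))
      \<longlonglongrightarrow> (spr x + 0) * (spr y + 0)"
    by (intro tendsto_intros LIMSEQ_inverse_real_of_nat)
  then have "(\<lambda>n. (spr x + inverse (real (Suc n))) * (spr y + inverse (real (Suc n))))
      \<longlonglongrightarrow> spr x * spr y" by simp
  moreover have "spr (x * y) \<le> (spr x + inverse (real (Suc n))) * (spr y + inverse (real (Suc n)))" for n
    by (intro spr_le_growth growth_mult assms growth_if_spr_less) auto
  ultimately show ?thesis by (intro LIMSEQ_le_const) auto
qed

lemma spr_zero: "spr (0::'a::complex_banach_algebra) = 0"
  using spr_le_norm[of "0::'a"] spr_nonneg[of "0::'a"] by simp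

lemma spr_scaleC: "spr (c *\<^sub>C x) = cmod c * spr x"
proof (cases "c = 0")
  case False
  have le: "spr (c *\<^sub>C x) \<le> cmod c * spr x" if "c \<noteq> 0" for c and x :: 'a
  proof (rule field_le_epsilon)
    fix e :: real assume "e > 0"
    then have "growth x (spr x + e / cmod c)"
      using that by (intro growth_if_spr_less) auto
    from spr_le_growth[OF growth_scaleC[OF this that]] that
    show "spr (c *\<^sub>C x) \<le> cmod c * spr x + e" by (simp add: distrib_left)
  qed
  from le[of "inverse c" "c *\<^sub>C x"] False have "spr x \<le> inverse (cmod c) * spr (c *\<^sub>C x)"
    by (simp add: scaleC_scaleC norm_inverse)
  then have "cmod c * spr x \<le> cmod c * (inverse (cmod c) * spr (c *\<^sub>C x))"
    by (rule mult_left_mono) simp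
  also have "\<dots> = spr (c *\<^sub>C x)"
    using False by simp
  finally have "cmod c * spr x \<le> spr (c *\<^sub>C x)" .
  with le[OF False, of x] show ?thesis by simp
qed (simp add: spr_zero)

text \<open>With this rule \<open>spr\<close> itself is admissible as the starting point of the
  search for a minimal seminorm below.\<close>

lemma spr_square: "spr (x * x) = spr x * spr x"
proof (rule antisym)
  show "spr x * spr x \<le> spr (x * x)"
  proof (rule dense_ge)
    fix s assume s: "spr (x * x) < s"
    then have "s > 0" using spr_nonneg[of "x * x"] by linarith
    have "spr x \<le> sqrt s"
      using growth_if_spr_less[OF s] \<open>s > 0\<close> by (intro spr_le_growth[OF growth_square]) simp_all
    then have "spr x * spr x \<le> sqrt s * sqrt s"
      using spr_nonneg[of x] \<open>s > 0\<close> by (intro mult_mono) auto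
    then show "spr x * spr x \<le> s" using \<open>s > 0\<close> by simp
  qed
qed (simp add: spr_mult)

section \<open>Characters\<close>

locale comm_subalgebra =
  fixes C :: "'a::complex_banach_algebra set"
  assumes closed_C: "closed C" and one_in: "1 \<in> C"
    and add_in: "x \<in> C \<Longrightarrow> y \<in> C \<Longrightarrow> x + y \<in> C"
    and scaleC_in: "x \<in> C \<Longrightarrow> c *\<^sub>C x \<in> C"
    and mult_in: "x \<in> C \<Longrightarrow> y \<in> C \<Longrightarrow> x * y \<in> C"
    and comm: "x \<in> C \<Longrightarrow> y \<in> C \<Longrightarrow> x * y = y * x"
begin

lemma zero_in: "0 \<in> C"
  using scaleC_in[OF one_in, of 0] by simp

lemma minus_in: "x \<in> C \<Longrightarrow> - x \<in> C"
  using scaleC_in[of x "-1"] by (simp add: scaleC_minus_one)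

lemma diff_in: "x \<in> C \<Longrightarrow> y \<in> C \<Longrightarrow> x - y \<in> C"
  using add_in[of x "- y"] minus_in by simp

lemma power_in: "x \<in> C \<Longrightarrow> x ^ n \<in> C"
  by (induction n) (auto simp: one_in mult_in)

lemma sum_in: "(\<And>i. i \<in> I \<Longrightarrow> f i \<in> C) \<Longrightarrow> sum f I \<in> C"
  by (induction I rule: infinite_finite_induct) (auto simp: zero_in add_in)

text \<open>The rule for squares is weaker than multiplicativity, but it survives limits and infima
  of chains, so minimal elements exist. Fixing the value 0 outside \<open>C\<close> makes equality
  and order of functions agree with those on \<open>C\<close>. The bound by \<open>spr\<close> will
  make the resulting characters contractive.\<close>

definition square_seminorm :: "('a \<Rightarrow> real) \<Rightarrow> bool" where
  "square_seminorm q \<longleftrightarrow> (\<forall>x. x \<notin> C \<longrightarrow> q x = 0) \<and> (\<forall>x\<in>C. 0 \<le> q x) \<and>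
    (\<forall>x\<in>C. \<forall>y\<in>C. q (x + y) \<le> q x + q y) \<and> (\<forall>c. \<forall>x\<in>C. q (c *\<^sub>C x) = cmod c * q x) \<and>
    (\<forall>x\<in>C. \<forall>y\<in>C. q (x * y) \<le> q x * q y) \<and> (\<forall>x\<in>C. q (x * x) = q x * q x) \<and>
    (\<forall>x\<in>C. q x \<le> spr x)"

lemma square_seminormD:
  assumes "square_seminorm q"
  shows "x \<notin> C \<Longrightarrow> q x = 0" and "x \<in> C \<Longrightarrow> 0 \<le> q x"
    and "x \<in> C \<Longrightarrow> y \<in> C \<Longrightarrow> q (x + y) \<le> q x + q y"
    and "x \<in> C \<Longrightarrow> q (c *\<^sub>C x) = cmod c * q x"
    and "x \<in> C \<Longrightarrow> y \<in> C \<Longrightarrow> q (x * y) \<le> q x * q y"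
    and "x \<in> C \<Longrightarrow> q (x * x) = q x * q x"
    and "x \<in> C \<Longrightarrow> q x \<le> spr x"
  using assms unfolding square_seminorm_def by blast+

text \<open>The squaring rule settles the exponents 2^k. For other n, a loss at \<open>b ^ n\<close>
  would persist at \<open>b ^ (2 ^ n)\<close>, because by submultiplicativity the complementary
  power \<open>b ^ (2 ^ n - n)\<close> cannot make up for it.\<close>

lemma square_seminorm_power:
  assumes q: "square_seminorm q" and b: "b \<in> C" "q b > 0"
  shows "q (b ^ n) = q b ^ n"
proof -
  have one: "q 1 \<ge> 1"
    using square_seminormD(5)[OF q one_in b(1)] b(2) by simp
  then have q1: "q 1 = 1"
    using square_seminormD(6)[OF q one_in] by auto
  have le: "q (b ^ n) \<le> q b ^ n" for n
  proof (induction n)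
    case (Suc n)
    have "q (b ^ Suc n) \<le> q b * q (b ^ n)"
      using square_seminormD(5)[OF q b(1) power_in[OF b(1)]] by simp
    also have "\<dots> \<le> q b * q b ^ n" using Suc b by simp
    finally show ?case by simp
  qed (simp add: q1)
  have two: "q (b ^ (2 ^ k)) = q b ^ (2 ^ k)" for k
  proof (induction k)
    case (Suc k)
    have "q (b ^ (2 ^ Suc k)) = q (b ^ (2 ^ k) * b ^ (2 ^ k))"
      by (simp add: power_add[symmetric] mult_2)
    also have "\<dots> = q b ^ (2 ^ Suc k)"
      using square_seminormD(6)[OF q power_in[OF b(1)]] Suc
      by (simp add: power_add[symmetric] mult_2)
    finally show ?case .
  qed simp
  have n: "n + (2 ^ n - n) = 2 ^ n" using less_exp[of n] by simp
  have "q b ^ n * q b ^ (2 ^ n - n) = q (b ^ n * b ^ (2 ^ n - n))"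
    by (simp only: power_add[symmetric] n two)
  also have "\<dots> \<le> q (b ^ n) * q (b ^ (2 ^ n - n))"
    by (intro square_seminormD(5)[OF q] power_in b)
  also have "\<dots> \<le> q (b ^ n) * q b ^ (2 ^ n - n)"
    by (intro mult_left_mono le square_seminormD(2)[OF q] power_in b)
  finally have "q b ^ n \<le> q (b ^ n)" using b(2) by simp
  with le[of n] show ?thesis by simp
qed

text \<open>The quotients decrease in n by submultiplicativity, hence converge. If minimality of
  \<open>q\<close> forces \<open>q' = q\<close>, the last bound at n = 1 reads
  \<open>q b * q x \<le> q (b * x)\<close>, the missing half of multiplicativity.\<close>

lemma localised_seminorm:
  assumes q: "square_seminorm q" and b: "b \<in> C" "q b > 0"
  shows "\<exists>q'. square_seminorm q' \<and> q' \<le> q \<and>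
    (\<forall>x\<in>C. (\<lambda>n. q (b ^ n * x) / q b ^ n) \<longlonglongrightarrow> q' x) \<and>
    (\<forall>x\<in>C. \<forall>n. q' x \<le> q (b ^ n * x) / q b ^ n)"
proof -
  define f where "f x n = q (b ^ n * x) / q b ^ n" for x n
  have f_nonneg: "0 \<le> f x n" if "x \<in> C" for x n
    using that b unfolding f_def
    by (intro divide_nonneg_nonneg square_seminormD(2)[OF q] mult_in power_in) auto
  have f_dec: "decseq (f x)" if "x \<in> C" for x
  proof (rule decseq_SucI)
    fix n
    have "q (b ^ Suc n * x) \<le> q b * q (b ^ n * x)"
      using that b square_seminormD(5)[OF q b(1), of "b ^ n * x"]
      by (simp add: mult_in power_in mult.assoc)
    then show "f x (Suc n) \<le> f x n"
      using b by (simp add: f_def field_simps)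
  qed
  define q' where "q' x = (if x \<in> C then lim (f x) else 0)" for x
  have lim: "f x \<longlonglongrightarrow> q' x" if "x \<in> C" for x
  proof -
    have "convergent (f x)"
      using decseq_convergent[OF f_dec[OF that], of 0] f_nonneg[OF that] convergent_def by metis
    then show ?thesis using that by (simp add: q'_def convergent_LIMSEQ_iff)
  qed
  have le: "q' x \<le> f x n" if "x \<in> C" for x n
    using decseq_ge[OF f_dec[OF that] lim[OF that]] .
  \<comment> \<open>Even indices, because \<open>b ^ (2 * n) * (x * y)\<close> splits into
    \<open>(b ^ n * x) * (b ^ n * y)\<close>; this carries the rules for products and squares to the
    limit.\<close>
  have lim2: "(\<lambda>n. f x (2 * n)) \<longlonglongrightarrow> q' x" if "x \<in> C" for x
    using LIMSEQ_subseq_LIMSEQ[OF lim[OF that], of "\<lambda>n. 2 * n"]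
    by (simp add: strict_mono_def o_def)
  have comm4: "b ^ (2 * n) * (x * y) = (b ^ n * x) * (b ^ n * y)" if "x \<in> C" "y \<in> C" for n x y
  proof -
    have "b ^ (2 * n) * (x * y) = b ^ n * (b ^ n * x) * y"
      by (simp add: mult_2 power_add mult.assoc)
    also have "\<dots> = b ^ n * (x * b ^ n) * y"
      by (simp only: comm[OF that(1) power_in[OF b(1), of n]])
    finally show ?thesis by (simp add: mult.assoc)
  qed
  have pow2: "q b ^ (2 * n) = q b ^ n * q b ^ n" for n
    by (simp add: mult_2 power_add)
  have le_q: "q' x \<le> q x" if "x \<in> C" for x
    using le[OF that, of 0] by (simp add: f_def)
  have "square_seminorm q'"
    unfolding square_seminorm_def
  proof (intro conjI ballI allI impI)
    fix x y :: 'a and c :: complex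
    show "x \<notin> C \<Longrightarrow> q' x = 0" by (simp add: q'_def)
    assume x: "x \<in> C"
    show "0 \<le> q' x" using LIMSEQ_le_const[OF lim[OF x]] f_nonneg[OF x] by blast
    show "q' x \<le> spr x" using le_q[OF x] square_seminormD(7)[OF q x] by simp
    have "f (c *\<^sub>C x) = (\<lambda>n. cmod c * f x n)"
      using x b by (auto simp: f_def scaleC_mult_right square_seminormD(4)[OF q] mult_in power_in)
    then show "q' (c *\<^sub>C x) = cmod c * q' x"
      using LIMSEQ_unique lim[OF scaleC_in[OF x]] tendsto_mult_left[OF lim[OF x]] by metis
    have "f (x * x) (2 * n) = f x n * f x n" for n
      using x b square_seminormD(6)[OF q, of "b ^ n * x"]
      by (simp only: f_def comm4 mult_in power_in pow2 times_divide_times_eq)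
    then have "(\<lambda>n. f x n * f x n) \<longlonglongrightarrow> q' (x * x)"
      using lim2[OF mult_in[OF x x]] by simp
    then show "q' (x * x) = q' x * q' x"
      using LIMSEQ_unique tendsto_mult[OF lim[OF x] lim[OF x]] by blast
    assume y: "y \<in> C"
    have "f (x + y) n \<le> f x n + f y n" for n
      using x y b square_seminormD(3)[OF q, of "b ^ n * x" "b ^ n * y"]
      by (simp add: f_def mult_in power_in distrib_left add_divide_distrib[symmetric] divide_right_mono)
    then show "q' (x + y) \<le> q' x + q' y"
      using lim[OF add_in[OF x y]] tendsto_add[OF lim[OF x] lim[OF y]] by (intro LIMSEQ_le) auto
    have "f (x * y) (2 * n) \<le> f x n * f y n" for n
      using x y b square_seminormD(5)[OF q, of "b ^ n * x" "b ^ n * y"]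
      by (simp only: f_def comm4 mult_in power_in pow2 times_divide_times_eq divide_right_mono
          zero_le_mult_iff zero_le_power less_imp_le simp_thms)
    then show "q' (x * y) \<le> q' x * q' y"
      using lim2[OF mult_in[OF x y]] tendsto_mult[OF lim[OF x] lim[OF y]] by (intro LIMSEQ_le) auto
  qed
  moreover have "q' \<le> q"
    using le_q square_seminormD(1)[OF q] by (auto simp: le_fun_def q'_def)
  ultimately show ?thesis
    using lim le unfolding f_def by blast
qed

text \<open>Zorn's lemma for the reversed pointwise order, with \<open>spr\<close> on
  \<open>C\<close> as an element to start from. The pointwise infimum of a nonempty chain is again
  admissible, and the value at \<open>a\<close> is constant along the chain.\<close>

lemma minimal_seminorm:
  assumes a: "a \<in> C" "spr a > 0"
  obtains q where "square_seminorm q" "q a = spr a"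
    "\<And>q'. square_seminorm q' \<Longrightarrow> q' a = spr a \<Longrightarrow> q' \<le> q \<Longrightarrow> q' = q"
proof -
  define Q where "Q = {q. square_seminorm q \<and> q a = spr a}"
  define r0 where "r0 x = (if x \<in> C then spr x else 0)" for x
  have "square_seminorm r0"
    unfolding square_seminorm_def
    using spr_add[OF comm] spr_mult[OF comm]
    by (simp add: r0_def spr_nonneg spr_scaleC spr_square add_in mult_in scaleC_in)
  then have r0: "r0 \<in> Q" using a by (simp add: Q_def r0_def)
  have "\<exists>m\<in>Q. \<forall>q\<in>Q. m \<ge> q \<longrightarrow> q = m"
  proof (rule predicate_Zorn)
    show "partial_order_on Q (relation_of (\<lambda>p q. p \<ge> q) Q)"
      by (rule partial_order_on_relation_ofI) auto
    fix \<C> assume ch: "\<C> \<in> Chains (relation_of (\<lambda>p q::'a \<Rightarrow> real. p \<ge> q) Q)"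
    show "\<exists>u\<in>Q. \<forall>q\<in>\<C>. q \<ge> u"
    proof (cases "\<C> = {}")
      case True
      then show ?thesis using r0 by auto
    next
      case False
      have sub: "\<C> \<subseteq> Q"
        using ch by (auto simp: Chains_def relation_of_def)
      have total: "p \<le> q \<or> q \<le> p" if "p \<in> \<C>" "q \<in> \<C>" for p q
        using ch that by (auto simp: Chains_def relation_of_def)
      have q: "square_seminorm p" if "p \<in> \<C>" for p
        using sub that by (auto simp: Q_def)
      have nonneg: "0 \<le> p x" if "p \<in> \<C>" for p x
        using square_seminormD(1,2)[OF q[OF that], of x] by (cases "x \<in> C") auto
      define u where "u x = (INF p\<in>\<C>. p x)" for x
      have u_le: "u x \<le> p x" if "p \<in> \<C>" for p x
        unfolding u_def using that nonneg by (intro cINF_lower bdd_belowI[of _ 0]) auto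
      have u_less: "\<exists>p\<in>\<C>. p x < s" if "u x < s" for x s
      proof -
        have "bdd_below ((\<lambda>p. p x) ` \<C>)"
          using nonneg by (auto intro!: bdd_belowI[of _ 0])
        with that False show ?thesis
          unfolding u_def by (simp add: cINF_less_iff)
      qed
      have u_nonneg: "0 \<le> u x" for x
        unfolding u_def using False nonneg by (intro cINF_greatest) auto
      have u_ge: "s \<le> u x" if "\<And>p. p \<in> \<C> \<Longrightarrow> s \<le> p x" for x s
        unfolding u_def using False that by (intro cINF_greatest) auto
      \<comment> \<open>Totality of the chain gives one seminorm that is nearly minimal at two
        points at once; this is what lets the rules for sums and products pass to the
        infimum.\<close>
      have both: "\<exists>p\<in>\<C>. p x < s \<and> p y < t" if st: "u x < s" "u y < t" for x y s t
      proof -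
        obtain p where p: "p \<in> \<C>" "p x < s" using u_less[OF st(1)] by auto
        obtain p' where p': "p' \<in> \<C>" "p' y < t" using u_less[OF st(2)] by auto
        from total[OF p(1) p'(1)] show ?thesis
        proof
          assume "p \<le> p'"
          then have "p y \<le> p' y" by (rule le_funD)
          with p p' show ?thesis by (intro bexI[of _ p]) auto
        next
          assume "p' \<le> p"
          then have "p' x \<le> p x" by (rule le_funD)
          with p p' show ?thesis by (intro bexI[of _ p']) auto
        qed
      qed
      have add: "u (x + y) \<le> u x + u y" if "x \<in> C" "y \<in> C" for x y
      proof (rule field_le_epsilon)
        fix e :: real assume "e > 0"
        then obtain p where p: "p \<in> \<C>" "p x < u x + e/2" "p y < u y + e/2"
          using both[of x "u x + e/2" y "u y + e/2"] by auto
        with u_le[of p "x + y"] square_seminormD(3)[OF q that, of p]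
        show "u (x + y) \<le> u x + u y + e" by simp
      qed
      have mult: "u (x * y) \<le> u x * u y" if "x \<in> C" "y \<in> C" for x y
      proof -
        have "(\<lambda>n. (u x + inverse (real (Suc n))) * (u y + inverse (real (Suc n))))
            \<longlonglongrightarrow> (u x + 0) * (u y + 0)"
          by (intro tendsto_intros LIMSEQ_inverse_real_of_nat)
        moreover have "u (x * y) \<le> (u x + inverse (real (Suc n))) * (u y + inverse (real (Suc n)))" for n
        proof -
          obtain p where p: "p \<in> \<C>" "p x < u x + inverse (real (Suc n))" "p y < u y + inverse (real (Suc n))"
            using both[of x "u x + inverse (real (Suc n))" y "u y + inverse (real (Suc n))"] by auto
          have "u (x * y) \<le> p x * p y"
            using u_le[of p "x * y"] square_seminormD(5)[OF q that, of p] p by simp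
          also have "\<dots> \<le> (u x + inverse (real (Suc n))) * (u y + inverse (real (Suc n)))"
            using p nonneg u_nonneg[of x] by (intro mult_mono) auto
          finally show ?thesis .
        qed
        ultimately show ?thesis by (intro LIMSEQ_le_const) auto
      qed
      have scale: "u (c *\<^sub>C x) = cmod c * u x" if "x \<in> C" for c x
      proof -
        have le: "cmod c * u x \<le> u (c *\<^sub>C x)" if "x \<in> C" for c x
          using that u_le by (intro u_ge) (auto simp: square_seminormD(4)[OF q] mult_left_mono)
        show ?thesis
        proof (cases "c = 0")
          case True
          have "u 0 \<le> 0"
            using False u_le[of _ 0] square_seminormD(4)[OF q zero_in, of _ 0] by fastforce
          then show ?thesis using u_nonneg[of 0] True by simp
        next
          case False
          have "cmod (inverse c) * u (c *\<^sub>C x) \<le> u x"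
            using le[of "c *\<^sub>C x" "inverse c"] False that by (simp add: scaleC_in scaleC_scaleC)
          then have "cmod c * (cmod (inverse c) * u (c *\<^sub>C x)) \<le> cmod c * u x"
            by (rule mult_left_mono) simp
          moreover have "cmod c * (cmod (inverse c) * u (c *\<^sub>C x)) = u (c *\<^sub>C x)"
            using False by (simp add: norm_inverse)
          ultimately have "u (c *\<^sub>C x) \<le> cmod c * u x" by simp
          with le[OF that, of c] show ?thesis by simp
        qed
      qed
      have square: "u (x * x) = u x * u x" if "x \<in> C" for x
      proof (rule antisym[OF mult[OF that that]])
        show "u x * u x \<le> u (x * x)"
        proof (rule u_ge)
          fix p assume p: "p \<in> \<C>"
          then have "u x * u x \<le> p x * p x"
            by (intro mult_mono u_le u_nonneg nonneg)
          also have "\<dots> = p (x * x)"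
            using square_seminormD(6)[OF q[OF p]] that by simp
          finally show "u x * u x \<le> p (x * x)" .
        qed
      qed
      obtain p where p: "p \<in> \<C>" using False by blast
      have "u a = spr a"
      proof (rule antisym)
        show "u a \<le> spr a" using u_le[OF p, of a] square_seminormD(7)[OF q[OF p] a(1)] by simp
        show "spr a \<le> u a" using sub by (intro u_ge) (auto simp: Q_def)
      qed
      moreover have "u x = 0" if "x \<notin> C" for x
        using u_le[OF p, of x] u_nonneg[of x] square_seminormD(1)[OF q[OF p] that] by simp
      moreover have "u x \<le> spr x" if "x \<in> C" for x
        using u_le[OF p, of x] square_seminormD(7)[OF q[OF p] that] by simp
      ultimately have "square_seminorm u" "u a = spr a"
        unfolding square_seminorm_def using u_nonneg add scale mult square by blast+
      then have "u \<in> Q" by (simp add: Q_def)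
      with u_le show ?thesis by (auto simp: le_fun_def)
    qed
  qed
  then show ?thesis using that by (auto simp: Q_def)
qed

section \<open>From minimal seminorms to characters\<close>

definition multiplicative_seminorm :: "('a \<Rightarrow> real) \<Rightarrow> bool" where
  "multiplicative_seminorm q \<longleftrightarrow> square_seminorm q \<and> q 1 = 1 \<and> (\<forall>x\<in>C. \<forall>y\<in>C. q (x * y) = q x * q y)"

text \<open>Localising at \<open>b\<close> keeps the value at \<open>a\<close> as soon as
  \<open>q (b ^ n * a) = q b ^ n * q a\<close>, and minimality then gives multiplicativity at
  \<open>b\<close>. For b = a this is exactness on powers; the resulting rule for products with
  \<open>a\<close> gives it for every \<open>b\<close> with \<open>q b > 0\<close>. If
  \<open>q b = 0\<close>, both sides vanish.\<close>

lemma multiplicative_seminorm_exists: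
  assumes a: "a \<in> C" "spr a > 0"
  obtains q where "multiplicative_seminorm q" "q a = spr a"
proof -
  obtain q where q: "square_seminorm q" "q a = spr a"
    and min: "\<And>q'. square_seminorm q' \<Longrightarrow> q' a = spr a \<Longrightarrow> q' \<le> q \<Longrightarrow> q' = q"
    using minimal_seminorm a by metis
  have "q a > 0" using a q by simp
  have mult_a: "q (a * x) = q a * q x" if x: "x \<in> C" for x
  proof -
    obtain q' where q': "square_seminorm q'" "q' \<le> q"
      and lim: "\<And>x. x \<in> C \<Longrightarrow> (\<lambda>n. q (a ^ n * x) / q a ^ n) \<longlonglongrightarrow> q' x"
      and le: "\<And>x n. x \<in> C \<Longrightarrow> q' x \<le> q (a ^ n * x) / q a ^ n"
      using localised_seminorm[OF q(1) a(1) \<open>q a > 0\<close>] by blast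
    have "q (a ^ n * a) / q a ^ n = q a" for n
      using square_seminorm_power[OF q(1) a(1) \<open>q a > 0\<close>, of "Suc n"] \<open>q a > 0\<close>
      by (simp add: power_commutes)
    with lim[OF a(1)] have "q' a = spr a"
      by (simp add: LIMSEQ_const_iff q(2))
    with min q' have "q' = q" by blast
    with le[OF x, of 1] \<open>q a > 0\<close> have "q a * q x \<le> q (a * x)"
      by (simp add: field_simps)
    with square_seminormD(5)[OF q(1) a(1) x] show ?thesis by simp
  qed
  have mult: "q (b * x) = q b * q x" if b: "b \<in> C" and x: "x \<in> C" for b x
  proof (cases "q b > 0")
    case True
    obtain q' where q': "square_seminorm q'" "q' \<le> q"
      and lim: "\<And>x. x \<in> C \<Longrightarrow> (\<lambda>n. q (b ^ n * x) / q b ^ n) \<longlonglongrightarrow> q' x"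
      and le: "\<And>x n. x \<in> C \<Longrightarrow> q' x \<le> q (b ^ n * x) / q b ^ n"
      using localised_seminorm[OF q(1) b True] by blast
    have "q (b ^ n * a) / q b ^ n = q a" for n
      using square_seminorm_power[OF q(1) b True, of n] mult_a[OF power_in[OF b], of n] True
        comm[OF a(1) power_in[OF b], of n] by simp
    with lim[OF a(1)] have "q' a = spr a"
      by (simp add: LIMSEQ_const_iff q(2))
    with min q' have "q' = q" by blast
    with le[OF x, of 1] True have "q b * q x \<le> q (b * x)"
      by (simp add: field_simps)
    with square_seminormD(5)[OF q(1) b x] show ?thesis by simp
  next
    case False
    then have "q b = 0" using square_seminormD(2)[OF q(1) b] by simp
    with square_seminormD(5)[OF q(1) b x] square_seminormD(2)[OF q(1) mult_in[OF b x]]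
    show ?thesis by simp
  qed
  have "q 1 = 1"
    using mult[OF a(1) one_in] \<open>q a > 0\<close> by simp
  with mult q have "multiplicative_seminorm q"
    unfolding multiplicative_seminorm_def by blast
  from that[OF this q(2)] show ?thesis .
qed

lemma multiplicative_seminormD:
  assumes mq: "multiplicative_seminorm q"
  shows "square_seminorm q" and "x \<in> C \<Longrightarrow> y \<in> C \<Longrightarrow> q (x * y) = q x * q y"
    and "q (l *\<^sub>C 1) = cmod l" and "x \<in> C \<Longrightarrow> y \<in> C \<Longrightarrow> q (x - y) \<le> q x + q y"
proof -
  show q: "square_seminorm q" and "x \<in> C \<Longrightarrow> y \<in> C \<Longrightarrow> q (x * y) = q x * q y"
    using mq by (auto simp: multiplicative_seminorm_def)
  show "q (l *\<^sub>C 1) = cmod l"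
    using square_seminormD(4)[OF q one_in] mq by (simp add: multiplicative_seminorm_def)
  show "q (x - y) \<le> q x + q y" if "x \<in> C" "y \<in> C"
    using square_seminormD(3)[OF q that(1) minus_in[OF that(2)]] square_seminormD(4)[OF q that(2), of "-1"]
    by (simp add: scaleC_minus_one)
qed

text \<open>For a multiplicative seminorm, if the distances from \<open>y\<close> to the scalars are at least \<open>m\<close>,
  then those from \<open>y * y\<close> are at least \<open>m * m\<close>; iterating
  \<open>y\<^sup>2 - \<mu>\<^sup>2 = (y - \<mu>) (y + \<mu>)\<close> shows that the scalars around a
  minimiser are again minimisers.\<close>

lemma gelfand_mazur:
  assumes mq: "multiplicative_seminorm q" and x: "x \<in> C"
  shows "\<exists>l. q (x - l *\<^sub>C 1) = 0"
proof -
  note q = multiplicative_seminormD(1)[OF mq] and mult = multiplicative_seminormD(2)[OF mq]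
    and qsc = multiplicative_seminormD(3)[OF mq] and tri = multiplicative_seminormD(4)[OF mq]
  have sc: "l *\<^sub>C 1 \<in> C" for l by (intro scaleC_in one_in)
  define f where "f l = q (x - l *\<^sub>C 1)" for l
  have f_in: "x - l *\<^sub>C 1 \<in> C" for l by (intro diff_in x sc)
  have lip: "f l \<le> f k + cmod (k - l)" for k l
  proof -
    have "x - l *\<^sub>C 1 = (x - k *\<^sub>C 1) + (k - l) *\<^sub>C 1"
      by (simp add: scaleC_diff_left)
    then show ?thesis
      using square_seminormD(3)[OF q f_in[of k] sc[of "k - l"]] qsc[of "k - l"] by (simp only: f_def)
  qed
  have cont: "continuous_on UNIV f"
  proof (rule continuous_onI)
    fix k and e :: real assume "e > 0"
    have "dist (f l) (f k) \<le> dist l k" for l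
      using lip[of l k] lip[of k l] by (auto simp: dist_norm abs_le_iff norm_minus_commute)
    then show "\<exists>d>0. \<forall>l\<in>UNIV. dist l k < d \<longrightarrow> dist (f l) (f k) \<le> e"
      using \<open>e > 0\<close> by (intro exI[of _ e]) (auto intro: order_trans less_imp_le)
  qed
  have large: "cmod l - q x \<le> f l" for l
  proof -
    have "l *\<^sub>C 1 = x - (x - l *\<^sub>C 1)" by simp
    then show ?thesis
      using tri[OF x f_in[of l]] qsc[of l] by (simp add: f_def)
  qed
  \<comment> \<open>Outside this ball \<open>large\<close> gives \<open>f l > q x\<close>, and
    \<open>q x = f 0\<close>, so a minimiser on the ball is a global one.\<close>
  obtain l0 where "\<forall>l\<in>cball 0 (2 * q x). f l0 \<le> f l"
    using continuous_attains_inf[of "cball 0 (2 * q x)" f] square_seminormD(2)[OF q x]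
      continuous_on_subset[OF cont, of "cball 0 (2 * q x)"] by auto
  then have l0: "f l0 \<le> f l" if "cmod l \<le> 2 * q x" for l using that by simp
  have min: "f l0 \<le> f l" for l
  proof (cases "cmod l \<le> 2 * q x")
    case False
    have "f l0 \<le> f 0" using l0[of 0] square_seminormD(2)[OF q x] by simp
    also have "f 0 = q x" by (simp add: f_def)
    also have "\<dots> \<le> f l" using large[of l] False by linarith
    finally show ?thesis .
  qed (use l0 in auto)
  define m where "m = f l0"
  have m_nonneg: "m \<ge> 0" using square_seminormD(2)[OF q f_in] by (simp add: m_def f_def)
  have "m = 0"
  proof (rule ccontr)
    assume "m \<noteq> 0"
    then have m: "m > 0" using m_nonneg by simp
    have shift: "f (l + \<mu>) = m" if l: "f l = m" and \<mu>: "cmod \<mu> < m" for l \<mu>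
    proof -
      define y where "y = x - l *\<^sub>C 1"
      have y: "y \<in> C" "q y = m" using f_in l by (auto simp: y_def f_def)
      have ybelow: "m \<le> q (y - k *\<^sub>C 1)" for k
      proof -
        have "y - k *\<^sub>C 1 = x - (l + k) *\<^sub>C 1" by (simp add: y_def scaleC_add_left)
        then show ?thesis using min[of "l + k"] by (simp add: f_def m_def)
      qed
      define Y where "Y n = y ^ (2 ^ n)" for n :: nat
      define M where "M n = \<mu> ^ (2 ^ n)" for n :: nat
      have Y_in: "Y n \<in> C" for n by (simp add: Y_def power_in y)
      have Suc: "Y (Suc n) = Y n * Y n" "M (Suc n) = M n * M n" for n
        by (simp_all add: Y_def M_def power_add[symmetric] mult_2)
      have factor: "Z * Z - (k * k) *\<^sub>C 1 = (Z - k *\<^sub>C 1) * (Z + k *\<^sub>C 1)" for Z :: 'a and k :: complex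
        by (simp add: algebra_simps scaleC_mult_left scaleC_mult_right scaleC_scaleC scaleC_diff_right)
      have below: "m ^ (2 ^ n) \<le> q (Y n - k *\<^sub>C 1)" for n k
      proof (induction n arbitrary: k)
        case 0
        then show ?case using ybelow by (simp add: Y_def)
      next
        case (Suc n)
        \<comment> \<open>With a complex square root of \<open>k\<close>, both factors of the square
          minus \<open>k\<close> are distances to scalars, to which the induction hypothesis
          applies.\<close>
        obtain k' where k': "k = k' * k'" using power2_csqrt[of k] by (metis power2_eq_square)
        have plus: "Y n + k' *\<^sub>C 1 = Y n - (- k') *\<^sub>C 1" by (simp add: scaleC_minus_left)
        have "m ^ (2 ^ n) * m ^ (2 ^ n) \<le> q (Y n - k' *\<^sub>C 1) * q (Y n + k' *\<^sub>C 1)"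
          unfolding plus using m Suc.IH
          by (intro mult_mono Suc.IH square_seminormD(2)[OF q] diff_in Y_in sc) simp
        also have "\<dots> = q (Y (Suc n) - k *\<^sub>C 1)"
          using mult[of "Y n - k' *\<^sub>C 1" "Y n + k' *\<^sub>C 1"]
          by (simp add: Suc k' factor diff_in add_in Y_in sc \<open>\<And>n. Y (Suc n) = Y n * Y n\<close>)
        finally show ?case by (simp add: power_add[symmetric] mult_2)
      qed
      \<comment> \<open>The induction multiplies out the factorisation of y^(2^n) - \<mu>^(2^n) into
        y - \<mu> and the factors \<open>Y k + M k\<close> with k < n, each of seminorm at least
        m^(2^k). The factor \<open>m\<close> on the right avoids the exponent 2^n - 1.\<close>
      have prod: "q (y - \<mu> *\<^sub>C 1) * m ^ (2 ^ n) \<le> m * q (Y n - M n *\<^sub>C 1)" for n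
      proof (induction n)
        case 0
        then show ?case by (simp add: Y_def M_def mult.commute)
      next
        case IH: (Suc n)
        have plus: "Y n + M n *\<^sub>C 1 = Y n - (- M n) *\<^sub>C 1" by (simp add: scaleC_minus_left)
        have "q (y - \<mu> *\<^sub>C 1) * m ^ (2 ^ n) * m ^ (2 ^ n)
            \<le> m * q (Y n - M n *\<^sub>C 1) * q (Y n + M n *\<^sub>C 1)"
          unfolding plus using m
          by (intro mult_mono IH below mult_nonneg_nonneg square_seminormD(2)[OF q] diff_in Y_in sc) simp_all
        also have "\<dots> = m * q (Y (Suc n) - M (Suc n) *\<^sub>C 1)"
          using mult[of "Y n - M n *\<^sub>C 1" "Y n + M n *\<^sub>C 1"]
          by (simp add: Suc factor diff_in add_in Y_in sc)
        finally show ?case by (simp add: power_add mult_2 mult.assoc)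
      qed
      have up: "q (y - \<mu> *\<^sub>C 1) \<le> m * (1 + (cmod \<mu> / m) ^ (2 ^ n))" for n
      proof -
        have "q (Y n) = m ^ (2 ^ n)"
          using square_seminorm_power[OF q y(1)] y(2) m by (simp add: Y_def)
        then have "q (Y n - M n *\<^sub>C 1) \<le> m ^ (2 ^ n) + cmod \<mu> ^ (2 ^ n)"
          using tri[OF Y_in[of n] sc[of "M n"]] by (simp add: qsc M_def norm_power)
        then have "q (y - \<mu> *\<^sub>C 1) * m ^ (2 ^ n) \<le> m * (m ^ (2 ^ n) + cmod \<mu> ^ (2 ^ n))"
          using order_trans[OF prod[of n] mult_left_mono] m by simp
        then show ?thesis using m by (simp add: field_simps)
      qed
      have "strict_mono (\<lambda>n. 2 ^ n :: nat)" by (simp add: strict_mono_def)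
      then have "(\<lambda>n. (cmod \<mu> / m) ^ (2 ^ n)) \<longlonglongrightarrow> 0"
        using LIMSEQ_subseq_LIMSEQ[OF LIMSEQ_power_zero[of "cmod \<mu> / m"], of "\<lambda>n. 2 ^ n"] \<mu> m
        by (simp add: o_def)
      then have "(\<lambda>n. m * (1 + (cmod \<mu> / m) ^ (2 ^ n))) \<longlonglongrightarrow> m * (1 + 0)"
        by (intro tendsto_intros)
      then have "q (y - \<mu> *\<^sub>C 1) \<le> m"
        using LIMSEQ_le_const[of _ "m * (1 + 0)" "q (y - \<mu> *\<^sub>C 1)"] up by simp
      moreover have "q (y - \<mu> *\<^sub>C 1) = f (l + \<mu>)"
        by (simp add: y_def f_def scaleC_add_left algebra_simps)
      ultimately show ?thesis using min[of "l + \<mu>"] by (simp add: m_def)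
    qed
    \<comment> \<open>Steps of length m/2, which is less than m, lead through minimisers to
      arbitrarily large modulus, in contradiction to \<open>large\<close>.\<close>
    have all: "f (l0 + of_nat n * complex_of_real (m / 2)) = m" for n
    proof (induction n)
      case (Suc n)
      from shift[OF this, of "complex_of_real (m / 2)"] m show ?case
        by (simp add: norm_divide add_divide_distrib distrib_right add.assoc add.commute[of "complex_of_real m / 2"])
    qed (simp add: m_def)
    obtain n where "real n > (q x + m + cmod l0) / (m / 2)"
      using reals_Archimedean2 by blast
    then have "real n * (m / 2) > q x + m + cmod l0"
      using m by (simp add: field_simps)
    moreover have "real n * (m / 2) \<le> cmod (l0 + of_nat n * complex_of_real (m / 2)) + cmod l0"
    proof -
      have "cmod (of_nat n * complex_of_real (m / 2)) = real n * (m / 2)"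
        using m by (simp add: norm_mult norm_divide)
      then show ?thesis
        using norm_triangle_ineq4[of "l0 + of_nat n * complex_of_real (m / 2)" l0] by simp
    qed
    ultimately show False
      using large[of "l0 + of_nat n * complex_of_real (m / 2)"] all[of n] by simp
  qed
  then show ?thesis by (auto simp: m_def f_def)
qed

definition character :: "('a \<Rightarrow> complex) \<Rightarrow> bool" where
  "character h \<longleftrightarrow> (\<forall>x\<in>C. \<forall>y\<in>C. h (x + y) = h x + h y) \<and>
    (\<forall>c. \<forall>x\<in>C. h (c *\<^sub>C x) = c * h x) \<and> (\<forall>x\<in>C. \<forall>y\<in>C. h (x * y) = h x * h y) \<and>
    h 1 = 1 \<and> (\<forall>x\<in>C. cmod (h x) \<le> norm x)"

text \<open>By Gelfand-Mazur each \<open>x\<close> has distance 0 from a scalar, which is unique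
  because \<open>q\<close> is the modulus on scalars; it is taken as \<open>h x\<close>. The
  algebraic laws follow from uniqueness, and \<open>cmod (h x) = q x\<close> turns the bound by
  \<open>spr\<close> into contractivity.\<close>

lemma character_exists:
  assumes a: "a \<in> C" "spr a > 0"
  obtains h where "character h" "cmod (h a) = spr a"
proof -
  obtain q where mq: "multiplicative_seminorm q" and qa: "q a = spr a"
    using multiplicative_seminorm_exists a by metis
  note q = multiplicative_seminormD(1)[OF mq] and mult = multiplicative_seminormD(2)[OF mq]
    and qsc = multiplicative_seminormD(3)[OF mq] and tri = multiplicative_seminormD(4)[OF mq]
  have sc: "l *\<^sub>C 1 \<in> C" for l by (intro scaleC_in one_in)
  obtain h where h: "\<And>x. x \<in> C \<Longrightarrow> q (x - h x *\<^sub>C 1) = 0"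
    using gelfand_mazur[OF mq] by metis
  have uniq: "h x = l" if "x \<in> C" "q (x - l *\<^sub>C 1) \<le> 0" for x l
  proof -
    have "(l - h x) *\<^sub>C 1 = (x - h x *\<^sub>C 1) - (x - l *\<^sub>C 1)"
      by (simp add: scaleC_diff_left)
    moreover have "q ((x - h x *\<^sub>C 1) - (x - l *\<^sub>C 1)) \<le> 0"
      using tri[OF diff_in[OF that(1) sc[of "h x"]] diff_in[OF that(1) sc[of l]]]
        h[OF that(1)] that(2) by simp
    ultimately have "cmod (l - h x) \<le> 0"
      using qsc[of "l - h x"] by simp
    then show ?thesis by simp
  qed
  have abs: "cmod (h x) = q x" if "x \<in> C" for x
    using tri[OF that diff_in[OF that sc[of "h x"]]] h[OF that] qsc[of "h x"]
      square_seminormD(3)[OF q sc[of "h x"] diff_in[OF that sc[of "h x"]]] by simp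
  have "character h"
    unfolding character_def
  proof (intro conjI ballI allI)
    fix x y c
    show "h 1 = 1" by (rule uniq) (use square_seminormD(4)[OF q one_in, of 0] one_in in auto)
    assume x: "x \<in> C"
    show "cmod (h x) \<le> norm x"
      using abs[OF x] square_seminormD(7)[OF q x] spr_le_norm[of x] by simp
    have "c *\<^sub>C x - (c * h x) *\<^sub>C 1 = c *\<^sub>C (x - h x *\<^sub>C 1)"
      by (simp add: scaleC_diff_right scaleC_scaleC)
    then show "h (c *\<^sub>C x) = c * h x"
      using h[OF x] square_seminormD(4)[OF q, of "x - h x *\<^sub>C 1"] x
      by (intro uniq) (auto simp: scaleC_in diff_in sc)
    assume y: "y \<in> C"
    have "x + y - (h x + h y) *\<^sub>C 1 = (x - h x *\<^sub>C 1) + (y - h y *\<^sub>C 1)"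
      by (simp add: scaleC_add_left)
    then have "q (x + y - (h x + h y) *\<^sub>C 1) \<le> 0"
      using h[OF x] h[OF y] square_seminormD(3)[OF q diff_in[OF x sc[of "h x"]] diff_in[OF y sc[of "h y"]]]
      by (simp only:)
    then show "h (x + y) = h x + h y"
      using x y by (intro uniq add_in)
    have "x * y - (h x * h y) *\<^sub>C 1 = (x - h x *\<^sub>C 1) * y + h x *\<^sub>C (y - h y *\<^sub>C 1)"
      by (simp add: algebra_simps scaleC_diff_right scaleC_scaleC scaleC_mult_left)
    then have "q (x * y - (h x * h y) *\<^sub>C 1) \<le> 0"
      using h[OF x] h[OF y] mult[of "x - h x *\<^sub>C 1" y] square_seminormD(4)[OF q, of "y - h y *\<^sub>C 1" "h x"]
        square_seminormD(3)[OF q, of "(x - h x *\<^sub>C 1) * y" "h x *\<^sub>C (y - h y *\<^sub>C 1)"] x y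
      by (simp add: mult_in scaleC_in diff_in sc)
    then show "h (x * y) = h x * h y"
      using x y by (intro uniq) (auto simp: mult_in)
  qed
  with abs[OF a(1)] qa that show ?thesis by simp
qed

text \<open>This turns pointwise information on character values into growth bounds for powers: it
  yields both the convergence of the power series and the vanishing of \<open>spr\<close>
  below.\<close>

lemma spr_leI:
  assumes "a \<in> C" "\<And>h. character h \<Longrightarrow> cmod (h a) \<le> B" "B \<ge> 0"
  shows "spr a \<le> B"
proof (cases "spr a > 0")
  case True
  with character_exists[OF assms(1)] assms(2) show ?thesis by metis
qed (use assms(3) in auto)

lemma characterD:
  assumes "character h"
  shows "x \<in> C \<Longrightarrow> y \<in> C \<Longrightarrow> h (x + y) = h x + h y"
    and "x \<in> C \<Longrightarrow> h (c *\<^sub>C x) = c * h x"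
    and "x \<in> C \<Longrightarrow> y \<in> C \<Longrightarrow> h (x * y) = h x * h y"
    and "h 1 = 1" and "x \<in> C \<Longrightarrow> cmod (h x) \<le> norm x"
    and "x \<in> C \<Longrightarrow> y \<in> C \<Longrightarrow> h (x - y) = h x - h y" and "h 0 = 0"
    and "x \<in> C \<Longrightarrow> h (x ^ n) = h x ^ n"
    and "(\<And>i. i \<in> I \<Longrightarrow> f i \<in> C) \<Longrightarrow> h (sum f I) = (\<Sum>i\<in>I. h (f i))"
proof -
  have *: "(\<forall>x\<in>C. \<forall>y\<in>C. h (x + y) = h x + h y) \<and>
    (\<forall>c. \<forall>x\<in>C. h (c *\<^sub>C x) = c * h x) \<and> (\<forall>x\<in>C. \<forall>y\<in>C. h (x * y) = h x * h y) \<and>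
    h 1 = 1 \<and> (\<forall>x\<in>C. cmod (h x) \<le> norm x)"
    using assms by (simp add: character_def)
  show add: "x \<in> C \<Longrightarrow> y \<in> C \<Longrightarrow> h (x + y) = h x + h y" for x y
    using * by blast
  show sc: "x \<in> C \<Longrightarrow> h (c *\<^sub>C x) = c * h x" for c x
    using * by blast
  show mult: "x \<in> C \<Longrightarrow> y \<in> C \<Longrightarrow> h (x * y) = h x * h y" for x y
    using * by blast
  show one: "h 1 = 1" and "x \<in> C \<Longrightarrow> cmod (h x) \<le> norm x"
    using * by blast+
  show "h (x - y) = h x - h y" if "x \<in> C" "y \<in> C"
    using add[OF that(1) minus_in[OF that(2)]] sc[OF that(2), of "-1"]
    by (simp add: scaleC_minus_one)
  show zero: "h 0 = 0" using sc[OF zero_in, of 0] by simp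
  show "x \<in> C \<Longrightarrow> h (x ^ n) = h x ^ n"
    by (induction n) (auto simp: one mult power_in)
  show "(\<And>i. i \<in> I \<Longrightarrow> f i \<in> C) \<Longrightarrow> h (sum f I) = (\<Sum>i\<in>I. h (f i))"
    by (induction I rule: infinite_finite_induct) (auto simp: zero add sum_in)
qed

lemma character_tendsto:
  assumes h: "character h" and f: "\<forall>\<^sub>F i in F. f i \<in> C" and L: "L \<in> C" and lim: "(f \<longlongrightarrow> L) F"
  shows "((\<lambda>i. h (f i)) \<longlongrightarrow> h L) F"
proof (rule Lim_transform_bound[where g = "\<lambda>i. f i - L", THEN LIM_zero_cancel])
  show "\<forall>\<^sub>F i in F. cmod (h (f i) - h L) \<le> norm (f i - L)"
    using f by eventually_elim (metis L h characterD(5,6) diff_in)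
  show "((\<lambda>i. f i - L) \<longlongrightarrow> 0) F" using lim by (rule LIM_zero)
qed

lemma character_sums:
  assumes h: "character h" and f: "\<And>i. f i \<in> C" and sums: "f sums L"
  shows "L \<in> C" and "(\<lambda>i. h (f i)) sums h L"
proof -
  have s: "(\<lambda>n. \<Sum>i<n. f i) \<longlonglongrightarrow> L" using sums by (simp add: sums_def)
  show L: "L \<in> C"
    by (rule closed_sequentially[OF closed_C _ s]) (auto intro: sum_in f)
  have "(\<lambda>n. h (\<Sum>i<n. f i)) \<longlonglongrightarrow> h L"
    by (rule character_tendsto[OF h _ L s]) (simp add: sum_in f)
  then show "(\<lambda>i. h (f i)) sums h L"
    by (simp add: sums_def characterD(9)[OF h f])
qed

end

section \<open>A logarithm of the semigroup\<close>

text \<open>Convergence is governed by the growth rate and not by the norm, so a power series may be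
  applied to an element of large norm whose character values are small.\<close>

lemma growth_summable:
  fixes x :: "'a::complex_banach_algebra"
  assumes "growth x s" "summable (\<lambda>n. cmod (c n) * s ^ n)"
  shows "summable (\<lambda>n. c n *\<^sub>C x ^ n)"
proof -
  obtain K where K: "\<And>n. norm (x ^ n) \<le> K * s ^ n" using growthE assms(1) by metis
  have "norm (c n *\<^sub>C x ^ n) \<le> K * (cmod (c n) * s ^ n)" for n
    using mult_left_mono[OF K[of n] norm_ge_zero[of "c n"]] by (simp add: norm_scaleC mult_ac)
  then show ?thesis
    by (rule summable_comparison_test'[OF summable_mult[OF assms(2), of K], of 0])
qed

text \<open>The first bound keeps \<open>l * \<tau>\<close> in the strip where \<open>Ln\<close>
  inverts \<open>exp\<close>. The second puts the nonzero spectral values of \<open>T \<tau>\<close>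
  into a disc about 1 small enough for both power series used below.\<close>

lemma exp_near_one:
  assumes "L \<ge> 0"
  shows "\<exists>\<tau>>0. \<forall>l. cmod l \<le> L \<longrightarrow>
    cmod (l * complex_of_real \<tau>) < 1 \<and> cmod (exp (- (l * complex_of_real \<tau>)) - 1) \<le> 1 / 10"
proof -
  have "isCont exp (0::complex)" by simp
  then obtain d where d: "d > 0" "\<And>x::complex. dist x 0 < d \<Longrightarrow> dist (exp x) (exp 0) < 1 / 10"
    unfolding continuous_at_eps_delta by (metis divide_pos_pos zero_less_numeral zero_less_one)
  define \<tau> where "\<tau> = min d 1 / (2 * (L + 1))"
  have m: "0 < min d 1" using d by simp
  have \<tau>: "\<tau> > 0" using assms d by (simp add: \<tau>_def)
  have *: "cmod (l * complex_of_real \<tau>) < min d 1" if "cmod l \<le> L" for l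
  proof -
    have "cmod (l * complex_of_real \<tau>) = cmod l * \<tau>" using \<tau> by (simp add: norm_mult)
    also have "\<dots> \<le> (L + 1) * \<tau>" using that \<tau> by (intro mult_right_mono) auto
    also have "\<dots> = min d 1 / 2" using assms by (simp add: \<tau>_def field_simps)
    also have "\<dots> < min d 1" using m by linarith
    finally show ?thesis .
  qed
  have "cmod (exp (- (l * complex_of_real \<tau>)) - 1) \<le> 1 / 10" if "cmod l \<le> L" for l
    using d(2)[of "- (l * complex_of_real \<tau>)"] *[OF that] by (simp add: dist_norm)
  then show ?thesis using \<tau> * by (intro exI[of _ \<tau>]) simp
qed

text \<open>With \<open>w = z - z\<^sup>2\<close> one has \<open>1 - 4 w = (2 z - 1)\<^sup>2\<close>, so the binomial series of
  \<open>(1 - 4 w)\<^bsup>-1/2\<^esup>\<close> takes the value \<open>1 / (2 z - 1)\<close> near \<open>z = 1\<close>.\<close>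

lemma binomial_series_idempotent:
  assumes z: "cmod (z - 1) \<le> 1 / 10"
  shows "(\<lambda>n. ((- (1 / 2)) gchoose Suc n) * (- 4) ^ Suc n * (z - z * z) ^ Suc n) sums (1 / (2 * z - 1) - 1)"
proof -
  define u where "u = 2 * z - 1"
  have "cmod (u - 1) = 2 * cmod (z - 1)"
    using norm_mult[of 2 "z - 1"] by (simp add: u_def algebra_simps)
  then have "\<bar>Re (u - 1)\<bar> \<le> 1 / 5" using abs_Re_le_cmod[of "u - 1"] z by linarith
  then have "\<bar>Re u - 1\<bar> \<le> 1 / 5" by simp
  then have Re: "Re u > 0" by linarith
  then have u0: "u \<noteq> 0" by auto
  \<comment> \<open>The positive real part makes \<open>Ln (u * u)\<close> twice
    \<open>Ln u\<close>, so the principal power of \<open>u * u\<close> is 1/u and not -1/u.\<close>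
  have Im: "\<bar>Im (Ln u)\<bar> < pi / 2" using Re_Ln_pos_lt[OF u0] Re by simp
  have Ln: "Ln (u * u) = Ln u + Ln u" using Im u0 by (intro Ln_times_simple) auto
  have eq: "1 + (- 4) * (z - z * z) = u * u" by (simp add: u_def algebra_simps)
  have "cmod z \<le> 11 / 10" using norm_triangle_ineq[of "z - 1" 1] z by simp
  moreover have "cmod (z - z * z) = cmod z * cmod (z - 1)"
    using norm_mult[of z "1 - z"] by (simp add: algebra_simps norm_minus_commute)
  ultimately have "cmod (z - z * z) \<le> 11 / 10 * (1 / 10)"
    using z mult_mono[of "cmod z" "11/10" "cmod (z - 1)" "1/10"] by simp
  moreover have "cmod ((- 4) * (z - z * z)) = 4 * cmod (z - z * z)"
    by (simp only: norm_mult norm_minus_cancel norm_numeral)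
  ultimately have "cmod ((- 4) * (z - z * z)) < 1" by linarith
  from gen_binomial_complex[OF this, of "- (1 / 2)"]
  have "(\<lambda>n. ((- (1 / 2)) gchoose n) * ((- 4) * (z - z * z)) ^ n) sums ((u * u) powr (- (1 / 2)))"
    unfolding eq .
  moreover have "(u * u) powr (- (1 / 2)) = 1 / u"
    using u0 Ln by (simp add: powr_def exp_minus field_simps)
  ultimately have "(\<lambda>n. ((- (1 / 2)) gchoose Suc n) * ((- 4) * (z - z * z)) ^ Suc n) sums (1 / u - 1)"
    using sums_Suc_iff[of "\<lambda>n. ((- (1 / 2)) gchoose n) * ((- 4) * (z - z * z)) ^ n" "1 / u - 1"] by simp
  then show ?thesis unfolding u_def power_mult_distrib mult.assoc .
qed

text \<open>The radius 1/5 exceeds the bound 11/100 for \<open>spr w\<close> below, and 4 * 1/5 =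
  4/5 is inside the unit disc; convergence at 9/10 gives absolute convergence at 4/5. The index
  starts at 1 because the series is applied in an algebra that need not have an identity.\<close>

lemma summable_binomial_coefficients:
  "summable (\<lambda>n. cmod (((- (1 / 2)) gchoose Suc n) * (- 4) ^ Suc n) * (1 / 5) ^ Suc n)"
proof -
  have "summable (\<lambda>n. ((- (1 / 2) :: complex) gchoose n) * (9 / 10) ^ n)"
    by (rule sums_summable[OF gen_binomial_complex]) simp
  then have "summable (\<lambda>n. norm (((- (1 / 2) :: complex) gchoose n) * (4 / 5) ^ n))"
    by (rule powser_insidea) simp
  then have "summable (\<lambda>n. norm (((- (1 / 2) :: complex) gchoose Suc n) * (4 / 5) ^ Suc n))"
    by (subst summable_Suc_iff)
  moreover have "norm (((- (1 / 2) :: complex) gchoose Suc n) * (4 / 5) ^ Suc n)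
      = cmod (((- (1 / 2)) gchoose Suc n) * (- 4) ^ Suc n) * (1 / 5) ^ Suc n" for n
    by (simp only: norm_mult norm_power norm_divide norm_minus_cancel norm_numeral mult.assoc
        power_mult_distrib[symmetric] norm_one) simp
  ultimately show ?thesis by simp
qed

context comm_subalgebra
begin

text \<open>The characters annihilating all \<open>T t\<close> form the point at infinity of the spectrum of the
  semigroup. Boundedness of the exponents \<open>l\<close> isolates it, and \<open>T \<tau>\<close> for small \<open>\<tau>\<close> has the
  spectral values \<open>0\<close> and values close to \<open>1\<close>: the elements \<open>p\<close> and \<open>b\<close> are obtained from it by
  power series that equal \<open>1\<close>, respectively a logarithm, near \<open>1\<close> and vanish at \<open>0\<close>.\<close>

lemma semigroup_logarithm:
  assumes A: "A \<subseteq> C" "closed A" "0 \<in> A" "\<And>x y. x \<in> A \<Longrightarrow> y \<in> A \<Longrightarrow> x + y \<in> A"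
      "\<And>c x. x \<in> A \<Longrightarrow> c *\<^sub>C x \<in> A" "\<And>x y. x \<in> A \<Longrightarrow> y \<in> A \<Longrightarrow> x * y \<in> A"
    and S: "\<And>r. 0 < r \<Longrightarrow> complex_of_real r \<in> S" and T: "\<And>t. t \<in> S \<Longrightarrow> T t \<in> A" and L: "L \<ge> 0"
    and char: "\<And>h. character h \<Longrightarrow> (\<forall>x\<in>A. h x = 0) \<or>
      (\<exists>l. cmod l \<le> L \<and> (\<forall>t\<in>S. h (T t) = exp (- (l * t))))"
  shows "\<exists>p\<in>A. \<exists>b\<in>A. (\<forall>x\<in>A. spr (x - p * x) = 0) \<and>
    (\<forall>t\<in>S. \<exists>E\<in>A. (\<lambda>n. (t ^ n / fact n) *\<^sub>C (b ^ n * p)) sums E \<and> spr (E - T t) = 0)"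
proof -
  obtain \<tau> where \<tau>: "\<tau> > 0" "\<And>l. cmod l \<le> L \<Longrightarrow> cmod (l * complex_of_real \<tau>) < 1"
    "\<And>l. cmod l \<le> L \<Longrightarrow> cmod (exp (- (l * complex_of_real \<tau>)) - 1) \<le> 1 / 10"
    using exp_near_one[OF L] by blast
  have minus: "- x \<in> A" if "x \<in> A" for x using A(5)[OF that, of "-1"] by (simp add: scaleC_minus_one)
  have diff: "x - y \<in> A" if "x \<in> A" "y \<in> A" for x y using A(4)[OF that(1) minus[OF that(2)]] by simp
  have pow: "x ^ Suc n \<in> A" if "x \<in> A" for x n
    by (induction n) (use A(6) that in auto)
  have sum: "sum f I \<in> A" if "\<And>i. f i \<in> A" for f :: "nat \<Rightarrow> 'a" and I
    by (induction I rule: infinite_finite_induct) (auto simp: A that)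
  have sums_in: "X \<in> A" if "\<And>i. f i \<in> A" "f sums X" for f X
    using that(2) unfolding sums_def by (rule closed_sequentially[OF A(2), rotated]) (auto intro: sum that(1))
  have inC: "x \<in> C" if "x \<in> A" for x using that A(1) by blast
  define a where "a = T (complex_of_real \<tau>)"
  have a: "a \<in> A" unfolding a_def by (intro T S \<tau>)
  have dich: "(\<forall>x\<in>A. h x = 0) \<or> (\<exists>l. cmod l \<le> L \<and> cmod (h a - 1) \<le> 1 / 10 \<and>
      h a = exp (- (l * complex_of_real \<tau>)) \<and> (\<forall>t\<in>S. h (T t) = exp (- (l * t))))"
    if "character h" for h
    using char[OF that] \<tau> S[OF \<tau>(1)] unfolding a_def by metis
  define w where "w = a - a * a"
  have w: "w \<in> A" unfolding w_def by (intro diff A(6) a)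
  \<comment> \<open>The polynomial z - z^2 is small at both kinds of spectral values: it vanishes at
    0, and near 1 its modulus is at most 11/10 * 1/10.\<close>
  have "spr w \<le> 11 / 100"
  proof (rule spr_leI[OF inC[OF w]])
    fix h assume h: "character h"
    have kw: "h w = h a * (1 - h a)"
      using inC[OF a] by (simp add: w_def characterD(3,6)[OF h] mult_in algebra_simps)
    from dich[OF h] show "cmod (h w) \<le> 11 / 100"
    proof
      assume "\<exists>l. cmod l \<le> L \<and> cmod (h a - 1) \<le> 1 / 10 \<and>
        h a = exp (- (l * complex_of_real \<tau>)) \<and> (\<forall>t\<in>S. h (T t) = exp (- (l * t)))"
      then have z: "cmod (h a - 1) \<le> 1 / 10" by blast
      then have "cmod (h a) \<le> 11 / 10" using norm_triangle_ineq[of "h a - 1" 1] by simp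
      then have "cmod (h a) * cmod (1 - h a) \<le> 11 / 10 * (1 / 10)"
        using z by (intro mult_mono) (auto simp: norm_minus_commute)
      then show ?thesis by (simp add: kw norm_mult)
    qed (use w in simp)
  qed simp
  then have gw: "growth w (1 / 5)" by (intro growth_if_spr_less) simp
  define c :: "nat \<Rightarrow> complex" where "c n = ((- (1 / 2)) gchoose n) * (- 4) ^ n" for n
  have "summable (\<lambda>n. c n *\<^sub>C w ^ n)"
    using summable_binomial_coefficients
    by (intro growth_summable[OF gw]) (subst summable_Suc_iff[symmetric], simp only: c_def)
  then have "summable (\<lambda>n. c (Suc n) *\<^sub>C w ^ Suc n)" by (subst summable_Suc_iff)
  then obtain G where G: "(\<lambda>n. c (Suc n) *\<^sub>C w ^ Suc n) sums G" unfolding summable_def by blast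
  have GA: "G \<in> A" by (rule sums_in[OF _ G]) (intro A(5) pow w)
  \<comment> \<open>This is (a - 1/2) (1 + G) + 1/2 multiplied out, with 1 + G in the role of 1 / (2
    a - 1). The value is 1 near z = 1 and 0 at z = 0, and no multiple of the identity
    remains.\<close>
  define p where "p = a + a * G - (1 / 2) *\<^sub>C G"
  have p: "p \<in> A" unfolding p_def by (intro diff A(4-6) a GA)
  have kp: "h p = 1" if h: "character h" and z: "cmod (h a - 1) \<le> 1 / 10" for h
  proof -
    define z where "z = h a"
    have kw: "h w = z - z * z"
      using inC[OF a] by (simp add: w_def z_def characterD(3,6)[OF h] mult_in)
    have "(\<lambda>n. h (c (Suc n) *\<^sub>C w ^ Suc n)) sums h G"
      by (rule character_sums(2)[OF h _ G]) (intro scaleC_in power_in inC w)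
    moreover have "h (c (Suc n) *\<^sub>C w ^ Suc n) = c (Suc n) * (z - z * z) ^ Suc n" for n
      using characterD(2)[OF h power_in[OF inC[OF w]]] characterD(8)[OF h inC[OF w]] kw by metis
    ultimately have "(\<lambda>n. c (Suc n) * (z - z * z) ^ Suc n) sums h G" by simp
    then have kG: "h G = 1 / (2 * z - 1) - 1"
      using binomial_series_idempotent[of z] z sums_unique2 unfolding c_def z_def by blast
    have "2 * z - 1 \<noteq> 0"
    proof
      assume "2 * z - 1 = 0"
      then have "Re (2 * z - 1) = 0" by (simp only: zero_complex.simps)
      then have "\<bar>Re (z - 1)\<bar> = 1 / 2" by simp
      then show False using abs_Re_le_cmod[of "z - 1"] z by (simp add: z_def)
    qed
    then have "z + z * (1 / (2 * z - 1) - 1) - 1 / 2 * (1 / (2 * z - 1) - 1) = 1"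
      by (simp add: divide_simps) (simp add: algebra_simps)
    moreover have "h p = z + z * h G - 1 / 2 * h G"
      using inC[OF a] inC[OF GA]
      by (simp add: p_def z_def characterD(1,2,3,6)[OF h] add_in mult_in scaleC_in)
    ultimately show ?thesis by (simp add: kG)
  qed
  \<comment> \<open>A substitute for 1 - a, which need not lie in \<open>A\<close>: the values are 1
    - z near z = 1 and 0 at characters vanishing on \<open>A\<close>.\<close>
  define d where "d = p - a"
  have d: "d \<in> A" unfolding d_def by (intro diff p a)
  have kd: "h d = 1 - h a" if h: "character h" and z: "cmod (h a - 1) \<le> 1 / 10" for h
    using kp[OF that] inC[OF p] inC[OF a] by (simp add: d_def characterD(6)[OF h])
  have "spr d \<le> 1 / 10"
  proof (rule spr_leI[OF inC[OF d]])
    fix h assume h: "character h"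
    from dich[OF h] show "cmod (h d) \<le> 1 / 10"
      using kd[OF h] d by (auto simp: norm_minus_commute)
  qed simp
  then have gd: "growth d (1 / 2)" by (intro growth_if_spr_less) simp
  \<comment> \<open>The coefficients of Ln (1 - x) / \<tau> as a series in x. Division by zero gives
    \<open>e 0 = 0\<close>, so the series has no constant term.\<close>
  define e where "e n = - (1 / (complex_of_real \<tau> * of_nat n))" for n
  have "summable (\<lambda>n. cmod (e n) * (1 / 2) ^ n)"
  proof (rule summable_comparison_test'[of "\<lambda>n. 1 / \<tau> * (1 / 2) ^ n" 0])
    show "summable (\<lambda>n. 1 / \<tau> * (1 / 2 :: real) ^ n)" by (intro summable_mult summable_geometric) simp
    fix n :: nat
    have "cmod (e n) \<le> 1 / \<tau>"
    proof -
      have "cmod (e n) = 1 / (\<tau> * real n)"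
        using \<tau>(1) by (simp add: e_def norm_divide norm_mult)
      also have "\<dots> \<le> 1 / \<tau>"
      proof (cases n)
        case (Suc m)
        then show ?thesis using \<tau>(1) by (intro divide_left_mono) (auto simp: distrib_left intro!: mult_pos_pos add_pos_nonneg)
      qed (use \<tau>(1) in simp)
      finally show ?thesis .
    qed
    then have "cmod (e n) * (1 / 2) ^ n \<le> 1 / \<tau> * (1 / 2) ^ n" by (rule mult_right_mono) simp
    then show "norm (cmod (e n) * (1 / 2) ^ n) \<le> 1 / \<tau> * (1 / 2) ^ n" by simp
  qed
  then have "summable (\<lambda>n. e n *\<^sub>C d ^ n)" by (intro growth_summable[OF gd])
  then have "summable (\<lambda>n. e (Suc n) *\<^sub>C d ^ Suc n)" by (subst summable_Suc_iff)
  then obtain b where b_sums: "(\<lambda>n. e (Suc n) *\<^sub>C d ^ Suc n) sums b" unfolding summable_def by blast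
  have b: "b \<in> A" by (rule sums_in[OF _ b_sums]) (intro A(5) pow d)
  have kb: "h b = - l" if h: "character h" and l: "cmod l \<le> L" "cmod (h a - 1) \<le> 1 / 10"
      "h a = exp (- (l * complex_of_real \<tau>))" for h l
  proof -
    define z where "z = h a"
    have "(\<lambda>n. h (e (Suc n) *\<^sub>C d ^ Suc n)) sums h b"
      by (rule character_sums(2)[OF h _ b_sums]) (intro scaleC_in power_in inC d)
    moreover have "h (e (Suc n) *\<^sub>C d ^ Suc n) = e (Suc n) * (1 - z) ^ Suc n" for n
      using characterD(2)[OF h power_in[OF inC[OF d]]] characterD(8)[OF h inC[OF d]] kd[OF h l(2)]
      unfolding z_def by metis
    ultimately have s1: "(\<lambda>n. e (Suc n) * (1 - z) ^ Suc n) sums h b" by simp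
    have "cmod (z - 1) < 1" using l(2) by (simp add: z_def)
    from Ln_series'[OF this] have "(\<lambda>n. - ((1 - z) ^ n) / of_nat n) sums Ln z" by simp
    then have "(\<lambda>n. - ((1 - z) ^ Suc n) / of_nat (Suc n)) sums Ln z"
      by (subst sums_Suc_iff) simp
    then have "(\<lambda>n. - ((1 - z) ^ Suc n) / of_nat (Suc n) / complex_of_real \<tau>) sums (Ln z / complex_of_real \<tau>)"
      by (rule sums_divide)
    moreover have "- ((1 - z) ^ Suc n) / of_nat (Suc n) / complex_of_real \<tau> = e (Suc n) * (1 - z) ^ Suc n" for n
      by (simp add: e_def field_simps del: of_nat_Suc power_Suc)
    ultimately have "h b = Ln z / complex_of_real \<tau>"
      using s1 sums_unique2 by simp
    also have "Ln z = - (l * complex_of_real \<tau>)"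
    proof -
      have "\<bar>Im (l * complex_of_real \<tau>)\<bar> < 1"
        using abs_Im_le_cmod[of "l * complex_of_real \<tau>"] \<tau>(2)[OF l(1)] by linarith
      then have "\<bar>Im (l * complex_of_real \<tau>)\<bar> < pi" using pi_gt3 by linarith
      then show ?thesis unfolding z_def l(3) by (intro Ln_exp) auto
    qed
    finally show ?thesis using \<tau>(1) by simp
  qed
  have "spr (x - p * x) = 0" if x: "x \<in> A" for x
  proof -
    have "spr (x - p * x) \<le> 0"
    proof (rule spr_leI[OF inC[OF diff[OF x A(6)[OF p x]]]])
      fix h assume h: "character h"
      have "h (x - p * x) = h x - h p * h x"
        using inC[OF x] inC[OF p] by (simp add: characterD(3,6)[OF h] mult_in)
      with dich[OF h] kp[OF h] x show "cmod (h (x - p * x)) \<le> 0" by auto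
    qed simp
    then show ?thesis using spr_nonneg[of "x - p * x"] by simp
  qed
  moreover have "\<exists>E\<in>A. (\<lambda>n. (t ^ n / fact n) *\<^sub>C (b ^ n * p)) sums E \<and> spr (E - T t) = 0" if t: "t \<in> S" for t
  proof -
    have gb: "growth b (norm b + 1)" by (rule growth_norm) (auto intro: add_nonneg_pos)
    have "cmod (t ^ n / fact n) * (norm b + 1) ^ n = inverse (fact n) * (cmod t * (norm b + 1)) ^ n" for n
    proof -
      have "cmod (t ^ n / fact n) = inverse (fact n) * cmod t ^ n"
        by (simp add: norm_divide norm_power divide_inverse[of _ "fact n :: real"])
      then show ?thesis by (simp only: power_mult_distrib mult.assoc)
    qed
    then have "summable (\<lambda>n. cmod (t ^ n / fact n) * (norm b + 1) ^ n)"
      using summable_exp[of "cmod t * (norm b + 1)"] by simp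
    from growth_summable[OF gb this] obtain X where X: "(\<lambda>n. (t ^ n / fact n) *\<^sub>C b ^ n) sums X"
      unfolding summable_def by blast
    \<comment> \<open>The exponential \<open>X\<close> has the identity as its term n = 0 and is
      formed in \<open>C\<close>; multiplication by \<open>p\<close> brings every term into
      \<open>A\<close>.\<close>
    have E: "(\<lambda>n. (t ^ n / fact n) *\<^sub>C (b ^ n * p)) sums (X * p)"
      using sums_mult2[OF X, of p] by (simp add: scaleC_mult_left)
    have "b ^ n * p \<in> A" for n by (cases n) (use A(6) pow b p in auto)
    then have EA: "X * p \<in> A" by (intro sums_in[OF _ E] A(5))
    have "spr (X * p - T t) \<le> 0"
    proof (rule spr_leI[OF inC[OF diff[OF EA T[OF t]]]])
      fix h assume h: "character h"
      have k: "h (X * p - T t) = h (X * p) - h (T t)"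
        by (rule characterD(6)[OF h inC[OF EA] inC[OF T[OF t]]])
      from dich[OF h] show "cmod (h (X * p - T t)) \<le> 0"
      proof
        assume "\<exists>l. cmod l \<le> L \<and> cmod (h a - 1) \<le> 1 / 10 \<and>
          h a = exp (- (l * complex_of_real \<tau>)) \<and> (\<forall>t\<in>S. h (T t) = exp (- (l * t)))"
        then obtain l where l: "cmod l \<le> L" "cmod (h a - 1) \<le> 1 / 10"
          "h a = exp (- (l * complex_of_real \<tau>))" "h (T t) = exp (- (l * t))" using t by blast
        have X_in: "X \<in> C" and kX: "(\<lambda>n. h ((t ^ n / fact n) *\<^sub>C b ^ n)) sums h X"
        proof -
          have "(t ^ n / fact n) *\<^sub>C b ^ n \<in> C" for n by (intro scaleC_in power_in inC b)
          from character_sums[OF h this X]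
          show "X \<in> C" "(\<lambda>n. h ((t ^ n / fact n) *\<^sub>C b ^ n)) sums h X" .
        qed
        have "h ((t ^ n / fact n) *\<^sub>C b ^ n) = (t * (- l)) ^ n /\<^sub>R fact n" for n
          using characterD(2)[OF h power_in[OF inC[OF b]]] characterD(8)[OF h inC[OF b]] kb[OF h l(1-3)]
          by (simp only: power_mult_distrib scaleR_conv_of_real of_real_inverse of_real_fact) (simp add: field_simps)
        then have "(\<lambda>n. (t * (- l)) ^ n /\<^sub>R fact n) sums h X" using kX by simp
        then have "h X = exp (t * (- l))" using exp_converges sums_unique2 by blast
        then show ?thesis
          using k l(4) kp[OF h l(2)] characterD(3)[OF h X_in inC[OF p]] by (simp add: mult.commute)
      qed (use k EA T[OF t] in auto)
    qed simp
    then show ?thesis using E EA spr_nonneg[of "X * p - T t"] by (intro bexI[of _ "X * p"]) auto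
  qed
  ultimately show ?thesis using p b by blast
qed

end

section \<open>Sectors\<close>

text \<open>This linear form of the condition makes openness, convexity and closure under addition
  immediate; the polar form serves for products.\<close>

lemma sector_iff_Im:
  assumes "0 < \<gamma>" "\<gamma> < pi / 2"
  shows "z \<in> sector \<gamma> \<longleftrightarrow> \<bar>Im z\<bar> < tan \<gamma> * Re z"
proof -
  have tan: "tan \<gamma> > 0" using assms by (intro tan_gt_zero) auto
  show ?thesis
  proof (cases "Re z > 0")
    case True
    define u where "u = Im z / Re z"
    have "\<bar>arctan u\<bar> < \<gamma> \<longleftrightarrow> \<bar>u\<bar> < tan \<gamma>"
      using assms arctan_less_iff[of u "tan \<gamma>"] arctan_less_iff[of "- tan \<gamma>" u] arctan_tan[of \<gamma>]
      by (auto simp: abs_less_iff arctan_minus)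
    then have "\<bar>Arg z\<bar> < \<gamma> \<longleftrightarrow> \<bar>Im z / Re z\<bar> < tan \<gamma>"
      using True by (simp add: u_def arg_conv_arctan)
    also have "\<dots> \<longleftrightarrow> \<bar>Im z\<bar> < tan \<gamma> * Re z"
      using True by (simp add: divide_less_eq)
    finally show ?thesis using True by (simp add: sector_def)
  next
    case False
    then have "tan \<gamma> * Re z \<le> 0" using tan by (simp add: mult_nonneg_nonpos)
    then show ?thesis using False by (auto simp: sector_def)
  qed
qed

lemma rcis_in_sector:
  assumes "r > 0" "\<bar>\<theta>\<bar> < \<gamma>" "\<gamma> \<le> pi / 2"
  shows "rcis r \<theta> \<in> sector \<gamma>"
proof -
  have "cos \<theta> > 0" using assms by (intro cos_gt_zero_pi) auto
  moreover have "Arg (rcis r \<theta>) = \<theta>" using assms by (intro Arg_rcis) auto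
  ultimately show ?thesis using assms by (simp add: sector_def)
qed

lemma sectorE:
  assumes "z \<in> sector \<gamma>"
  obtains r \<theta> where "r > 0" "\<bar>\<theta>\<bar> < \<gamma>" "z = rcis r \<theta>"
proof
  show "cmod z > 0" using assms by (auto simp: sector_def)
  show "\<bar>Arg z\<bar> < \<gamma>" using assms by (auto simp: sector_def)
  show "z = rcis (cmod z) (Arg z)" by (simp add: rcis_cmod_Arg)
qed

lemma sector_mult:
  assumes "z \<in> sector \<gamma>" "w \<in> sector \<delta>" "\<gamma> + \<delta> \<le> pi / 2"
  shows "z * w \<in> sector (\<gamma> + \<delta>)"
proof -
  obtain r \<theta> where z: "r > 0" "\<bar>\<theta>\<bar> < \<gamma>" "z = rcis r \<theta>" using sectorE[OF assms(1)] .
  obtain s \<phi> where w: "s > 0" "\<bar>\<phi>\<bar> < \<delta>" "w = rcis s \<phi>" using sectorE[OF assms(2)] .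
  show ?thesis unfolding z w rcis_mult
    using z w assms by (intro rcis_in_sector) auto
qed

lemma sector_mono: "\<gamma> \<le> \<delta> \<Longrightarrow> sector \<gamma> \<subseteq> sector \<delta>"
  by (auto simp: sector_def)

lemma sector_add:
  assumes "0 < \<gamma>" "\<gamma> < pi / 2" "z \<in> sector \<gamma>" "w \<in> sector \<gamma>"
  shows "z + w \<in> sector \<gamma>"
  using assms abs_triangle_ineq[of "Im z" "Im w"] by (simp add: sector_iff_Im distrib_left)

lemma open_sector: "0 < \<gamma> \<Longrightarrow> \<gamma> < pi / 2 \<Longrightarrow> open (sector \<gamma>)"
proof -
  assume a: "0 < \<gamma>" "\<gamma> < pi / 2"
  have "sector \<gamma> = {z. \<bar>Im z\<bar> < tan \<gamma> * Re z}" using sector_iff_Im[OF a] by blast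
  moreover have "open {z. \<bar>Im z\<bar> < tan \<gamma> * Re z}"
    by (intro open_Collect_less continuous_intros)
  ultimately show ?thesis by simp
qed

lemma convex_sector: "0 < \<gamma> \<Longrightarrow> \<gamma> < pi / 2 \<Longrightarrow> convex (sector \<gamma>)"
proof (rule convexI)
  fix x y u v
  assume a: "0 < \<gamma>" "\<gamma> < pi / 2" and xy: "x \<in> sector \<gamma>" "y \<in> sector \<gamma>"
    and uv: "0 \<le> (u::real)" "0 \<le> v" "u + v = 1"
  have scale: "s *\<^sub>R z \<in> sector \<gamma>" if "z \<in> sector \<gamma>" "s > 0" for s z
    using that mult_strict_left_mono[OF _ that(2), of "\<bar>Im z\<bar>" "tan \<gamma> * Re z"]
    by (simp add: sector_iff_Im[OF a] abs_mult mult_ac)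
  show "u *\<^sub>R x + v *\<^sub>R y \<in> sector \<gamma>"
  proof (cases "u = 0 \<or> v = 0")
    case True
    then show ?thesis using xy uv by auto
  next
    case False
    then show ?thesis using xy uv by (intro sector_add[OF a] scale) auto
  qed
qed

lemma cnj_in_sector_iff: "cnj z \<in> sector \<gamma> \<longleftrightarrow> z \<in> sector \<gamma>"
proof (cases "z \<in> \<real>")
  case True
  then show ?thesis by (metis Reals_cnj_iff)
next
  case False
  then show ?thesis by (auto simp: sector_def Arg_cnj)
qed

lemma of_real_in_sector: "r > 0 \<Longrightarrow> \<gamma> > 0 \<Longrightarrow> complex_of_real r \<in> sector \<gamma>"
  by (simp add: sector_def)

text \<open>A zero t1 forces zeros at t1 / 2^n for all n, and every t is the sum of such a small
  zero and another point of the open sector. Without zeros, differentiating the functional equation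
  gives h' = c h. The sign in the exponent matches the kernel of the Fourier-Borel
  transform.\<close>

lemma sector_semigroup_exponential:
  fixes h :: "complex \<Rightarrow> complex"
  assumes \<alpha>: "0 < \<alpha>" "\<alpha> < pi / 2"
    and diff: "\<And>t. t \<in> sector \<alpha> \<Longrightarrow> h field_differentiable at t"
    and add: "\<And>s t. s \<in> sector \<alpha> \<Longrightarrow> t \<in> sector \<alpha> \<Longrightarrow> h (s + t) = h s * h t"
  shows "(\<forall>t\<in>sector \<alpha>. h t = 0) \<or> (\<exists>l. \<forall>t\<in>sector \<alpha>. h t = exp (- (l * t)))"
proof (cases "\<exists>t1\<in>sector \<alpha>. h t1 = 0")
  case True
  then obtain t1 where t1: "t1 \<in> sector \<alpha>" "h t1 = 0" by blast
  have half: "t1 / 2 ^ n \<in> sector \<alpha>" "h (t1 / 2 ^ n) = 0" for n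
  proof (induction n)
    case (Suc n)
    case 1
    have scale: "complex_of_real r * t1 \<in> sector \<alpha>" if "r > 0" for r
      using t1 mult_strict_left_mono[OF _ that, of "\<bar>Im t1\<bar>" "tan \<alpha> * Re t1"] that
      by (simp add: sector_iff_Im[OF \<alpha>] abs_mult mult_ac)
    have "complex_of_real (inverse (2 ^ Suc n)) * t1 \<in> sector \<alpha>" by (rule scale) simp
    moreover have "complex_of_real (inverse (2 ^ Suc n)) * t1 = t1 / 2 ^ Suc n"
      by (simp add: field_simps)
    ultimately show "t1 / 2 ^ Suc n \<in> sector \<alpha>" by (simp only:)
    then have "h (t1 / 2 ^ Suc n + t1 / 2 ^ Suc n) = h (t1 / 2 ^ Suc n) * h (t1 / 2 ^ Suc n)"
      using add by blast
    moreover have "t1 / 2 ^ Suc n + t1 / 2 ^ Suc n = t1 / 2 ^ n" by (simp add: field_simps)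
    ultimately show "h (t1 / 2 ^ Suc n) = 0" using Suc by simp
  qed (use t1 in auto)
  have "h t = 0" if t: "t \<in> sector \<alpha>" for t
  proof -
    have "(\<lambda>n. t - t1 * (1/2) ^ n) \<longlonglongrightarrow> t - t1 * 0"
      by (intro tendsto_diff tendsto_const tendsto_mult LIMSEQ_power_zero) (simp add: norm_divide)
    then have "\<forall>\<^sub>F n in sequentially. t - t1 * (1/2) ^ n \<in> sector \<alpha>"
      by (rule topological_tendstoD) (use open_sector[OF \<alpha>] t in auto)
    then obtain n where "t - t1 / 2 ^ n \<in> sector \<alpha>"
      by (auto simp: eventually_sequentially power_divide)
    from add[OF this half(1)[of n]] half(2)[of n] show "h t = 0" by simp
  qed
  then show ?thesis by blast
next
  case False
  then have nz: "h t \<noteq> 0" if "t \<in> sector \<alpha>" for t using that by blast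
  have D: "(h has_field_derivative deriv h t) (at t)" if "t \<in> sector \<alpha>" for t
    using diff[OF that] by (simp add: DERIV_deriv_iff_field_differentiable)
  \<comment> \<open>Only the first variable is differentiated; exchanging the summands 1 and
    \<open>t\<close> then compares h'(1) h(t) with h'(t) h(1).\<close>
  have D1: "deriv h (s + t) = deriv h s * h t" if s: "s \<in> sector \<alpha>" and t: "t \<in> sector \<alpha>" for s t
  proof -
    have "((\<lambda>s. h (s + t)) has_field_derivative deriv h (s + t)) (at s)"
      using DERIV_shift[of h "deriv h (s + t)" s t] D[OF sector_add[OF \<alpha> s t]] by simp
    moreover have "((\<lambda>s. h (s + t)) has_field_derivative deriv h s * h t) (at s)"
    proof (rule has_field_derivative_transform_within_open[OF _ open_sector[OF \<alpha>] s])
      show "((\<lambda>s. h s * h t) has_field_derivative deriv h s * h t) (at s)"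
        by (intro DERIV_cmult_right D s)
      show "h z * h t = h (z + t)" if "z \<in> sector \<alpha>" for z using add[OF that t] by simp
    qed
    ultimately show ?thesis by (rule DERIV_unique)
  qed
  define c where "c = deriv h 1 / h 1"
  have one: "1 \<in> sector \<alpha>" using of_real_in_sector[of 1 \<alpha>] \<alpha> by simp
  have D2: "deriv h t = c * h t" if t: "t \<in> sector \<alpha>" for t
  proof -
    have "deriv h 1 * h t = deriv h t * h 1"
      using D1[OF one t] D1[OF t one, unfolded add.commute[of t 1]] by (rule trans[OF sym])
    then show ?thesis using nz[OF one] by (simp add: c_def nonzero_eq_divide_eq)
  qed
  have "\<exists>K. \<forall>t\<in>sector \<alpha>. h t * exp (- (c * t)) = K"
  proof (rule has_field_derivative_zero_constant[OF convex_sector[OF \<alpha>]])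
    fix t assume t: "t \<in> sector \<alpha>"
    have "((\<lambda>t. exp (- (c * t))) has_field_derivative exp (- (c * t)) * (- c)) (at t)"
      by (auto intro!: derivative_eq_intros)
    from DERIV_mult[OF D[OF t] this]
    have "((\<lambda>t. h t * exp (- (c * t))) has_field_derivative 0) (at t)"
      unfolding D2[OF t] by (simp add: mult_ac)
    then show "((\<lambda>t. h t * exp (- (c * t))) has_field_derivative 0) (at t within sector \<alpha>)"
      by (rule has_field_derivative_at_within)
  qed
  then obtain K where K: "\<And>t. t \<in> sector \<alpha> \<Longrightarrow> h t * exp (- (c * t)) = K" by blast
  have hK: "h t = K * exp (c * t)" if "t \<in> sector \<alpha>" for t
    using K[OF that] by (simp add: exp_minus field_simps)
  have "K * exp (c * (1 + 1)) = (K * exp (c * 1)) * (K * exp (c * 1))"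
    using add[OF one one] unfolding hK[OF one] hK[OF sector_add[OF \<alpha> one one]] .
  also have "\<dots> = K * K * exp (c * (1 + 1))"
    by (simp only: distrib_left exp_add mult_1_right mult_ac)
  finally have "K = K * K" by simp
  moreover have "K \<noteq> 0" using hK[OF one] nz[OF one] by auto
  ultimately have "K = 1" by simp
  then have "\<forall>t\<in>sector \<alpha>. h t = exp (- ((- c) * t))" using hK by simp
  then show ?thesis by blast
qed

text \<open>By the maximum principle and symmetry, the large values of \<open>F\<close> on a sector are attained
  on the bounding ray, within a distance of the origin that does not depend on the ray.\<close>

lemma ray_attains:
  fixes F :: "complex \<Rightarrow> complex"
  assumes \<theta>: "0 < \<theta>" "\<theta> < pi / 2"
    and hol: "F holomorphic_on UNIV" and sym: "\<And>z. F (cnj z) = cnj (F z)"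
    and decay: "\<And>\<phi>. \<bar>\<phi>\<bar> \<le> \<theta> \<Longrightarrow> cmod (F (rcis r0 \<phi>)) \<le> cmod (F z1) / 2"
    and z1: "z1 \<in> sector \<theta>" "cmod z1 < r0" and nz: "F z1 \<noteq> 0"
  shows "\<exists>r. 0 \<le> r \<and> r \<le> r0 \<and> cmod (F z1) \<le> cmod (F (rcis r \<theta>))"
proof (rule ccontr)
  assume contr: "\<not> ?thesis"
  have r0: "r0 > 0" using z1(2) norm_ge_zero[of z1] by linarith
  have contF: "continuous_on A F" for A
    using hol holomorphic_on_imp_continuous_on continuous_on_subset by blast
  obtain r' where r': "r' \<in> {0..r0}" "\<And>r. r \<in> {0..r0} \<Longrightarrow> cmod (F (rcis r \<theta>)) \<le> cmod (F (rcis r' \<theta>))"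
  proof -
    have "\<exists>x\<in>{0..r0}. \<forall>y\<in>{0..r0}. cmod (F (rcis y \<theta>)) \<le> cmod (F (rcis x \<theta>))"
      using r0 by (intro continuous_attains_sup continuous_on_norm
          continuous_on_compose2[OF contF[of UNIV]] continuous_intros) auto
    then show ?thesis using that by blast
  qed
  \<comment> \<open>A bound for \<open>F\<close> on the whole frontier: the first entry on the two
    rays, on the lower one by conjugation, and the second on the arc. Both entries are below
    \<open>cmod (F z1)\<close>, the first by the assumption to be refuted, the second because
    \<open>F z1\<close> is nonzero.\<close>
  define B where "B = max (cmod (F (rcis r' \<theta>))) (cmod (F z1) / 2)"
  have B: "B < cmod (F z1)"
    using contr r' nz unfolding B_def by auto
  define W where "W = sector \<theta> \<inter> ball 0 r0"
  have W: "open W" "W \<subseteq> ball 0 r0" unfolding W_def using open_sector[OF \<theta>] by auto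
  \<comment> \<open>A closed set containing \<open>W\<close>, used to locate frontier points. The
    vertex belongs to it and is treated as the point of radius 0 on the ray.\<close>
  define E where "E = {z. \<bar>Im z\<bar> \<le> tan \<theta> * Re z} \<inter> cball 0 r0"
  have "closed E" unfolding E_def
    by (intro closed_Int closed_Collect_le continuous_intros closed_cball)
  moreover have "W \<subseteq> E" unfolding W_def E_def using sector_iff_Im[OF \<theta>] by fastforce
  ultimately have clW: "closure W \<subseteq> E" by (rule closure_minimal[rotated])
  have tan: "tan \<theta> > 0" using \<theta> by (intro tan_gt_zero) auto
  have "cmod (F z1) \<le> B"
  proof (rule maximum_modulus_frontier[of F W B z1])
    show "F holomorphic_on interior W" using hol holomorphic_on_subset by blast
    show "continuous_on (closure W) F" by (rule contF)
    show "bounded W" using W(2) bounded_ball bounded_subset by blast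
    show "z1 \<in> W" using z1 by (simp add: W_def)
    fix z assume "z \<in> frontier W"
    then have z: "z \<in> E" "z \<notin> W" using clW W(1) by (auto simp: frontier_def interior_open)
    have Re: "Re z \<ge> 0"
    proof (rule ccontr)
      assume "\<not> Re z \<ge> 0"
      then have "tan \<theta> * Re z < 0" using tan by (simp add: mult_pos_neg)
      then have "\<bar>Im z\<bar> < 0" using z(1) by (auto simp: E_def)
      then show False by simp
    qed
    show "cmod (F z) \<le> B"
    proof (cases "Re z = 0")
      case True
      then have "z = rcis 0 \<theta>" using z(1) by (simp add: E_def complex_eq_iff)
      then show ?thesis using r'(2)[of 0] r0 by (simp add: B_def)
    next
      case False
      then have Re: "Re z > 0" using Re by simp
      have Argz: "Arg z = arctan (Im z / Re z)" by (rule arg_conv_arctan[OF Re])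
      have at: "arctan (tan \<theta>) = \<theta>" using \<theta> by (intro arctan_tan) auto
      define u where "u = Im z / Re z"
      have "\<bar>u\<bar> \<le> tan \<theta>"
        using z(1) Re by (simp add: E_def divide_le_eq u_def)
      then have "\<bar>arctan u\<bar> \<le> \<theta>"
        using arctan_le_iff[of u "tan \<theta>"] arctan_le_iff[of "- tan \<theta>" u] at
        by (auto simp: abs_le_iff arctan_minus)
      then have le: "\<bar>Arg z\<bar> \<le> \<theta>"
        by (simp add: Argz u_def)
      show ?thesis
      proof (cases "cmod z = r0")
        case True
        then have "z = rcis r0 (Arg z)" using rcis_cmod_Arg[of z] by simp
        then show ?thesis using decay[OF le] by (simp add: B_def)
      next
        case False
        then have "z \<notin> sector \<theta>" "cmod z \<le> r0" using z by (auto simp: W_def E_def)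
        then have "\<bar>Arg z\<bar> = \<theta>" using le Re by (auto simp: sector_def)
        then consider "z = rcis (cmod z) \<theta>" | "cnj z = rcis (cmod z) \<theta>"
          using rcis_cmod_Arg[of z] rcis_cnj[of z] by (cases "Arg z \<ge> 0") auto
        then show ?thesis
        proof cases
          case 1
          then have "cmod (F z) = cmod (F (rcis (cmod z) \<theta>))" by simp
          then show ?thesis using r'(2)[of "cmod z"] \<open>cmod z \<le> r0\<close> by (simp add: B_def)
        next
          case 2
          then have "cmod (F (cnj z)) = cmod (F (rcis (cmod z) \<theta>))" by simp
          then show ?thesis using r'(2)[of "cmod z"] \<open>cmod z \<le> r0\<close> by (simp add: B_def sym)
        qed
      qed
    qed
  qed
  with B show False by simp
qed

section \<open>The bound on the exponents\<close>

lemma cos_le_minus_sin: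
  assumes "0 \<le> \<epsilon>" "pi / 2 + \<epsilon> \<le> x" "x \<le> 3 * pi / 2 - \<epsilon>"
  shows "cos x \<le> - sin \<epsilon>"
proof -
  have "sin \<epsilon> = cos (pi / 2 - \<epsilon>)" by (simp add: cos_diff)
  also have "\<dots> \<le> cos \<bar>x - pi\<bar>" using assms by (intro cos_monotone_0_pi_le) auto
  also have "\<dots> = - cos x" by (simp add: cos_diff)
  finally show ?thesis by simp
qed

text \<open>For large |l| an argument beyond pi/2 - \<beta> is impossible, because
  \<open>exp (- (l * t))\<close> would exceed \<open>N t\<close> at one of two fixed points.
  Otherwise a point \<open>rcis r \<theta>\<close> where \<open>F\<close> is large is written as t *
  l with |t| = r / |l| and argument of t at most \<alpha> - \<beta>; for large |l| this t has
  modulus below \<open>t0\<close>, which contradicts the bound \<open>s\<close>.\<close>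

lemma exponents_bounded:
  fixes F :: "complex \<Rightarrow> complex" and N :: "complex \<Rightarrow> real"
  assumes ab: "0 < \<beta>" "\<beta> < \<alpha>" "\<alpha> < pi / 2"
    and hol: "F holomorphic_on UNIV" and sym: "\<And>z. F (cnj z) = cnj (F z)"
    and decay: "\<And>\<theta> e. 0 < \<theta> \<Longrightarrow> \<theta> < pi / 2 - \<beta> \<Longrightarrow> e > 0 \<Longrightarrow>
      \<exists>r0. \<forall>r\<ge>r0. \<forall>\<phi>. \<bar>\<phi>\<bar> \<le> \<theta> \<longrightarrow> cmod (F (rcis r \<phi>)) \<le> e"
    and z1: "z1 \<in> sector (\<alpha> - \<beta>)" "s < cmod (F z1)" "0 \<le> s" and t0: "t0 > 0"
  shows "\<exists>L. \<forall>l. (\<forall>t\<in>sector \<alpha>. cmod (exp (- (l * t))) \<le> N t) \<longrightarrow>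
    (\<forall>t\<in>sector (\<alpha> - \<beta>). cmod t \<le> t0 \<longrightarrow> cmod (F (t * l)) \<le> s) \<longrightarrow> cmod l \<le> L"
proof -
  define \<delta> where "\<delta> = \<alpha> - \<beta>"
  \<comment> \<open>The rays used below have angles between \<delta> and \<theta>0. Both entries are
    below pi/2 - \<beta>, the limit for decay: the first since \<alpha> < pi/2, the second since
    \<delta> > 0.\<close>
  define \<theta>0 where "\<theta>0 = max \<delta> (pi / 2 - \<beta> - \<delta>)"
  have \<delta>: "0 < \<delta>" "\<delta> \<le> \<theta>0" "\<theta>0 < pi / 2 - \<beta>" "\<theta>0 < pi / 2" "\<delta> < pi / 2"
    using ab by (auto simp: \<delta>_def \<theta>0_def max_def)
  have nz: "F z1 \<noteq> 0" using z1 by auto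
  obtain r1 where r1: "\<And>r \<phi>. r \<ge> r1 \<Longrightarrow> \<bar>\<phi>\<bar> \<le> \<theta>0 \<Longrightarrow> cmod (F (rcis r \<phi>)) \<le> cmod (F z1) / 2"
    using decay[of \<theta>0 "cmod (F z1) / 2"] \<delta> nz by auto
  define r0 where "r0 = max r1 (cmod z1 + 1)"
  have r0: "r0 \<ge> r1" "cmod z1 < r0" "r0 > 0"
    using norm_ge_zero[of z1] unfolding r0_def by linarith+
  have ray: "\<exists>r. 0 \<le> r \<and> r \<le> r0 \<and> cmod (F z1) \<le> cmod (F (rcis r \<theta>))" if "\<delta> \<le> \<theta>" "\<theta> \<le> \<theta>0" for \<theta>
    using that \<delta> r0 r1 z1(1) sector_mono[of \<delta> \<theta>]
    by (intro ray_attains hol sym nz) (auto simp: \<delta>_def)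
  \<comment> \<open>The angle is chosen so that (pi/2 - \<beta>) + (\<alpha> - \<delta>/2) = pi/2 +
    \<delta>/2: an exponent of larger argument is turned into the left half plane with margin
    \<delta>/2.\<close>
  define Cn where "Cn = max (N (rcis 1 (\<alpha> - \<delta> / 2))) (N (rcis 1 (- (\<alpha> - \<delta> / 2))))"
  \<comment> \<open>The first summand rules out large arguments of \<open>l\<close>; the second
    makes r / |l| < t0 for all r up to \<open>r0\<close>.\<close>
  define L where "L = max 0 (Cn / sin (\<delta> / 2)) + r0 / t0"
  have sin: "sin (\<delta> / 2) > 0" using \<delta> by (intro sin_gt_zero) auto
  have "cmod l \<le> L" if growth: "\<And>t. t \<in> sector \<alpha> \<Longrightarrow> cmod (exp (- (l * t))) \<le> N t"
    and small: "\<And>t. t \<in> sector \<delta> \<Longrightarrow> cmod t \<le> t0 \<Longrightarrow> cmod (F (t * l)) \<le> s" for l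
  proof (rule ccontr)
    assume "\<not> cmod l \<le> L"
    then have l: "cmod l > L" by simp
    then have l1: "cmod l > Cn / sin (\<delta> / 2)" "cmod l > r0 / t0"
      using r0 t0 unfolding L_def by (smt (verit) divide_pos_pos)+
    have l0: "cmod l > 0" using l1(2) r0 t0 by (smt (verit) divide_pos_pos)
    define \<psi> where "\<psi> = \<bar>Arg l\<bar>"
    \<comment> \<open>The sign reduces the lower half plane to the upper one; conjugation symmetry
      of \<open>F\<close> removes it at the end.\<close>
    define \<sigma> :: real where "\<sigma> = (if Arg l \<ge> 0 then 1 else -1)"
    have \<sigma>: "\<bar>\<sigma> * x\<bar> = \<bar>x\<bar>" "Arg l = \<sigma> * \<psi>" "\<sigma> = 1 \<or> \<sigma> = -1" for x
      by (auto simp: \<sigma>_def \<psi>_def)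
    have \<psi>: "0 \<le> \<psi>" "\<psi> \<le> pi" using Arg_bounded[of l] by (auto simp: \<psi>_def)
    have lp: "l = rcis (cmod l) (\<sigma> * \<psi>)" using rcis_cmod_Arg[of l] \<sigma>(2) by simp
    have \<psi>_le: "\<psi> \<le> pi / 2 - \<beta>"
    proof (rule ccontr)
      assume "\<not> ?thesis"
      then have big: "\<psi> > pi / 2 - \<beta>" by simp
      define t where "t = rcis 1 (\<sigma> * (\<alpha> - \<delta> / 2))"
      have t: "t \<in> sector \<alpha>" unfolding t_def
        using ab \<delta> \<sigma>(1) by (intro rcis_in_sector) (auto simp: \<delta>_def)
      have "l * t = rcis (cmod l) (\<sigma> * (\<psi> + (\<alpha> - \<delta> / 2)))"
        unfolding t_def by (subst lp) (simp add: rcis_mult distrib_left)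
      then have "Re (l * t) = cmod l * cos (\<sigma> * (\<psi> + (\<alpha> - \<delta> / 2)))" by simp
      also have "cos (\<sigma> * (\<psi> + (\<alpha> - \<delta> / 2))) = cos (\<psi> + (\<alpha> - \<delta> / 2))"
        using \<sigma>(3) by (metis cos_minus mult_1 mult_minus1)
      also have "\<dots> \<le> - sin (\<delta> / 2)"
        using big \<psi> ab \<delta> by (intro cos_le_minus_sin) (auto simp: \<delta>_def field_simps)
      finally have "Re (l * t) \<le> - (cmod l * sin (\<delta> / 2))"
        using l0 by (simp add: mult_left_mono)
      then have "exp (cmod l * sin (\<delta> / 2)) \<le> cmod (exp (- (l * t)))" by simp
      also have "\<dots> \<le> N t" by (rule growth[OF t])
      also have "\<dots> \<le> Cn" using \<sigma>(3) by (auto simp: Cn_def t_def)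
      finally have "cmod l * sin (\<delta> / 2) < Cn"
        using exp_ge_add_one_self[of "cmod l * sin (\<delta> / 2)"] by linarith
      then show False using l1(1) sin by (simp add: divide_less_eq)
    qed
    \<comment> \<open>The smallest angle of an available ray that is within \<delta> of
      \<psi>.\<close>
    define \<theta> where "\<theta> = max \<delta> (\<psi> - \<delta>)"
    have "\<delta> \<le> \<theta>" "\<theta> \<le> \<theta>0" using \<psi>_le by (auto simp: \<theta>_def \<theta>0_def)
    then obtain r where r: "0 \<le> r" "r \<le> r0" "cmod (F z1) \<le> cmod (F (rcis r \<theta>))"
      using ray by blast
    have ang: "\<bar>\<theta> - \<psi>\<bar> \<le> \<delta>" using \<psi> \<delta> by (auto simp: \<theta>_def)
    define \<eta> where "\<eta> = t0 - r / cmod l"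
    have \<eta>: "\<eta> > 0"
    proof -
      have "r0 < t0 * cmod l" using l1(2) t0 by (simp add: divide_less_eq mult.commute)
      then show ?thesis using r l0 by (simp add: \<eta>_def divide_less_eq)
    qed
    \<comment> \<open>At k = 1 this is the wanted factor, but its argument may have modulus \<delta>
      and its modulus may be 0, so it can miss the open sector. For 0 < k < 1 the angle is smaller
      and the modulus is positive and at most \<open>t0\<close>; continuity of \<open>F\<close> then
      gives the bound at k = 1.\<close>
    define t where "t k = rcis (r / cmod l + (1 - k) * \<eta>) (k * (\<sigma> * (\<theta> - \<psi>)))" for k
    have "cmod (F (t (1 - inverse (real (Suc (Suc n)))) * l)) \<le> s" for n
    proof (rule small)
      define k where "k = 1 - inverse (real (Suc (Suc n)))"
      have k: "0 < k" "k < 1" by (auto simp: k_def field_simps)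
      have "\<bar>k * (\<sigma> * (\<theta> - \<psi>))\<bar> < \<delta>"
      proof -
        have "\<bar>k * (\<sigma> * (\<theta> - \<psi>))\<bar> = k * \<bar>\<theta> - \<psi>\<bar>"
          using k \<sigma>(1)[of "\<theta> - \<psi>"] by (simp add: abs_mult[of k])
        also have "\<dots> \<le> k * \<delta>" using k ang by simp
        also have "\<dots> < \<delta>" using k \<delta> by simp
        finally show ?thesis .
      qed
      moreover have pos: "0 < r / cmod l + (1 - k) * \<eta>"
        using k \<eta> r l0 by (intro add_nonneg_pos) auto
      ultimately show "t (1 - inverse (real (Suc (Suc n)))) \<in> sector \<delta>"
        unfolding t_def k_def[symmetric] using \<delta> by (intro rcis_in_sector) auto
      have "(1 - k) * \<eta> \<le> 1 * \<eta>" using k \<eta> by (intro mult_right_mono) auto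
      then have "r / cmod l + (1 - k) * \<eta> \<le> t0" by (simp add: \<eta>_def)
      then show "cmod (t (1 - inverse (real (Suc (Suc n))))) \<le> t0"
        unfolding t_def k_def[symmetric] using pos by simp
    qed
    moreover have "(\<lambda>n. cmod (F (t (1 - inverse (real (Suc (Suc n)))) * l))) \<longlonglongrightarrow> cmod (F (t (1 - 0) * l))"
    proof -
      have "(\<lambda>n. inverse (real (Suc (Suc n)))) \<longlonglongrightarrow> 0"
        using LIMSEQ_Suc[OF LIMSEQ_inverse_real_of_nat] .
      moreover have "isCont F z" for z
        using holomorphic_on_imp_continuous_on[OF hol] by (simp add: continuous_on_eq_continuous_at)
      ultimately show ?thesis unfolding t_def
        by (intro tendsto_norm isCont_tendsto_compose[of _ F] tendsto_intros) 
    qed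
    ultimately have "cmod (F (t 1 * l)) \<le> s"
      using LIMSEQ_le_const2[of _ "cmod (F (t (1 - 0) * l))" s] by auto
    moreover have "t 1 * l = rcis r (\<sigma> * \<theta>)"
    proof -
      have "t 1 * l = t 1 * rcis (cmod l) (\<sigma> * \<psi>)"
        using arg_cong[OF lp, of "\<lambda>x. t 1 * x"] .
      also have "\<dots> = rcis r (\<sigma> * \<theta>)"
        using l0 by (simp add: t_def rcis_mult algebra_simps)
      finally show ?thesis .
    qed
    moreover have "cmod (F (rcis r (\<sigma> * \<theta>))) = cmod (F (rcis r \<theta>))"
    proof (cases "\<sigma> = 1")
      case False
      then have "rcis r (\<sigma> * \<theta>) = cnj (rcis r \<theta>)" using \<sigma>(3) by (simp add: complex_eq_iff)
      then show ?thesis by (simp add: sym)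
    qed simp
    ultimately show False using r(3) z1(2) by simp
  qed
  then show ?thesis unfolding \<delta>_def by blast
qed

section \<open>The Jordan decomposition\<close>

definition signed :: "(complex set \<Rightarrow> real) \<Rightarrow> bool" where
  "signed \<nu> \<longleftrightarrow> (\<forall>E :: nat \<Rightarrow> complex set. range E \<subseteq> sets borel \<longrightarrow> disjoint_family E \<longrightarrow>
      (\<lambda>n. \<nu> (E n)) sums \<nu> (\<Union>n. E n))"

definition upper_variation :: "(complex set \<Rightarrow> real) \<Rightarrow> complex set \<Rightarrow> ennreal" where
  "upper_variation \<nu> E = (SUP F\<in>{F \<in> sets borel. F \<subseteq> E}. ennreal (\<nu> F))"

lemma signedD:
  assumes "signed \<nu>" "range E \<subseteq> sets borel" "disjoint_family E"
  shows "(\<lambda>n::nat. \<nu> (E n)) sums \<nu> (\<Union>n. E n)"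
  using assms by (simp add: signed_def)

lemma signed_empty: "signed \<nu> \<Longrightarrow> \<nu> {} = 0"
  using signedD[of \<nu> "\<lambda>_. {}"] by (auto dest!: sums_summable simp: summable_const_iff disjoint_family_on_def)

lemma signed_Un:
  assumes \<nu>: "signed \<nu>" and AB: "A \<in> sets borel" "B \<in> sets borel" "A \<inter> B = {}"
  shows "\<nu> (A \<union> B) = \<nu> A + \<nu> B"
proof -
  have "disjoint_family (binaryset A B)"
    using AB(3) by (auto simp: disjoint_family_on_def binaryset_def)
  with AB have "(\<lambda>n. \<nu> (binaryset A B n)) sums \<nu> (\<Union>n. binaryset A B n)"
    by (intro signedD[OF \<nu>]) (auto simp: range_binaryset_eq)
  moreover have "(\<lambda>n. \<nu> (binaryset A B n)) sums (\<nu> A + \<nu> B)"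
    by (rule binaryset_sums[of \<nu> A B, OF signed_empty[OF \<nu>]])
  ultimately show ?thesis using sums_unique2 unfolding UN_binaryset_eq by blast
qed

lemma signed_Diff:
  assumes "signed \<nu>" "A \<in> sets borel" "B \<in> sets borel" "B \<subseteq> A"
  shows "\<nu> (A - B) = \<nu> A - \<nu> B"
proof -
  have "\<nu> (B \<union> (A - B)) = \<nu> B + \<nu> (A - B)"
    using assms by (intro signed_Un) auto
  moreover have "B \<union> (A - B) = A" using assms by blast
  ultimately show ?thesis by simp
qed

lemma signed_uminus: "signed \<nu> \<Longrightarrow> signed (\<lambda>E. - \<nu> E)"
  by (auto simp: signed_def intro: sums_minus)

lemma upper_variation_ge:
  "F \<in> sets borel \<Longrightarrow> F \<subseteq> E \<Longrightarrow> ennreal (\<nu> F) \<le> upper_variation \<nu> E"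
  unfolding upper_variation_def by (rule SUP_upper) simp

lemma upper_variation_le:
  "(\<And>F. F \<in> sets borel \<Longrightarrow> F \<subseteq> E \<Longrightarrow> ennreal (\<nu> F) \<le> c) \<Longrightarrow> upper_variation \<nu> E \<le> c"
  unfolding upper_variation_def by (rule SUP_least) simp

lemma upper_variation_superadditive:
  assumes \<nu>: "signed \<nu>" and AB: "A \<inter> B = {}"
  shows "upper_variation \<nu> A + upper_variation \<nu> B \<le> upper_variation \<nu> (A \<union> B)"
proof -
  let ?I = "\<lambda>A. {F \<in> sets borel. F \<subseteq> (A :: complex set)}"
  have ne: "?I A \<noteq> {}" for A by (auto intro!: exI[of _ "{}"])
  have "ennreal (\<nu> F) + ennreal (\<nu> G) \<le> upper_variation \<nu> (A \<union> B)"
    if FG: "F \<in> ?I A" "G \<in> ?I B" for F G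
  proof -
    have "\<nu> (F \<union> G) = \<nu> F + \<nu> G" using FG AB by (intro signed_Un[OF \<nu>]) auto
    moreover have "ennreal (\<nu> (F \<union> G)) \<le> upper_variation \<nu> (A \<union> B)"
      "ennreal (\<nu> F) \<le> upper_variation \<nu> (A \<union> B)" "ennreal (\<nu> G) \<le> upper_variation \<nu> (A \<union> B)"
      using FG by (auto intro!: upper_variation_ge)
    ultimately show ?thesis
      by (cases "\<nu> F \<ge> 0"; cases "\<nu> G \<ge> 0") (auto simp: ennreal_plus ennreal_neg)
  qed
  then have "ennreal (\<nu> F) + upper_variation \<nu> B \<le> upper_variation \<nu> (A \<union> B)" if "F \<in> ?I A" for F
    unfolding upper_variation_def[of \<nu> B] ennreal_SUP_add_right[OF ne] using that by (intro SUP_least)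
  then show ?thesis
    unfolding upper_variation_def[of \<nu> A] ennreal_SUP_add_left[OF ne, symmetric] by (intro SUP_least)
qed

lemma ennreal_add_le: "ennreal (a + b) \<le> ennreal a + ennreal b"
  by (cases "a \<ge> 0"; cases "b \<ge> 0") (auto simp: ennreal_plus ennreal_neg intro: ennreal_leI)

text \<open>One inequality is superadditivity on finite unions. For the other, a Borel set inside
  the union is cut along the pieces, and \<open>ennreal\<close> of a finite sum is at most the sum
  of the \<open>ennreal\<close> values because negative terms are discarded there.\<close>

lemma upper_variation_countably_additive:
  assumes \<nu>: "signed \<nu>"
  shows "countably_additive (sets borel) (upper_variation \<nu>)"
proof (rule countably_additiveI)
  fix E :: "nat \<Rightarrow> complex set"
  assume E: "range E \<subseteq> sets borel" "disjoint_family E" "(\<Union>i. E i) \<in> sets borel"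
  show "(\<Sum>i. upper_variation \<nu> (E i)) = upper_variation \<nu> (\<Union>i. E i)"
  proof (rule antisym)
    have "(\<Sum>i<n. upper_variation \<nu> (E i)) \<le> upper_variation \<nu> (\<Union>i<n. E i)" for n
    proof (induction n)
      case (Suc n)
      have "E n \<inter> (\<Union>i<n. E i) = {}"
        using disjoint_family_onD[OF E(2), of n] by fastforce
      then have "upper_variation \<nu> (\<Union>i<n. E i) + upper_variation \<nu> (E n) \<le> upper_variation \<nu> ((\<Union>i<n. E i) \<union> E n)"
        by (intro upper_variation_superadditive[OF \<nu>]) auto
      with add_right_mono[OF Suc, of "upper_variation \<nu> (E n)"]
      have "(\<Sum>i<n. upper_variation \<nu> (E i)) + upper_variation \<nu> (E n) \<le> upper_variation \<nu> ((\<Union>i<n. E i) \<union> E n)"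
        by (rule order_trans)
      moreover have "(\<Union>i<Suc n. E i) = (\<Union>i<n. E i) \<union> E n" by (auto simp: less_Suc_eq)
      ultimately show ?case by simp
    qed simp
    moreover have "upper_variation \<nu> (\<Union>i<n. E i) \<le> upper_variation \<nu> (\<Union>i. E i)" for n
      by (intro upper_variation_le upper_variation_ge) auto
    ultimately show "(\<Sum>i. upper_variation \<nu> (E i)) \<le> upper_variation \<nu> (\<Union>i. E i)"
      unfolding suminf_eq_SUP by (blast intro: SUP_least order_trans)
    show "upper_variation \<nu> (\<Union>i. E i) \<le> (\<Sum>i. upper_variation \<nu> (E i))"
    proof (rule upper_variation_le)
      fix F assume F: "F \<in> sets borel" "F \<subseteq> (\<Union>i. E i)"
      have "(\<lambda>i. \<nu> (F \<inter> E i)) sums \<nu> (\<Union>i. F \<inter> E i)"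
        using E F by (intro signedD[OF \<nu>]) (auto simp: disjoint_family_on_def)
      moreover have "(\<Union>i. F \<inter> E i) = F" using F by blast
      ultimately have "(\<lambda>n. ennreal (\<Sum>i<n. \<nu> (F \<inter> E i))) \<longlonglongrightarrow> ennreal (\<nu> F)"
        by (auto simp: sums_def intro: tendsto_ennrealI)
      moreover have "ennreal (\<Sum>i<n. \<nu> (F \<inter> E i)) \<le> (\<Sum>i. upper_variation \<nu> (E i))" for n
      proof -
        have "ennreal (\<Sum>i<n. \<nu> (F \<inter> E i)) \<le> (\<Sum>i<n. ennreal (\<nu> (F \<inter> E i)))"
        proof (induction n)
          case (Suc n)
          then show ?case
            using order_trans[OF ennreal_add_le[of "\<Sum>i<n. \<nu> (F \<inter> E i)" "\<nu> (F \<inter> E n)"] add_right_mono]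
            by simp
        qed simp
        also have "\<dots> \<le> (\<Sum>i<n. upper_variation \<nu> (E i))"
          using E F by (intro sum_mono upper_variation_ge) auto
        also have "\<dots> \<le> (\<Sum>i. upper_variation \<nu> (E i))"
          by (intro sum_le_suminf) auto
        finally show ?thesis .
      qed
      ultimately show "ennreal (\<nu> F) \<le> (\<Sum>i. upper_variation \<nu> (E i))"
        by (intro LIMSEQ_le_const2) auto
    qed
  qed
qed

lemma sets_positive_part [measurable_cong, simp]: "sets (positive_part \<nu>) = sets borel"
  by (simp add: positive_part_def) (metis sets.sigma_sets_eq space_borel)

lemma space_positive_part [simp]: "space (positive_part \<nu>) = UNIV"
  by (simp add: positive_part_def)

lemma emeasure_positive_part:
  assumes \<nu>: "signed \<nu>" and E: "E \<in> sets borel"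
  shows "emeasure (positive_part \<nu>) E = upper_variation \<nu> E"
proof -
  have "positive_part \<nu> = measure_of UNIV (sets borel) (upper_variation \<nu>)"
    by (simp add: positive_part_def upper_variation_def[abs_def])
  then show ?thesis
  proof (rule emeasure_measure_of)
    show "positive (sets (positive_part \<nu>)) (upper_variation \<nu>)"
      using signed_empty[OF \<nu>] by (auto simp: positive_def upper_variation_def)
    show "countably_additive (sets (positive_part \<nu>)) (upper_variation \<nu>)"
      using upper_variation_countably_additive[OF \<nu>] by simp
  qed (use E in auto)
qed

text \<open>If \<nu> G > 1 + |\<nu> E|, both \<nu> G and \<nu> (E - G) have modulus at least 1, so
  either half may be removed; a half of infinite upper variation is kept.\<close>

lemma upper_variation_split:
  assumes \<nu>: "signed \<nu>" and E: "E \<in> sets borel" and top: "upper_variation \<nu> E = \<infinity>"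
  shows "\<exists>F\<in>sets borel. F \<subseteq> E \<and> upper_variation \<nu> F = \<infinity> \<and> 1 \<le> \<bar>\<nu> (E - F)\<bar>"
proof -
  have "ennreal (1 + \<bar>\<nu> E\<bar>) < upper_variation \<nu> E" using top by simp
  then obtain G where G: "G \<in> sets borel" "G \<subseteq> E" "ennreal (1 + \<bar>\<nu> E\<bar>) < ennreal (\<nu> G)"
    unfolding upper_variation_def less_SUP_iff by blast
  then have big: "1 + \<bar>\<nu> E\<bar> < \<nu> G" using iffD1[OF ennreal_less_iff G(3)] by simp
  have d: "\<nu> (E - G) = \<nu> E - \<nu> G" by (rule signed_Diff[OF \<nu> E G(1,2)])
  have "emeasure (positive_part \<nu>) G + emeasure (positive_part \<nu>) (E - G) = emeasure (positive_part \<nu>) (G \<union> (E - G))"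
    using G E by (intro plus_emeasure) auto
  moreover have "G \<union> (E - G) = E" using G by blast
  ultimately have "upper_variation \<nu> G + upper_variation \<nu> (E - G) = \<infinity>"
    using G E top by (simp add: emeasure_positive_part[OF \<nu>])
  then consider "upper_variation \<nu> G = \<infinity>" | "upper_variation \<nu> (E - G) = \<infinity>"
    by (auto simp: ennreal_add_eq_top)
  then show ?thesis
  proof cases
    case 1
    then show ?thesis using G big d by (intro bexI[of _ G]) auto
  next
    case 2
    have "E - (E - G) = G" using G by blast
    then show ?thesis using 2 G E big by (intro bexI[of _ "E - G"]) auto
  qed
qed

text \<open>Repeated splitting would give disjoint sets on which |\<nu>| is at least 1, whereas
  countable additivity makes the series of their values converge.\<close>

lemma upper_variation_finite:
  assumes \<nu>: "signed \<nu>" shows "upper_variation \<nu> UNIV \<noteq> \<infinity>"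
proof
  assume top: "upper_variation \<nu> UNIV = \<infinity>"
  define P where "P E \<longleftrightarrow> E \<in> sets borel \<and> upper_variation \<nu> E = \<infinity>" for E
  have "\<exists>E. \<forall>n. P (E n) \<and> (E (Suc n) \<subseteq> E n \<and> 1 \<le> \<bar>\<nu> (E n - E (Suc n))\<bar>)"
  proof (rule dependent_nat_choice)
    show "\<exists>E. P E" using top by (auto simp: P_def)
    show "\<exists>F. P F \<and> F \<subseteq> E \<and> 1 \<le> \<bar>\<nu> (E - F)\<bar>" if "P E" for E
      using upper_variation_split[OF \<nu>, of E] that unfolding P_def by blast
  qed
  then obtain E where E: "\<And>n. P (E n)" "\<And>n. E (Suc n) \<subseteq> E n" "\<And>n. 1 \<le> \<bar>\<nu> (E n - E (Suc n))\<bar>"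
    by blast
  have anti: "E n \<subseteq> E m" if "m \<le> n" for m n
    using lift_Suc_antimono_le[of E, OF E(2) that] .
  have "disjoint_family (\<lambda>n. E n - E (Suc n))"
    unfolding disjoint_family_on_def
  proof (intro ballI impI)
    fix m n :: nat assume "m \<noteq> n"
    then consider "Suc m \<le> n" | "Suc n \<le> m" by linarith
    then show "(E m - E (Suc m)) \<inter> (E n - E (Suc n)) = {}"
      using anti by cases blast+
  qed
  then have "(\<lambda>n. \<nu> (E n - E (Suc n))) sums \<nu> (\<Union>n. E n - E (Suc n))"
    using E(1) by (intro signedD[OF \<nu>]) (auto simp: P_def)
  then have "(\<lambda>n. \<nu> (E n - E (Suc n))) \<longlonglongrightarrow> 0"
    by (intro summable_LIMSEQ_zero sums_summable)
  then obtain n where "\<bar>\<nu> (E n - E (Suc n))\<bar> < 1"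
    using LIMSEQ_D[of _ 0 1] by fastforce
  with E(3)[of n] show False by simp
qed

lemma finite_measure_positive_part: "signed \<nu> \<Longrightarrow> finite_measure (positive_part \<nu>)"
  by (intro finite_measureI) (simp add: emeasure_positive_part upper_variation_finite[unfolded infinity_ennreal_def])

lemma measure_positive_part_ge:
  assumes "signed \<nu>" "E \<in> sets borel" "F \<in> sets borel" "F \<subseteq> E"
  shows "\<nu> F \<le> measure (positive_part \<nu>) E"
proof -
  interpret finite_measure "positive_part \<nu>" by (rule finite_measure_positive_part) fact
  have "ennreal (\<nu> F) \<le> emeasure (positive_part \<nu>) E"
    using assms by (simp add: emeasure_positive_part upper_variation_ge)
  then show ?thesis by (simp add: emeasure_eq_measure ennreal_le_iff)
qed

lemma measure_positive_part_le:
  assumes "signed \<nu>" "E \<in> sets borel" "\<And>F. F \<in> sets borel \<Longrightarrow> F \<subseteq> E \<Longrightarrow> \<nu> F \<le> c"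
  shows "measure (positive_part \<nu>) E \<le> c"
proof -
  have c: "0 \<le> c" using assms(3)[of "{}"] signed_empty[OF assms(1)] by simp
  interpret finite_measure "positive_part \<nu>" by (rule finite_measure_positive_part) fact
  have "emeasure (positive_part \<nu>) E \<le> ennreal c"
    using assms by (simp add: emeasure_positive_part upper_variation_le ennreal_leI)
  then show ?thesis using c by (simp add: emeasure_eq_measure)
qed

text \<open>Replacing F by E - F, with \<nu> F = \<nu> E - \<nu> (E - F), compares the two suprema
  directly; no Hahn decomposition is constructed.\<close>

lemma jordan_decomposition:
  assumes \<nu>: "signed \<nu>" and E: "E \<in> sets borel"
  shows "measure (positive_part \<nu>) E - measure (positive_part (\<lambda>E. - \<nu> E)) E = \<nu> E"
proof -
  have "measure (positive_part \<nu>) E \<le> \<nu> E + measure (positive_part (\<lambda>E. - \<nu> E)) E"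
  proof (rule measure_positive_part_le[OF \<nu> E])
    fix F assume F: "F \<in> sets borel" "F \<subseteq> E"
    show "\<nu> F \<le> \<nu> E + measure (positive_part (\<lambda>E. - \<nu> E)) E"
      using measure_positive_part_ge[OF signed_uminus[OF \<nu>] E, of "E - F"] signed_Diff[OF \<nu> E F] E F by auto
  qed
  moreover have "measure (positive_part (\<lambda>E. - \<nu> E)) E \<le> measure (positive_part \<nu>) E - \<nu> E"
  proof (rule measure_positive_part_le[OF signed_uminus[OF \<nu>] E])
    fix F assume F: "F \<in> sets borel" "F \<subseteq> E"
    show "- \<nu> F \<le> measure (positive_part \<nu>) E - \<nu> E"
      using measure_positive_part_ge[OF \<nu> E, of "E - F"] signed_Diff[OF \<nu> E F] E F by auto
  qed
  ultimately show ?thesis by linarith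
qed

lemma emeasure_positive_part_null:
  assumes "signed \<nu>" "E \<in> sets borel" "\<And>F. F \<in> sets borel \<Longrightarrow> F \<subseteq> E \<Longrightarrow> \<nu> F = 0"
  shows "emeasure (positive_part \<nu>) E = 0"
  using assms upper_variation_le[of E \<nu> 0] by (simp add: emeasure_positive_part)

text \<open>The complement of the support is covered by open sets all of whose Borel subsets are
  null. The Lindelof property leaves countably many of them, and countable additivity applies after
  making them disjoint.\<close>

lemma complex_measure_null_outside_support:
  assumes \<mu>: "complex_measure \<mu>" and E: "E \<in> sets borel" "E \<inter> cm_support \<mu> = {}"
  shows "\<mu> E = 0"
proof -
  have "(\<lambda>n::nat. \<mu> {}) sums \<mu> (\<Union>n::nat. {})"
    using \<mu>[unfolded complex_measure_def, rule_format, of "\<lambda>_. {}"] by (simp add: disjoint_family_on_def)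
  then have empty: "\<mu> {} = 0" by (auto dest!: sums_summable simp: summable_const_iff)
  define \<U> where "\<U> = {U. open U \<and> (\<forall>E\<in>sets borel. E \<subseteq> U \<longrightarrow> \<mu> E = 0)}"
  obtain \<V> where \<V>: "\<V> \<subseteq> \<U>" "countable \<V>" "\<Union>\<V> = \<Union>\<U>"
    using Lindelof[of \<U>] by (auto simp: \<U>_def)
  \<comment> \<open>The empty set is added so that the countable family is nonempty and can be
    enumerated by the natural numbers.\<close>
  have "{} \<in> \<U>" using empty by (auto simp: \<U>_def)
  then have \<W>: "insert {} \<V> \<subseteq> \<U>" "countable (insert {} \<V>)" using \<V> by auto
  define U where "U = from_nat_into (insert {} \<V>)"
  have ran: "range U = insert {} \<V>" unfolding U_def using \<W>(2) by (intro range_from_nat_into) auto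
  have U: "U n \<in> \<U>" for n
    using \<W>(1) unfolding ran[symmetric] by (rule subsetD) (rule rangeI)
  have "E \<subseteq> \<Union>\<U>"
  proof
    fix z assume "z \<in> E"
    then have "z \<notin> cm_support \<mu>" using E by blast
    then obtain V where "open V" "z \<in> V" "\<forall>E\<in>sets borel. E \<subseteq> V \<longrightarrow> \<mu> E = 0"
      by (auto simp: cm_support_def)
    then show "z \<in> \<Union>\<U>" unfolding \<U>_def by (intro UnionI[of V]) simp_all
  qed
  then have sub: "E \<subseteq> (\<Union>n. U n)" using ran \<V>(3) by simp
  have Ub: "range U \<subseteq> sets borel" using U by (auto simp: \<U>_def)
  have Db: "disjointed U n \<in> sets borel" for n
    using sets.range_disjointed_sets[OF Ub] by blast
  have "(\<lambda>n. \<mu> (E \<inter> disjointed U n)) sums \<mu> (\<Union>n. E \<inter> disjointed U n)"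
  proof (rule \<mu>[unfolded complex_measure_def, rule_format])
    show "range (\<lambda>n. E \<inter> disjointed U n) \<subseteq> sets borel" using E Db by auto
    show "disjoint_family (\<lambda>n. E \<inter> disjointed U n)"
      using disjoint_family_disjointed[of U] by (auto simp: disjoint_family_on_def)
  qed
  moreover have "(\<Union>n. E \<inter> disjointed U n) = E"
    using sub UN_disjointed_eq[of U] by blast
  moreover have "\<mu> (E \<inter> disjointed U n) = 0" for n
  proof -
    have "E \<inter> disjointed U n \<in> sets borel" "E \<inter> disjointed U n \<subseteq> U n"
      using E(1) Db[of n] disjointed_subset[of U n] by auto
    then show ?thesis using U[of n] unfolding \<U>_def by blast
  qed
  ultimately show ?thesis by (simp add: sums_iff)
qed

section \<open>Bochner integrals as limits of Riemann sums\<close>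

abbreviation "sb_integrable \<equiv> Bochner_Integration.simple_bochner_integrable"
abbreviation "sb_integral \<equiv> Bochner_Integration.simple_bochner_integral"

text \<open>Differences of Borel functions into a nonseparable space need not be Borel. Since
  \<open>s\<close> takes finitely many values, the norm is a finite sum of real Borel
  functions.\<close>

lemma borel_measurable_norm_diff_simple:
  fixes f :: "'m \<Rightarrow> 'b::real_normed_vector"
  assumes f: "f \<in> borel_measurable M" and s: "simple_function M s"
  shows "(\<lambda>z. norm (f z - s z)) \<in> borel_measurable M"
proof -
  have fin: "finite (s ` space M)" using s by (rule simple_functionD)
  have "(\<lambda>z. \<Sum>y\<in>s ` space M. indicator (s -` {y} \<inter> space M) z * norm (f z - y)) \<in> borel_measurable M"
  proof (intro borel_measurable_sum borel_measurable_times)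
    fix y
    show "(indicator (s -` {y} \<inter> space M) :: 'm \<Rightarrow> real) \<in> borel_measurable M"
      by (intro borel_measurable_indicator simple_functionD[OF s])
    show "(\<lambda>z. norm (f z - y)) \<in> borel_measurable M"
      by (rule borel_measurable_continuous_on[OF _ f, of "\<lambda>x. norm (x - y)"]) (intro continuous_intros)
  qed
  moreover have "(\<Sum>y\<in>s ` space M. indicator (s -` {y} \<inter> space M) z * norm (f z - y)) = norm (f z - s z)"
    if "z \<in> space M" for z
  proof -
    have "(\<Sum>y\<in>s ` space M. indicator (s -` {y} \<inter> space M) z * norm (f z - y))
        = (\<Sum>y\<in>s ` space M. if y = s z then norm (f z - y) else 0)"
      using that by (intro sum.cong) (auto simp: indicator_def)
    then show ?thesis using fin that by (simp add: sum.delta')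
  qed
  ultimately show ?thesis by (simp cong: measurable_cong)
qed

text \<open>The triangle inequality in L1 with \<open>f\<close> as intermediate point; it yields
  uniqueness of the Bochner integral and the Cauchy property of approximating integrals.\<close>

lemma simple_bochner_integral_dist:
  fixes f :: "'m \<Rightarrow> 'b::real_normed_vector"
  assumes f: "f \<in> borel_measurable M"
    and s: "sb_integrable M s"
    and t: "sb_integrable M t"
  shows "ennreal (norm (sb_integral M s - sb_integral M t))
    \<le> (\<integral>\<^sup>+ z. norm (f z - s z) \<partial>M) + (\<integral>\<^sup>+ z. norm (f z - t z) \<partial>M)"
proof -
  have st: "simple_function M s" "simple_function M t"
    using s t by (auto elim: Bochner_Integration.simple_bochner_integrable.cases)
  have "ennreal (norm (sb_integral M s - sb_integral M t))
      = norm (sb_integral M (\<lambda>x. s x - t x))"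
    using s t by (subst Bochner_Integration.simple_bochner_integral_diff) auto
  also have "\<dots> \<le> sb_integral M (\<lambda>x. norm (s x - t x))"
    using Bochner_Integration.simple_bochner_integrable_compose2[of "(-)" M s t] s t
    by (auto intro!: Bochner_Integration.simple_bochner_integral_norm_bound)
  also have "\<dots> = (\<integral>\<^sup>+x. norm (s x - t x) \<partial>M)"
    using Bochner_Integration.simple_bochner_integrable_compose2[of "\<lambda>x y. norm (x - y)" M s t] s t
    by (auto intro!: Bochner_Integration.simple_bochner_integral_eq_nn_integral)
  also have "\<dots> \<le> (\<integral>\<^sup>+x. ennreal (norm (f x - s x)) + ennreal (norm (f x - t x)) \<partial>M)"
  proof (rule nn_integral_mono)
    fix x
    have "norm (s x - t x) \<le> norm (f x - s x) + norm (f x - t x)"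
      using norm_triangle_ineq4[of "f x - t x" "f x - s x"] by simp
    then show "ennreal (norm (s x - t x)) \<le> ennreal (norm (f x - s x)) + ennreal (norm (f x - t x))"
      by (simp flip: ennreal_plus add: ennreal_leI)
  qed
  also have "\<dots> = (\<integral>\<^sup>+ z. norm (f z - s z) \<partial>M) + (\<integral>\<^sup>+ z. norm (f z - t z) \<partial>M)"
    using borel_measurable_norm_diff_simple[OF f] st by (intro nn_integral_add) auto
  finally show ?thesis .
qed

lemma has_bochner_int_unique:
  assumes "has_bochner_int M f x" "has_bochner_int M f y"
  shows "x = y"
proof -
  obtain s where f: "f \<in> borel_measurable M"
    and s: "\<And>i. sb_integrable M (s i)"
      "(\<lambda>i. \<integral>\<^sup>+ z. norm (f z - s i z) \<partial>M) \<longlonglongrightarrow> 0"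
      "(\<lambda>i::nat. sb_integral M (s i)) \<longlonglongrightarrow> x"
    using assms(1) unfolding has_bochner_int_def by blast
  obtain t where t: "\<And>i. sb_integrable M (t i)"
      "(\<lambda>i. \<integral>\<^sup>+ z. norm (f z - t i z) \<partial>M) \<longlonglongrightarrow> 0"
      "(\<lambda>i::nat. sb_integral M (t i)) \<longlonglongrightarrow> y"
    using assms(2) unfolding has_bochner_int_def by blast
  have "(\<lambda>i. ennreal (norm (sb_integral M (s i) - sb_integral M (t i))))
      \<longlonglongrightarrow> ennreal (norm (x - y))"
    using s(3) t(3) by (intro tendsto_intros)
  moreover have "(\<lambda>i. (\<integral>\<^sup>+ z. norm (f z - s i z) \<partial>M) + (\<integral>\<^sup>+ z. norm (f z - t i z) \<partial>M)) \<longlonglongrightarrow> 0 + 0"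
    using s(2) t(2) by (intro tendsto_add)
  ultimately have "ennreal (norm (x - y)) \<le> 0 + 0"
    by (rule LIMSEQ_le) (intro exI allI impI simple_bochner_integral_dist[OF f s(1) t(1)])
  then show ?thesis by simp
qed

lemma bochner_int_eq:
  assumes "has_bochner_int M f x" shows "bochner_int M f = x"
proof -
  have "(THE x. has_bochner_int M f x) = x"
    using assms has_bochner_int_unique by (intro the_equality) blast+
  then show ?thesis using assms by (auto simp: bochner_int_def)
qed

lemma simple_bochner_indicator_sum:
  fixes v :: "'i \<Rightarrow> 'b::real_normed_vector"
  assumes M: "finite_measure M" and J: "finite J" and B: "\<And>j. j \<in> J \<Longrightarrow> B j \<in> sets M"
  shows "sb_integrable M (\<lambda>z. \<Sum>j\<in>J. indicator (B j) z *\<^sub>R v j)"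
    and "sb_integral M (\<lambda>z. \<Sum>j\<in>J. indicator (B j) z *\<^sub>R v j)
      = (\<Sum>j\<in>J. measure M (B j) *\<^sub>R v j)"
proof -
  interpret finite_measure M by fact
  have simple: "sb_integrable M f" if "simple_function M f" for f :: "_ \<Rightarrow> 'c::real_normed_vector"
    using that by (intro Bochner_Integration.simple_bochner_integrable.intros) auto
  have ind: "sb_integrable M (indicator E :: _ \<Rightarrow> real)"
    "sb_integral M (indicator E :: _ \<Rightarrow> real) = measure M E" if E: "E \<in> sets M" for E
  proof -
    show *: "sb_integrable M (indicator E :: _ \<Rightarrow> real)"
      using E by (intro simple) auto
    have "ennreal (sb_integral M (indicator E :: _ \<Rightarrow> real)) = ennreal (measure M E)"
      using Bochner_Integration.simple_bochner_integral_eq_nn_integral[OF *] E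
      by (simp add: emeasure_eq_measure ennreal_indicator)
    moreover have "0 \<le> sb_integral M (indicator E :: _ \<Rightarrow> real)"
      by (rule Bochner_Integration.simple_bochner_integral_nonneg) simp
    ultimately show "sb_integral M (indicator E :: _ \<Rightarrow> real) = measure M E"
      by simp
  qed
  have summand: "sb_integrable M (\<lambda>z. indicator E z *\<^sub>R w)"
    "sb_integral M (\<lambda>z. indicator E z *\<^sub>R w) = measure M E *\<^sub>R w"
    if E: "E \<in> sets M" for E and w :: 'b
  proof -
    show "sb_integrable M (\<lambda>z. indicator E z *\<^sub>R w)"
      using E by (intro simple simple_function_compose1[where g = "\<lambda>r. r *\<^sub>R w"]) auto
    have "linear (\<lambda>r::real. r *\<^sub>R w)" by (intro linearI) (auto simp: scaleR_add_left)
    from Bochner_Integration.simple_bochner_integral_linear[OF this ind(1)[OF E]] ind(2)[OF E]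
    show "sb_integral M (\<lambda>z. indicator E z *\<^sub>R w) = measure M E *\<^sub>R w"
      by simp
  qed
  have "sb_integrable M (\<lambda>z. \<Sum>j\<in>J. indicator (B j) z *\<^sub>R v j) \<and>
    sb_integral M (\<lambda>z. \<Sum>j\<in>J. indicator (B j) z *\<^sub>R v j)
      = (\<Sum>j\<in>J. measure M (B j) *\<^sub>R v j)"
    using J B
  proof (induction J)
    case empty
    have "sb_integrable M (\<lambda>z. 0 :: 'b)" by (intro simple) auto
    then show ?case by (auto simp: Bochner_Integration.simple_bochner_integral_def intro!: sum.neutral)
  next
    case (insert j J)
    then have IH: "sb_integrable M (\<lambda>z. \<Sum>j\<in>J. indicator (B j) z *\<^sub>R v j)"
      "sb_integral M (\<lambda>z. \<Sum>j\<in>J. indicator (B j) z *\<^sub>R v j)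
        = (\<Sum>j\<in>J. measure M (B j) *\<^sub>R v j)" and Bj: "B j \<in> sets M"
      by auto
    have eq: "(\<lambda>z. \<Sum>i\<in>insert j J. indicator (B i) z *\<^sub>R v i)
        = (\<lambda>z. indicator (B j) z *\<^sub>R v j + (\<Sum>i\<in>J. indicator (B i) z *\<^sub>R v i))"
      by (simp only: sum.insert[OF insert(1,2)])
    show ?case
      unfolding eq sum.insert[OF insert(1,2)]
      using Bochner_Integration.simple_bochner_integral_add[OF summand(1)[OF Bj, of "v j"] IH(1)] IH(2) summand(2)[OF Bj]
        Bochner_Integration.simple_bochner_integrable_compose2[of "(+)", OF _ summand(1)[OF Bj, of "v j"] IH(1)]
      by (simp only: add_0_left simp_thms)
  qed
  then show "sb_integrable M (\<lambda>z. \<Sum>j\<in>J. indicator (B j) z *\<^sub>R v j)"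
    and "sb_integral M (\<lambda>z. \<Sum>j\<in>J. indicator (B j) z *\<^sub>R v j)
      = (\<Sum>j\<in>J. measure M (B j) *\<^sub>R v j)" by auto
qed

text \<open>The tags are required to lie in \<open>K\<close> near their cells but not inside them,
  so empty cells are allowed. One such sequence is shared by all integrals that are to be compared,
  which reduces identities between them to finite sums.\<close>

definition partitions :: "complex set \<Rightarrow> (nat \<Rightarrow> nat) \<Rightarrow> (nat \<Rightarrow> nat \<Rightarrow> complex set) \<Rightarrow> (nat \<Rightarrow> nat \<Rightarrow> complex) \<Rightarrow> bool" where
  "partitions K N B \<xi> \<longleftrightarrow> (\<forall>n. (\<forall>j<N n. B n j \<in> sets borel \<and> \<xi> n j \<in> K \<and>
      (\<forall>z\<in>B n j. dist z (\<xi> n j) < inverse (real (Suc n)))) \<and>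
    disjoint_family_on (B n) {..<N n} \<and> (\<Union>j<N n. B n j) = K)"

lemma partitionsD:
  assumes "partitions K N B \<xi>"
  shows "j < N n \<Longrightarrow> B n j \<in> sets borel" and "j < N n \<Longrightarrow> \<xi> n j \<in> K"
    and "j < N n \<Longrightarrow> z \<in> B n j \<Longrightarrow> dist z (\<xi> n j) < inverse (real (Suc n))"
    and "disjoint_family_on (B n) {..<N n}" and "(\<Union>j<N n. B n j) = K"
proof -
  have "(\<forall>j<N n. B n j \<in> sets borel \<and> \<xi> n j \<in> K \<and> (\<forall>z\<in>B n j. dist z (\<xi> n j) < inverse (real (Suc n)))) \<and>
      disjoint_family_on (B n) {..<N n} \<and> (\<Union>j<N n. B n j) = K"
    using assms unfolding partitions_def by (rule spec)
  then show "j < N n \<Longrightarrow> B n j \<in> sets borel" and "j < N n \<Longrightarrow> \<xi> n j \<in> K"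
    and "j < N n \<Longrightarrow> z \<in> B n j \<Longrightarrow> dist z (\<xi> n j) < inverse (real (Suc n))"
    and "disjoint_family_on (B n) {..<N n}" and "(\<Union>j<N n. B n j) = K"
    by simp_all
qed

lemma partitions_exist:
  assumes K: "compact K" shows "\<exists>N B \<xi>. partitions K N B \<xi>"
proof -
  define Q where "Q e p \<longleftrightarrow> (case p of (N :: nat, B, \<xi>) \<Rightarrow>
      (\<forall>j<N. B j \<in> sets borel \<and> \<xi> j \<in> K \<and> (\<forall>z\<in>B j. dist z (\<xi> j) < e)) \<and>
      disjoint_family_on B {..<N} \<and> (\<Union>j<N. B j) = K)" for e :: real and p
  have ex: "\<exists>p. Q e p" if e: "e > 0" for e
  proof -
    obtain k where k: "k \<subseteq> K" "finite k" "K \<subseteq> (\<Union>x\<in>k. ball x e)"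
    proof (rule compactE_image[OF K, of K "\<lambda>x. ball x e"])
      show "K \<subseteq> (\<Union>x\<in>K. ball x e)"
      proof
        fix x assume "x \<in> K"
        then show "x \<in> (\<Union>x\<in>K. ball x e)" using e by (intro UN_I[of x]) auto
      qed
    qed auto
    obtain xs where xs: "set xs = k" using finite_list[OF k(2)] by blast
    define B where "B = disjointed (\<lambda>j. K \<inter> ball (xs ! j) e)"
    have bor: "K \<inter> ball (xs ! j) e \<in> sets borel" for j
      using borel_compact[OF K] by (intro sets.Int) auto
    have "range (disjointed (\<lambda>j. K \<inter> ball (xs ! j) e)) \<subseteq> sets borel"
      by (rule sets.range_disjointed_sets) (auto intro: bor)
    then have "B j \<in> sets borel" for j by (auto simp: B_def)
    moreover have "xs ! j \<in> K" if "j < length xs" for j using that xs k(1) nth_mem by blast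
    moreover have "dist z (xs ! j) < e" if "z \<in> B j" for z j
      using that disjointed_subset[of "\<lambda>j. K \<inter> ball (xs ! j) e" j] by (auto simp: B_def dist_commute)
    moreover have "disjoint_family_on B {..<length xs}"
      unfolding B_def by (rule disjoint_family_on_mono[OF subset_UNIV disjoint_family_disjointed])
    moreover have "(\<Union>j<length xs. B j) = K"
    proof -
      have "(\<Union>j<length xs. B j) = (\<Union>j<length xs. K \<inter> ball (xs ! j) e)"
        unfolding B_def atLeast0LessThan[symmetric] by (rule finite_UN_disjointed_eq)
      also have "\<dots> = K"
      proof
        show "K \<subseteq> (\<Union>j<length xs. K \<inter> ball (xs ! j) e)"
        proof
          fix z assume z: "z \<in> K"
          then obtain x where "x \<in> set xs" "z \<in> ball x e" using k(3) xs by blast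
          with z show "z \<in> (\<Union>j<length xs. K \<inter> ball (xs ! j) e)" by (auto simp: in_set_conv_nth)
        qed
      qed auto
      finally show ?thesis .
    qed
    ultimately have "Q e (length xs, B, \<lambda>j. xs ! j)" by (simp add: Q_def)
    then show ?thesis by (rule exI)
  qed
  have "\<forall>n. \<exists>p. Q (inverse (real (Suc n))) p" by (intro allI ex) simp
  from choice[OF this] obtain p where p: "\<And>n. Q (inverse (real (Suc n))) (p n)" by auto
  have "partitions K (\<lambda>n. fst (p n)) (\<lambda>n. fst (snd (p n))) (\<lambda>n. snd (snd (p n)))"
    unfolding partitions_def
  proof
    fix n
    show "(\<forall>j<fst (p n). fst (snd (p n)) j \<in> sets borel \<and> snd (snd (p n)) j \<in> K \<and>
        (\<forall>z\<in>fst (snd (p n)) j. dist z (snd (snd (p n)) j) < inverse (real (Suc n)))) \<and>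
      disjoint_family_on (fst (snd (p n))) {..<fst (p n)} \<and> (\<Union>j<fst (p n). fst (snd (p n)) j) = K"
      using p[of n] unfolding Q_def case_prod_beta .
  qed
  then show ?thesis by blast
qed

text \<open>The step functions attached to the partitions converge to \<open>f\<close> uniformly on
  \<open>K\<close>, which carries the finite measure, hence in L1. This gives both the existence of
  the integral for continuous operator-valued \<open>f\<close> and its value.\<close>

lemma riemann_sums_bochner:
  fixes f :: "complex \<Rightarrow> 'b::banach"
  assumes M: "finite_measure M" "sets M = sets borel" and null: "emeasure M (- K) = 0"
    and K: "compact K" "K \<subseteq> S" and S: "S \<in> sets borel" and f: "continuous_on S f"
    and P: "partitions K N B \<xi>"
  shows "(\<lambda>n. \<Sum>j<N n. measure M (B n j) *\<^sub>R f (\<xi> n j)) \<longlonglongrightarrow> bochner_int M (\<lambda>z. indicator S z *\<^sub>R f z)"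
proof -
  interpret finite_measure M by fact
  have sp: "space M = UNIV" using sets_eq_imp_space_eq[OF M(2)] by simp
  define g where "g z = indicator S z *\<^sub>R f z" for z
  have g: "g \<in> borel_measurable M"
    unfolding g_def[abs_def] using borel_measurable_continuous_on_indicator[OF S f]
    unfolding measurable_cong_sets[OF M(2) refl] .
  define s where "s n z = (\<Sum>j\<in>{..<N n}. indicator (B n j) z *\<^sub>R f (\<xi> n j))" for n z
  have Bn: "B n j \<in> sets M" if "j \<in> {..<N n}" for n j using that partitionsD(1)[OF P] M(2) by simp
  have s1: "sb_integrable M (s n)" for n
    unfolding s_def by (rule simple_bochner_indicator_sum(1)[of M "{..<N n}" "B n" "\<lambda>j. f (\<xi> n j)", OF M(1) _ Bn]) simp_all
  have s2: "sb_integral M (s n) = (\<Sum>j<N n. measure M (B n j) *\<^sub>R f (\<xi> n j))" for n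
    unfolding s_def by (rule simple_bochner_indicator_sum(2)[of M "{..<N n}" "B n" "\<lambda>j. f (\<xi> n j)", OF M(1) _ Bn]) simp_all
  have AE: "AE z in M. z \<in> K"
  proof (rule AE_I)
    show "- K \<in> sets M" unfolding M(2) using borel_compact[OF K(1)] by simp
  qed (use null in auto)
  have err: "\<exists>n0. \<forall>n\<ge>n0. (\<integral>\<^sup>+ z. norm (g z - s n z) \<partial>M) \<le> ennreal e" if "e > 0" for e
  proof -
    define e' where "e' = e / (measure M UNIV + 1)"
    have e': "e' > 0" unfolding e'_def using that measure_nonneg[of M UNIV] by (simp add: add_nonneg_pos)
    have "uniformly_continuous_on K f"
      using K continuous_on_subset[OF f] by (intro compact_uniformly_continuous) auto
    then obtain d where d: "d > 0" "\<And>x y. x \<in> K \<Longrightarrow> y \<in> K \<Longrightarrow> dist y x < d \<Longrightarrow> dist (f y) (f x) < e'"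
      using e' unfolding uniformly_continuous_on_def by auto
    obtain n0 where n0: "inverse (real (Suc n0)) < d" using reals_Archimedean[OF d(1)] by blast
    have "(\<integral>\<^sup>+ z. norm (g z - s n z) \<partial>M) \<le> ennreal e" if n: "n \<ge> n0" for n
    proof -
      have small: "norm (g z - s n z) \<le> e'" if z: "z \<in> K" for z
      proof -
        obtain j where j: "j < N n" "z \<in> B n j" using partitionsD(5)[OF P, of n] z by blast
        have "indicator (B n i) z = (if i = j then 1 else 0 :: real)" if "i < N n" for i
        proof (cases "i = j")
          case False
          from disjoint_family_onD[OF partitionsD(4)[OF P] _ _ False] that j(1) have "B n i \<inter> B n j = {}" by simp
          with j(2) False show ?thesis by (auto simp: indicator_def)
        qed (use j in simp)
        then have "s n z = (\<Sum>i\<in>{..<N n}. if i = j then f (\<xi> n j) else 0)"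
          unfolding s_def by (intro sum.cong) auto
        then have sz: "s n z = f (\<xi> n j)" using j by (simp add: sum.delta)
        have "inverse (real (Suc n)) \<le> inverse (real (Suc n0))"
          using n by (intro le_imp_inverse_le) auto
        then have "dist z (\<xi> n j) < d"
          using partitionsD(3)[OF P j] n0 by linarith
        then have "dist (f z) (f (\<xi> n j)) < e'"
          by (rule d(2)[OF partitionsD(2)[OF P j(1)] z])
        moreover have "g z = f z" using z K by (auto simp: g_def)
        ultimately show ?thesis by (simp add: sz dist_norm)
      qed
      have "(\<integral>\<^sup>+ z. norm (g z - s n z) \<partial>M) \<le> (\<integral>\<^sup>+ z. ennreal e' \<partial>M)"
        using AE small by (intro nn_integral_mono_AE) (auto elim!: eventually_mono intro: ennreal_leI)
      also have "\<dots> = ennreal (e' * measure M UNIV)"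
        using e' by (simp add: sp emeasure_eq_measure ennreal_mult)
      also have "\<dots> \<le> ennreal e"
      proof (rule ennreal_leI)
        have "e' * measure M UNIV \<le> e' * (measure M UNIV + 1)" using e' by simp
        also have "\<dots> = e" using add_nonneg_pos[OF measure_nonneg[of M UNIV] zero_less_one] by (simp add: e'_def)
        finally show "e' * measure M UNIV \<le> e" .
      qed
      finally show ?thesis .
    qed
    then show ?thesis by blast
  qed
  have lim0: "(\<lambda>n. \<integral>\<^sup>+ z. norm (g z - s n z) \<partial>M) \<longlonglongrightarrow> 0"
  proof (rule order_tendstoI)
    fix a :: ennreal assume "a > 0"
    then obtain c where c: "0 < c" "c < a" using dense by blast
    then obtain r where r: "c = ennreal r" "r > 0"
      by (cases c) (auto simp: ennreal_less_zero_iff)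
    obtain n0 where n0: "\<And>n. n \<ge> n0 \<Longrightarrow> (\<integral>\<^sup>+ z. norm (g z - s n z) \<partial>M) \<le> ennreal r"
      using err[OF r(2)] by blast
    show "\<forall>\<^sub>F n in sequentially. (\<integral>\<^sup>+ z. norm (g z - s n z) \<partial>M) < a"
      unfolding eventually_sequentially using n0 c(2) r(1) le_less_trans by blast
  qed simp
  have "Cauchy (\<lambda>n. sb_integral M (s n))"
  proof (rule metric_CauchyI)
    fix e :: real assume e: "e > 0"
    obtain n0 where n0: "\<And>n. n \<ge> n0 \<Longrightarrow> (\<integral>\<^sup>+ z. norm (g z - s n z) \<partial>M) \<le> ennreal (e / 3)"
      using err[of "e / 3"] e by auto
    have "dist (sb_integral M (s m)) (sb_integral M (s n)) < e"
      if "m \<ge> n0" "n \<ge> n0" for m n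
    proof -
      have "ennreal (norm (sb_integral M (s m) - sb_integral M (s n)))
          \<le> ennreal (e / 3) + ennreal (e / 3)"
        by (rule order_trans[OF simple_bochner_integral_dist[OF g s1[of m] s1[of n]]
              add_mono[OF n0[OF that(1)] n0[OF that(2)]]])
      also have "\<dots> = ennreal (e / 3 + e / 3)" using e by (simp flip: ennreal_plus)
      finally show ?thesis using e by (simp add: dist_norm)
    qed
    then show "\<exists>n0. \<forall>m\<ge>n0. \<forall>n\<ge>n0. dist (sb_integral M (s m))
        (sb_integral M (s n)) < e" by blast
  qed
  then obtain x where x: "(\<lambda>n. sb_integral M (s n)) \<longlonglongrightarrow> x"
    using Cauchy_convergent_iff convergent_def by blast
  then have "has_bochner_int M g x"
    unfolding has_bochner_int_def by (intro conjI exI[of _ s] g allI s1 lim0)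
  from bochner_int_eq[OF this] x show ?thesis by (simp add: s2 g_def[abs_def])
qed

section \<open>Integrals with respect to compactly supported complex measures\<close>

lemma signed_Re_Im:
  assumes "complex_measure \<mu>"
  shows "signed (\<lambda>E. Re (\<mu> E))" "signed (\<lambda>E. - Re (\<mu> E))"
    "signed (\<lambda>E. Im (\<mu> E))" "signed (\<lambda>E. - Im (\<mu> E))"
proof -
  have sums: "(\<lambda>n. \<mu> (E n)) sums \<mu> (\<Union>n. E n)"
    if "range E \<subseteq> sets borel" "disjoint_family E" for E :: "nat \<Rightarrow> complex set"
    using assms that unfolding complex_measure_def by simp
  show re: "signed (\<lambda>E. Re (\<mu> E))" and im: "signed (\<lambda>E. Im (\<mu> E))"
    unfolding signed_def by (intro allI impI sums_Re sums_Im sums; assumption)+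
  show "signed (\<lambda>E. - Re (\<mu> E))" "signed (\<lambda>E. - Im (\<mu> E))"
    using signed_uminus[OF re] signed_uminus[OF im] .
qed

text \<open>The four positive measures in the definition are evaluated along the same partitions,
  and the Jordan decomposition recombines their masses into values of \<mu> itself.\<close>

lemma cm_integral_riemann:
  fixes f :: "complex \<Rightarrow> 'b::complex_banach"
  assumes \<mu>: "complex_measure \<mu>" and K: "compact K" "cm_support \<mu> \<subseteq> K" "K \<subseteq> S"
    and S: "S \<in> sets borel" and f: "continuous_on S f" and P: "partitions K N B \<xi>"
  shows "(\<lambda>n. \<Sum>j<N n. \<mu> (B n j) *\<^sub>C f (\<xi> n j)) \<longlonglongrightarrow> cm_integral \<mu> S f"
proof -
  have null: "\<mu> F = 0" if "F \<in> sets borel" "F \<subseteq> - K" for F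
    using complex_measure_null_outside_support[OF \<mu> that(1)] that(2) K(2) by blast
  let ?re = "\<lambda>E. Re (\<mu> E)" and ?re' = "\<lambda>E. - Re (\<mu> E)" and ?im = "\<lambda>E. Im (\<mu> E)" and ?im' = "\<lambda>E. - Im (\<mu> E)"
  define m where "m \<nu> = measure (positive_part \<nu>)" for \<nu>
  define X where "X \<nu> n = (\<Sum>j<N n. m \<nu> (B n j) *\<^sub>R f (\<xi> n j))" for \<nu> n
  define I where "I \<nu> = bochner_int (positive_part \<nu>) (\<lambda>z. indicator S z *\<^sub>R f z)" for \<nu>
  have conv: "X \<nu> \<longlonglongrightarrow> I \<nu>" if \<nu>: "signed \<nu>" "\<And>F. \<mu> F = 0 \<Longrightarrow> \<nu> F = 0" for \<nu>
    unfolding X_def[abs_def] I_def m_def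
  proof (rule riemann_sums_bochner[OF finite_measure_positive_part[OF \<nu>(1)] _ _ K(1,3) S f P])
    show "emeasure (positive_part \<nu>) (- K) = 0"
      using borel_compact[OF K(1)] by (intro emeasure_positive_part_null[OF \<nu>(1)] \<nu>(2) null) auto
  qed simp
  have "(\<lambda>n. X ?re n - X ?re' n + \<i> *\<^sub>C (X ?im n - X ?im' n)) \<longlonglongrightarrow> I ?re - I ?re' + \<i> *\<^sub>C (I ?im - I ?im')"
    by (intro tendsto_add tendsto_diff tendsto_scaleC tendsto_const conv signed_Re_Im[OF \<mu>]) auto
  moreover have combine: "(m ?re E *\<^sub>R v - m ?re' E *\<^sub>R v) + \<i> *\<^sub>C (m ?im E *\<^sub>R v - m ?im' E *\<^sub>R v) = \<mu> E *\<^sub>C v"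
    if "E \<in> sets borel" for E and v :: 'b
  proof -
    have "complex_of_real (Re (\<mu> E)) *\<^sub>C v + (\<i> * complex_of_real (Im (\<mu> E))) *\<^sub>C v = \<mu> E *\<^sub>C v"
      using complex_eq[of "\<mu> E"] by (metis scaleC_add_left)
    then show ?thesis
      using jordan_decomposition[OF signed_Re_Im(1)[OF \<mu>] that] jordan_decomposition[OF signed_Re_Im(3)[OF \<mu>] that]
      by (simp add: m_def scaleR_diff_left[symmetric] scaleC_of_real scaleC_scaleC[symmetric])
  qed
  moreover have "X ?re n - X ?re' n + \<i> *\<^sub>C (X ?im n - X ?im' n) = (\<Sum>j<N n. \<mu> (B n j) *\<^sub>C f (\<xi> n j))" for n
    unfolding X_def sum_subtractf[symmetric] scaleC_sum_right sum.distrib[symmetric]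
    by (intro sum.cong refl combine partitionsD(1)[OF P]) simp
  ultimately show ?thesis
    unfolding cm_integral_def Let_def I_def by simp
qed

text \<open>A bound that is uniform in the disjoint family lets pointwise estimates of the
  exponential kernel pass through the Riemann sums.\<close>

lemma complex_measure_bounded_variation:
  assumes \<mu>: "complex_measure \<mu>"
  shows "\<exists>V\<ge>0. \<forall>(J :: nat set) B. finite J \<longrightarrow> disjoint_family_on B J \<longrightarrow> (\<forall>j\<in>J. B j \<in> sets borel) \<longrightarrow>
      (\<Sum>j\<in>J. cmod (\<mu> (B j))) \<le> V"
proof -
  let ?re = "\<lambda>E. Re (\<mu> E)" and ?re' = "\<lambda>E. - Re (\<mu> E)" and ?im = "\<lambda>E. Im (\<mu> E)" and ?im' = "\<lambda>E. - Im (\<mu> E)"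
  define m where "m \<nu> = measure (positive_part \<nu>)" for \<nu>
  have le: "(\<Sum>j\<in>J. m \<nu> (B j)) \<le> m \<nu> UNIV"
    if "signed \<nu>" "finite J" "disjoint_family_on B J" "\<And>j. j \<in> J \<Longrightarrow> B j \<in> sets borel"
    for \<nu> and J :: "nat set" and B
  proof -
    interpret finite_measure "positive_part \<nu>" by (rule finite_measure_positive_part) fact
    have "(\<Sum>j\<in>J. m \<nu> (B j)) = m \<nu> (\<Union>j\<in>J. B j)"
      unfolding m_def by (rule finite_measure_finite_Union[symmetric]) (use that in auto)
    also have "\<dots> \<le> m \<nu> UNIV" unfolding m_def using bounded_measure by simp
    finally show ?thesis .
  qed
  define V where "V = m ?re UNIV + m ?re' UNIV + m ?im UNIV + m ?im' UNIV"
  have V: "V \<ge> 0" unfolding V_def m_def by (intro add_nonneg_nonneg measure_nonneg)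
  have "(\<Sum>j\<in>J. cmod (\<mu> (B j))) \<le> V"
    if J: "finite J" "disjoint_family_on B J" "\<And>j. j \<in> J \<Longrightarrow> B j \<in> sets borel" for J :: "nat set" and B
  proof -
    have "cmod (\<mu> (B j)) \<le> m ?re (B j) + m ?re' (B j) + m ?im (B j) + m ?im' (B j)"
      if "j \<in> J" for j
    proof -
      have nn: "0 \<le> m \<nu> (B j)" for \<nu> by (simp add: m_def)
      have "\<bar>Re (\<mu> (B j))\<bar> \<le> m ?re (B j) + m ?re' (B j)"
        using jordan_decomposition[OF signed_Re_Im(1)[OF \<mu>] J(3)[OF that]] nn[of "?re"] nn[of "?re'"]
        unfolding m_def by linarith
      moreover have "\<bar>Im (\<mu> (B j))\<bar> \<le> m ?im (B j) + m ?im' (B j)"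
        using jordan_decomposition[OF signed_Re_Im(3)[OF \<mu>] J(3)[OF that]] nn[of "?im"] nn[of "?im'"]
        unfolding m_def by linarith
      ultimately show ?thesis using cmod_le[of "\<mu> (B j)"] by linarith
    qed
    then have "(\<Sum>j\<in>J. cmod (\<mu> (B j))) \<le> (\<Sum>j\<in>J. m ?re (B j) + m ?re' (B j) + m ?im (B j) + m ?im' (B j))"
      by (rule sum_mono)
    also have "\<dots> \<le> V"
      unfolding sum.distrib V_def by (intro add_mono le signed_Re_Im[OF \<mu>] J) 
    finally show ?thesis .
  qed
  with V show ?thesis by blast
qed

section \<open>The Fourier--Borel transform\<close>

text \<open>Continuity of the functional is applied to the partial sums of the exponential series,
  which converge uniformly on compact sets. The transform becomes an everywhere convergent power
  series whose coefficients are (-1)^n / n! times the moments of \<phi>.\<close>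

lemma fourier_borel_entire:
  assumes \<phi>: "\<phi> \<in> holo_dual D" shows "fourier_borel \<phi> holomorphic_on UNIV"
proof -
  have add: "\<And>f g. f holomorphic_on D \<Longrightarrow> g holomorphic_on D \<Longrightarrow> \<phi> (\<lambda>z. f z + g z) = \<phi> f + \<phi> g"
    and scale: "\<And>c f. f holomorphic_on D \<Longrightarrow> \<phi> (\<lambda>z. c * f z) = c * \<phi> f"
    and cont: "\<And>f g. (\<And>n::nat. f n holomorphic_on D) \<Longrightarrow> g holomorphic_on D \<Longrightarrow>
      (\<And>K. compact K \<Longrightarrow> K \<subseteq> D \<Longrightarrow> uniform_limit K f g sequentially) \<Longrightarrow> (\<lambda>n. \<phi> (f n)) \<longlonglongrightarrow> \<phi> g"
    using \<phi> unfolding holo_dual_def by blast+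
  have sums: "(\<lambda>n. ((- 1) ^ n / fact n * \<phi> (\<lambda>\<xi>. \<xi> ^ n)) * z ^ n) sums fourier_borel \<phi> z" for z
  proof -
    define f where "f n \<xi> = (\<Sum>k<n. ((- z) ^ k / fact k) * \<xi> ^ k)" for n and \<xi> :: complex
    have hol: "(\<lambda>\<xi>. \<xi> ^ k) holomorphic_on D" for k by (intro holomorphic_intros)
    have hol_f: "f n holomorphic_on D" for n
      unfolding f_def[abs_def] by (intro holomorphic_intros) auto
    have \<phi>f: "\<phi> (f n) = (\<Sum>k<n. ((- z) ^ k / fact k) * \<phi> (\<lambda>\<xi>. \<xi> ^ k))" for n
    proof (induction n)
      case 0
      have "\<phi> (f 0) = \<phi> (\<lambda>\<xi>. 0 * \<xi> ^ 0)" by (simp add: f_def[abs_def])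
      then show ?case using scale[OF hol[of 0], of 0] by simp
    next
      case (Suc n)
      have "\<phi> (f (Suc n)) = \<phi> (\<lambda>\<xi>. f n \<xi> + (- z) ^ n / fact n * \<xi> ^ n)"
        by (simp add: f_def[abs_def])
      also have "\<dots> = \<phi> (f n) + \<phi> (\<lambda>\<xi>. (- z) ^ n / fact n * \<xi> ^ n)"
        by (intro add hol_f holomorphic_intros) auto
      also have "\<phi> (\<lambda>\<xi>. (- z) ^ n / fact n * \<xi> ^ n) = (- z) ^ n / fact n * \<phi> (\<lambda>\<xi>. \<xi> ^ n)"
        by (rule scale[OF hol])
      finally show ?case using Suc by simp
    qed
    have "(\<lambda>n. \<phi> (f n)) \<longlonglongrightarrow> \<phi> (\<lambda>\<xi>. exp (- (z * \<xi>)))"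
    proof (rule cont)
      show "(\<lambda>\<xi>. exp (- (z * \<xi>))) holomorphic_on D" by (intro holomorphic_intros)
      fix K :: "complex set" assume K: "compact K"
      obtain b where b: "\<And>\<xi>. \<xi> \<in> K \<Longrightarrow> cmod \<xi> \<le> b"
        using compact_imp_bounded[OF K] unfolding bounded_iff by blast
      have "uniform_limit K (\<lambda>n \<xi>. \<Sum>k<n. ((- z) ^ k / fact k) * \<xi> ^ k)
          (\<lambda>\<xi>. suminf (\<lambda>k. ((- z) ^ k / fact k) * \<xi> ^ k)) sequentially"
      proof (rule Weierstrass_m_test)
        fix k \<xi> assume "\<xi> \<in> K"
        then have "cmod \<xi> ^ k \<le> b ^ k" using b by (intro power_mono) auto
        then have "cmod z ^ k * cmod \<xi> ^ k / fact k \<le> cmod z ^ k * b ^ k / fact k"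
          by (intro divide_right_mono mult_left_mono) auto
        then show "cmod ((- z) ^ k / fact k * \<xi> ^ k) \<le> inverse (fact k) * (cmod z * b) ^ k"
        proof -
          have "cmod ((- z) ^ k / fact k * \<xi> ^ k) = cmod z ^ k * cmod \<xi> ^ k / fact k"
            by (simp add: norm_mult norm_divide norm_power)
          also have "\<dots> \<le> cmod z ^ k * b ^ k / fact k" by fact
          also have "\<dots> = inverse (fact k) * (cmod z * b) ^ k"
            by (simp only: power_mult_distrib divide_inverse mult_ac)
          finally show ?thesis .
        qed
      qed (rule summable_exp)
      moreover have "suminf (\<lambda>k. ((- z) ^ k / fact k) * \<xi> ^ k) = exp (- (z * \<xi>))" for \<xi>
      proof -
        have "(\<lambda>k. (- (z * \<xi>)) ^ k /\<^sub>R fact k) sums exp (- (z * \<xi>))" by (rule exp_converges)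
        moreover have "(- (z * \<xi>)) ^ k /\<^sub>R fact k = ((- z) ^ k / fact k) * \<xi> ^ k" for k
          unfolding mult_minus_left[symmetric] power_mult_distrib
          by (simp add: scaleR_conv_of_real field_simps)
        ultimately show ?thesis by (simp add: sums_iff)
      qed
      ultimately show "uniform_limit K f (\<lambda>\<xi>. exp (- (z * \<xi>))) sequentially"
        by (simp add: f_def[abs_def])
    qed (rule hol_f)
    then have "(\<lambda>k. ((- z) ^ k / fact k) * \<phi> (\<lambda>\<xi>. \<xi> ^ k)) sums fourier_borel \<phi> z"
      unfolding sums_def \<phi>f fourier_borel_def .
    moreover have "((- z) ^ k / fact k) * \<phi> (\<lambda>\<xi>. \<xi> ^ k) = ((- 1) ^ k / fact k * \<phi> (\<lambda>\<xi>. \<xi> ^ k)) * z ^ k" for k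
      by (subst power_minus) (simp only: mult_ac divide_inverse)
    ultimately show ?thesis by (simp only:)
  qed
  show ?thesis
    unfolding holomorphic_on_def
  proof
    fix z :: complex
    have "fourier_borel \<phi> holomorphic_on ball 0 (cmod z + 1)"
      by (rule power_series_holomorphic[of 0 _ "\<lambda>n. (- 1) ^ n / fact n * \<phi> (\<lambda>\<xi>. \<xi> ^ n)"]) (simp only: diff_zero sums)
    then have "fourier_borel \<phi> field_differentiable at z"
      by (rule holomorphic_on_imp_differentiable_at) auto
    then show "fourier_borel \<phi> field_differentiable at z within UNIV" by simp
  qed
qed

lemma borel_cnj_image: "E \<in> sets borel \<Longrightarrow> cnj ` E \<in> sets borel"
proof -
  assume "E \<in> sets borel"
  then have "cnj -` E \<inter> space borel \<in> sets borel"
    by (rule measurable_sets[rotated]) (intro borel_measurable_continuous_onI continuous_intros)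
  moreover have "cnj -` E = cnj ` E"
    by (auto intro: image_eqI[of _ cnj "cnj _"])
  ultimately show ?thesis by simp
qed

text \<open>For a symmetric measure the Riemann sums at \<open>cnj z\<close> along the reflected
  partition are the conjugates of those at \<open>z\<close>; the symmetry of the transform follows
  in the limit.\<close>

lemma partitions_cnj:
  assumes P: "partitions K N B \<xi>" and K: "cnj ` K = K"
  shows "partitions K N (\<lambda>n j. cnj ` B n j) (\<lambda>n j. cnj (\<xi> n j))"
  unfolding partitions_def
proof (intro allI conjI impI)
  fix n
  show "cnj ` B n j \<in> sets borel" "cnj (\<xi> n j) \<in> K" "\<forall>z\<in>cnj ` B n j. dist z (cnj (\<xi> n j)) < inverse (real (Suc n))"
    if "j < N n" for j
    using partitionsD(1-3)[OF P that] K
    by (auto simp: dist_norm complex_cnj_diff[symmetric] simp del: complex_cnj_diff intro: borel_cnj_image)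
  show "disjoint_family_on (\<lambda>j. cnj ` B n j) {..<N n}"
    unfolding disjoint_family_on_def
  proof (intro ballI impI)
    fix i j assume "i \<in> {..<N n}" "j \<in> {..<N n}" "i \<noteq> j"
    from disjoint_family_onD[OF partitionsD(4)[OF P] this]
    have "cnj ` (B n i \<inter> B n j) = {}" by simp
    then show "cnj ` B n i \<inter> cnj ` B n j = {}" by auto
  qed
  have "(\<Union>j<N n. cnj ` B n j) = cnj ` (\<Union>j<N n. B n j)" by blast
  then show "(\<Union>j<N n. cnj ` B n j) = K" using partitionsD(5)[OF P] K by simp
qed

lemma fourier_borel_riemann:
  assumes \<alpha>: "0 < \<alpha>" "\<alpha> < pi / 2" and \<mu>: "complex_measure \<mu>" and \<phi>: "induced_by (sector \<alpha>) \<mu> \<phi>"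
    and K: "compact K" "cm_support \<mu> \<subseteq> K" "K \<subseteq> sector \<alpha>" and P: "partitions K N B \<xi>"
  shows "(\<lambda>n. \<Sum>j<N n. \<mu> (B n j) * exp (- (z * \<xi> n j))) \<longlonglongrightarrow> fourier_borel \<phi> z"
proof -
  have "fourier_borel \<phi> z = cm_integral \<mu> (sector \<alpha>) (\<lambda>\<xi>. exp (- (z * \<xi>)))"
    using \<phi> unfolding induced_by_def fourier_borel_def
    by (rule allE[where x = "\<lambda>\<xi>. exp (- (z * \<xi>))"]) (auto intro!: holomorphic_intros)
  moreover have "sector \<alpha> \<in> sets borel" using open_sector[OF \<alpha>] by (rule borel_open)
  ultimately show ?thesis
    using cm_integral_riemann[OF \<mu> K _ _ P, of "\<lambda>\<xi>. exp (- (z * \<xi>))"]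
    by (simp add: scaleC_complex_def continuous_intros)
qed

lemma fourier_borel_properties:
  assumes ab: "0 < \<beta>" "\<beta> < \<alpha>" "\<alpha> < pi / 2" and \<mu>: "complex_measure \<mu>"
    and sym: "symmetric_on (sector \<alpha>) \<mu>"
    and supp: "compact (cm_support \<mu>)" "cm_support \<mu> \<subseteq> sector \<beta>"
    and \<phi>: "induced_by (sector \<alpha>) \<mu> \<phi>"
  shows "fourier_borel \<phi> (cnj z) = cnj (fourier_borel \<phi> z)" (is ?sym)
    and "0 < \<theta> \<Longrightarrow> \<theta> < pi / 2 - \<beta> \<Longrightarrow> e > 0 \<Longrightarrow>
      \<exists>r0. \<forall>r\<ge>r0. \<forall>\<psi>. \<bar>\<psi>\<bar> \<le> \<theta> \<longrightarrow> cmod (fourier_borel \<phi> (rcis r \<psi>)) \<le> e"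
proof -
  \<comment> \<open>The support is enlarged to a set invariant under conjugation, so that reflected
    partitions are partitions of the same set.\<close>
  define K where "K = cm_support \<mu> \<union> cnj ` cm_support \<mu>"
  have K: "compact K" "cm_support \<mu> \<subseteq> K" "K \<subseteq> sector \<beta>" "K \<subseteq> sector \<alpha>" "cnj ` K = K"
  proof -
    show "compact K" unfolding K_def
      by (intro compact_Un supp compact_continuous_image continuous_intros)
    show "cm_support \<mu> \<subseteq> K" by (simp add: K_def)
    show "K \<subseteq> sector \<beta>" using supp(2) by (auto simp: K_def cnj_in_sector_iff)
    then show "K \<subseteq> sector \<alpha>" using sector_mono[of \<beta> \<alpha>] ab by auto
    show "cnj ` K = K" by (auto simp: K_def image_Un image_image)
  qed
  obtain N B \<xi> where P: "partitions K N B \<xi>" using partitions_exist[OF K(1)] by blast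
  note F = fourier_borel_riemann[OF _ ab(3) \<mu> \<phi> K(1,2,4)]
  have \<alpha>: "0 < \<alpha>" using ab by simp
  have \<mu>cnj: "\<mu> (cnj ` B n j) = cnj (\<mu> (B n j))" if "j < N n" for n j
  proof -
    have "B n j \<subseteq> sector \<alpha>" using partitionsD(5)[OF P, of n] that K(4) by blast
    then show ?thesis using sym partitionsD(1)[OF P that] unfolding symmetric_on_def by blast
  qed
  have "(\<lambda>n. \<Sum>j<N n. \<mu> (cnj ` B n j) * exp (- (cnj z * cnj (\<xi> n j)))) \<longlonglongrightarrow> fourier_borel \<phi> (cnj z)"
    by (rule F[OF \<alpha> partitions_cnj[OF P K(5)]])
  moreover have "(\<Sum>j<N n. \<mu> (cnj ` B n j) * exp (- (cnj z * cnj (\<xi> n j)))) = cnj (\<Sum>j<N n. \<mu> (B n j) * exp (- (z * \<xi> n j)))" for n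
    by (simp add: \<mu>cnj exp_cnj)
  moreover have "(\<lambda>n. cnj (\<Sum>j<N n. \<mu> (B n j) * exp (- (z * \<xi> n j)))) \<longlonglongrightarrow> cnj (fourier_borel \<phi> z)"
    by (rule tendsto_cnj[OF F[OF \<alpha> P]])
  ultimately show ?sym using LIMSEQ_unique by simp
  obtain V where V: "V \<ge> 0" "\<And>(J :: nat set) B. finite J \<Longrightarrow> disjoint_family_on B J \<Longrightarrow> (\<forall>j\<in>J. B j \<in> sets borel) \<Longrightarrow>
      (\<Sum>j\<in>J. cmod (\<mu> (B j))) \<le> V"
    using complex_measure_bounded_variation[OF \<mu>] by auto
  have bound: "cmod (fourier_borel \<phi> z) \<le> V * c" if "\<And>\<zeta>. \<zeta> \<in> K \<Longrightarrow> cmod (exp (- (z * \<zeta>))) \<le> c" "c \<ge> 0" for z c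
  proof (rule LIMSEQ_le_const2[OF tendsto_norm[OF F[OF \<alpha> P, of z]]], intro exI allI impI)
    fix n
    have "cmod (\<Sum>j<N n. \<mu> (B n j) * exp (- (z * \<xi> n j))) \<le> (\<Sum>j<N n. cmod (\<mu> (B n j)) * c)"
      by (rule sum_norm_le) (auto simp: norm_mult simp del: norm_exp_eq_Re intro!: mult_left_mono that(1) partitionsD(2)[OF P])
    also have "\<dots> = (\<Sum>j<N n. cmod (\<mu> (B n j))) * c" by (simp add: sum_distrib_right)
    also have "\<dots> \<le> V * c"
      by (intro mult_right_mono V(2) that(2)) (auto simp: partitionsD[OF P])
    finally show "cmod (\<Sum>j<N n. \<mu> (B n j) * exp (- (z * \<xi> n j))) \<le> V * c" .
  qed
  assume \<theta>: "0 < \<theta>" "\<theta> < pi / 2 - \<beta>" and e: "e > 0"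
  have "0 \<notin> K" using K(3) by (auto simp: sector_def)
  then obtain \<rho> where \<rho>: "\<rho> > 0" "\<And>\<zeta>. \<zeta> \<in> K \<Longrightarrow> \<rho> \<le> cmod \<zeta>"
    using separate_point_closed[OF compact_imp_closed[OF K(1)], of 0] by auto
  \<comment> \<open>For z of argument at most \<theta> and \<zeta> in \<open>K\<close>, the argument
    of their product stays below \<theta> + \<beta> < pi/2, so its real part is at least r \<rho>
    c.\<close>
  define c where "c = cos (\<theta> + \<beta>)"
  have c: "c > 0" unfolding c_def using \<theta> ab by (intro cos_gt_zero) auto
  \<comment> \<open>By x <= exp x, the bound V exp (-x) <= e holds once x >= V / e, here with x = r
    \<rho> c. The added 1 keeps r positive when V = 0.\<close>
  define r0 where "r0 = V / (e * \<rho> * c) + 1"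
  have "cmod (fourier_borel \<phi> (rcis r \<psi>)) \<le> e" if r: "r \<ge> r0" and \<psi>: "\<bar>\<psi>\<bar> \<le> \<theta>" for r \<psi>
  proof -
    have q: "V / (e * \<rho> * c) \<ge> 0" using V(1) e \<rho>(1) c by simp
    then have "r > 0" using r by (simp add: r0_def)
    have big: "V / e \<le> r * \<rho> * c"
    proof -
      have "V / e = V / (e * \<rho> * c) * (\<rho> * c)" using \<rho>(1) c e by simp
      also have "\<dots> \<le> r * (\<rho> * c)" using r \<rho>(1) c by (intro mult_right_mono) (auto simp: r0_def)
      finally show ?thesis by (simp add: mult.assoc)
    qed
    have "cmod (fourier_borel \<phi> (rcis r \<psi>)) \<le> V * exp (- (r * \<rho> * c))"
    proof (rule bound)
      fix \<zeta> assume \<zeta>: "\<zeta> \<in> K"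
      then obtain s \<omega> where s: "s > 0" "\<bar>\<omega>\<bar> < \<beta>" "\<zeta> = rcis s \<omega>" using K(3) sectorE by blast
      have "\<rho> \<le> s" using \<rho>(2)[OF \<zeta>] s by simp
      have "c \<le> cos \<bar>\<psi> + \<omega>\<bar>" unfolding c_def using \<theta> ab s(2) \<psi>
        by (intro cos_monotone_0_pi_le) auto
      then have "r * \<rho> * c \<le> r * s * cos (\<psi> + \<omega>)"
        using \<open>r > 0\<close> \<open>\<rho> \<le> s\<close> \<rho>(1) c by (intro mult_mono) auto
      then show "cmod (exp (- (rcis r \<psi> * \<zeta>))) \<le> exp (- (r * \<rho> * c))"
        by (simp add: s(3) rcis_mult)
    qed simp
    also have "\<dots> \<le> e"
    proof -
      have "V \<le> e * (r * \<rho> * c)" using big e by (simp add: pos_divide_le_eq mult.commute)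
      also have "\<dots> \<le> e * exp (r * \<rho> * c)"
      proof (rule mult_left_mono)
        show "r * \<rho> * c \<le> exp (r * \<rho> * c)"
          using exp_ge_add_one_self[of "r * \<rho> * c"] by linarith
      qed (use e in simp)
      finally show ?thesis by (simp add: exp_minus field_simps)
    qed
    finally show ?thesis .
  qed
  then show "\<exists>r0. \<forall>r\<ge>r0. \<forall>\<psi>. \<bar>\<psi>\<bar> \<le> \<theta> \<longrightarrow> cmod (fourier_borel \<phi> (rcis r \<psi>)) \<le> e" by blast
qed

section \<open>The radical and quotient algebras\<close>

lemma closed_subalgebraD:
  assumes "closed_subalgebra A"
  shows "closed A" "0 \<in> A" "a \<in> A \<Longrightarrow> b \<in> A \<Longrightarrow> a + b \<in> A"
    "a \<in> A \<Longrightarrow> c *\<^sub>C a \<in> A" "a \<in> A \<Longrightarrow> b \<in> A \<Longrightarrow> a o\<^sub>L b \<in> A"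
    "a \<in> A \<Longrightarrow> - a \<in> A" "a \<in> A \<Longrightarrow> b \<in> A \<Longrightarrow> a - b \<in> A"
proof -
  show "closed A" "0 \<in> A" and add: "a \<in> A \<Longrightarrow> b \<in> A \<Longrightarrow> a + b \<in> A" for a b
    using assms by (simp_all add: closed_subalgebra_def)
  show sc: "a \<in> A \<Longrightarrow> c *\<^sub>C a \<in> A" and "a \<in> A \<Longrightarrow> b \<in> A \<Longrightarrow> a o\<^sub>L b \<in> A" for a b c
    using assms by (simp_all add: closed_subalgebra_def)
  show minus: "a \<in> A \<Longrightarrow> - a \<in> A" for a using sc[of a "-1"] by (simp add: scaleC_minus_one)
  show "a \<in> A \<Longrightarrow> b \<in> A \<Longrightarrow> a - b \<in> A" using add[of a "- b"] minus[of b] by simp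
qed

lemma closed_subalgebra_hull: "closed_subalgebra (closed_subalgebra hull X)"
proof (rule hull_in)
  fix \<A> :: "('a \<Rightarrow>\<^sub>L 'a) set set" assume "Ball \<A> closed_subalgebra"
  then show "closed_subalgebra (\<Inter>\<A>)"
    unfolding closed_subalgebra_def by (auto intro: closed_Inter)
qed

lemma blinfun_compose_ring:
  "(a + b) o\<^sub>L c = (a o\<^sub>L c) + (b o\<^sub>L c)" "c o\<^sub>L (a + b) = (c o\<^sub>L a) + (c o\<^sub>L b)"
  "(a - b) o\<^sub>L c = (a o\<^sub>L c) - (b o\<^sub>L c)" "c o\<^sub>L (a - b) = (c o\<^sub>L a) - (c o\<^sub>L b)"
  "(a o\<^sub>L b) o\<^sub>L c = a o\<^sub>L (b o\<^sub>L c)"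
  by (simp_all add: bounded_bilinear.add_left[OF bounded_bilinear_blinfun_compose]
      bounded_bilinear.add_right[OF bounded_bilinear_blinfun_compose]
      bounded_bilinear.diff_left[OF bounded_bilinear_blinfun_compose]
      bounded_bilinear.diff_right[OF bounded_bilinear_blinfun_compose] blinfun_eqI)

lemma left_idealD:
  assumes "left_ideal A I"
  shows "I \<subseteq> A" "0 \<in> I" "x \<in> I \<Longrightarrow> y \<in> I \<Longrightarrow> x + y \<in> I" "x \<in> I \<Longrightarrow> c *\<^sub>C x \<in> I"
    "a \<in> A \<Longrightarrow> x \<in> I \<Longrightarrow> a o\<^sub>L x \<in> I" "x \<in> I \<Longrightarrow> - x \<in> I" "x \<in> I \<Longrightarrow> y \<in> I \<Longrightarrow> x - y \<in> I"
proof -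
  show "I \<subseteq> A" "0 \<in> I" and add: "x \<in> I \<Longrightarrow> y \<in> I \<Longrightarrow> x + y \<in> I" for x y
    using assms by (simp_all add: left_ideal_def)
  show sc: "x \<in> I \<Longrightarrow> c *\<^sub>C x \<in> I" and "a \<in> A \<Longrightarrow> x \<in> I \<Longrightarrow> a o\<^sub>L x \<in> I" for a c x
    using assms by (simp_all add: left_ideal_def)
  show minus: "x \<in> I \<Longrightarrow> - x \<in> I" for x using sc[of x "-1"] by (simp add: scaleC_minus_one)
  show "x \<in> I \<Longrightarrow> y \<in> I \<Longrightarrow> x - y \<in> I" using add[of x "- y"] minus[of y] by simp
qed

lemma left_ideal_jacobson_radical:
  assumes A: "closed_subalgebra A" shows "left_ideal A (jacobson_radical A)"
proof -
  have "left_ideal A I" if "maximal_modular_left_ideal A I" for I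
    using that by (simp add: maximal_modular_left_ideal_def modular_left_ideal_def)
  note ID = left_idealD[OF this] and AD = closed_subalgebraD[OF A]
  have iff: "x \<in> jacobson_radical A \<longleftrightarrow> x \<in> A \<and> (\<forall>I. maximal_modular_left_ideal A I \<longrightarrow> x \<in> I)" for x
    by (auto simp: jacobson_radical_def)
  show ?thesis
    unfolding left_ideal_def
  proof (intro conjI ballI allI subsetI)
    show "0 \<in> jacobson_radical A" using AD(2) ID(2) by (simp add: iff)
    fix x assume x: "x \<in> jacobson_radical A"
    then show "x \<in> A" by (simp add: iff)
    show "c *\<^sub>C x \<in> jacobson_radical A" for c using x AD(4) ID(4) by (simp add: iff)
    show "x + y \<in> jacobson_radical A" if "y \<in> jacobson_radical A" for y
      using x that AD(3) ID(3) by (simp add: iff)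
    show "a o\<^sub>L x \<in> jacobson_radical A" if "a \<in> A" for a using x that AD(5) ID(5) by (simp add: iff)
  qed
qed

text \<open>If \<open>a\<close> is not in \<open>I\<close>, the right modular unit \<open>e\<close> of \<open>I\<close> is congruent to an element \<open>q\<close> of
  the left ideal generated by \<open>a\<close>. When all such \<open>q\<close> are quasi-invertible, both \<open>q\<close> and \<open>e\<close> lie in \<open>I\<close>.\<close>

lemma in_jacobson_radicalI:
  assumes A: "closed_subalgebra A" and lin: "\<And>c. c \<in> A \<Longrightarrow> complex_linear c" and a: "a \<in> A"
    and quasi: "\<And>c k. c \<in> A \<Longrightarrow> \<exists>s\<in>A. s - (s o\<^sub>L ((c o\<^sub>L a) + k *\<^sub>C a)) = (c o\<^sub>L a) + k *\<^sub>C a"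
  shows "a \<in> jacobson_radical A"
proof -
  note AD = closed_subalgebraD[OF A]
  have "a \<in> I" if max: "maximal_modular_left_ideal A I" for I
  proof (rule ccontr)
    assume nin: "a \<notin> I"
    obtain e where I: "left_ideal A I" and e: "e \<in> A" "\<And>x. x \<in> A \<Longrightarrow> x - (x o\<^sub>L e) \<in> I"
      and proper: "I \<noteq> A" and maximal: "\<And>J. left_ideal A J \<Longrightarrow> I \<subseteq> J \<Longrightarrow> J \<noteq> A \<Longrightarrow> J = I"
      using max unfolding maximal_modular_left_ideal_def modular_left_ideal_def by blast
    note ID = left_idealD[OF I]
    \<comment> \<open>The scalar multiples of \<open>a\<close> are included because \<open>A\<close>
      need not have an identity; they ensure that \<open>a\<close> itself lies in
      \<open>J\<close>.\<close>
    define J where "J = {x + ((c o\<^sub>L a) + k *\<^sub>C a) | x c k. x \<in> I \<and> c \<in> A}"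
    have JI: "x + ((c o\<^sub>L a) + k *\<^sub>C a) \<in> J" if "x \<in> I" "c \<in> A" for x c k
      unfolding J_def using that by blast
    have "left_ideal A J"
      unfolding left_ideal_def
    proof (intro conjI ballI allI subsetI)
      fix y assume "y \<in> J"
      then show "y \<in> A" unfolding J_def using ID(1) a by (auto intro!: AD(3-5))
    next
      show "0 \<in> J" using JI[OF ID(2) AD(2), of 0] by simp
    next
      fix y z assume "y \<in> J" "z \<in> J"
      then obtain x c k x' c' k' where yz: "x \<in> I" "c \<in> A" "x' \<in> I" "c' \<in> A"
        "y = x + ((c o\<^sub>L a) + k *\<^sub>C a)" "z = x' + ((c' o\<^sub>L a) + k' *\<^sub>C a)"
        unfolding J_def by blast
      then have "y + z = (x + x') + (((c + c') o\<^sub>L a) + (k + k') *\<^sub>C a)"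
        by (simp add: blinfun_compose_ring scaleC_add_left)
      then show "y + z \<in> J" using JI[OF ID(3)[OF yz(1,3)] AD(3)[OF yz(2,4)]] by simp
    next
      fix r y assume "y \<in> J"
      then obtain x c k where y: "x \<in> I" "c \<in> A" "y = x + ((c o\<^sub>L a) + k *\<^sub>C a)"
        unfolding J_def by blast
      have "r *\<^sub>C (c o\<^sub>L a) = (r *\<^sub>C c) o\<^sub>L a"
        by (rule blinfun_eqI) (simp add: scaleC_blinfun.rep_eq)
      then have "r *\<^sub>C y = r *\<^sub>C x + (((r *\<^sub>C c) o\<^sub>L a) + (r * k) *\<^sub>C a)"
        by (simp add: y(3) scaleC_add_right scaleC_scaleC)
      then show "r *\<^sub>C y \<in> J" using JI[OF ID(4)[OF y(1)] AD(4)[OF y(2)]] by simp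
    next
      fix d y assume d: "d \<in> A" and "y \<in> J"
      then obtain x c k where y: "x \<in> I" "c \<in> A" "y = x + ((c o\<^sub>L a) + k *\<^sub>C a)"
        unfolding J_def by blast
      have "d o\<^sub>L (k *\<^sub>C a) = (k *\<^sub>C d) o\<^sub>L a"
        using lin[OF d] by (intro blinfun_eqI) (simp add: scaleC_blinfun.rep_eq complex_linear_def)
      then have "d o\<^sub>L y = (d o\<^sub>L x) + (((d o\<^sub>L c) + k *\<^sub>C d) o\<^sub>L a + 0 *\<^sub>C a)"
        by (simp add: y(3) blinfun_compose_ring)
      then show "d o\<^sub>L y \<in> J"
        using JI[OF ID(5)[OF d y(1)] AD(3)[OF AD(5)[OF d y(2)] AD(4)[OF d]], of k 0] by simp
    qed
    moreover have "I \<subseteq> J" using JI[OF _ AD(2), of _ 0] by auto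
    moreover have "a \<in> J" using JI[OF ID(2) AD(2), of 1] by simp
    ultimately have "J = A" using maximal nin by blast
    then obtain x c k where xc: "x \<in> I" "c \<in> A" "e = x + ((c o\<^sub>L a) + k *\<^sub>C a)"
      using e(1) unfolding J_def by blast
    define q where "q = (c o\<^sub>L a) + k *\<^sub>C a"
    have eq: "e - q \<in> I" using xc by (simp add: q_def)
    obtain s where s: "s \<in> A" "s - (s o\<^sub>L q) = q" using quasi[OF xc(2), of k] unfolding q_def by blast
    \<comment> \<open>Both summands on the right are in \<open>I\<close>: the first by modularity,
      the second because \<open>e - q\<close> is.\<close>
    have "s - (s o\<^sub>L q) = (s - (s o\<^sub>L e)) + (s o\<^sub>L (e - q))" by (simp add: blinfun_compose_ring)
    then have "q \<in> I" using ID(3)[OF e(2)[OF s(1)] ID(5)[OF s(1) eq]] s(2) by simp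
    with ID(3)[OF eq] have eI: "e \<in> I" by fastforce
    have "y \<in> I" if "y \<in> A" for y using ID(3)[OF e(2)[OF that] ID(5)[OF that eI]] by simp
    then show False using ID(1) proper by blast
  qed
  then show ?thesis using a by (simp add: jacobson_radical_def)
qed

locale commutative_quotient =
  fixes A R :: "('a::complex_banach \<Rightarrow>\<^sub>L 'a) set"
  assumes A: "closed_subalgebra A" and R: "left_ideal A R"
    and commute: "a \<in> A \<Longrightarrow> b \<in> A \<Longrightarrow> a o\<^sub>L b = b o\<^sub>L a"
begin

lemma coset_eqI: "x - y \<in> R \<Longrightarrow> coset R x = coset R y"
proof -
  have sub: "coset R x \<subseteq> coset R y" if xy: "x - y \<in> R" for x y
  proof
    fix z assume "z \<in> coset R x"
    then obtain r where "r \<in> R" "z = x + r" by (auto simp: coset_def)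
    then have "z = y + ((x - y) + r)" "(x - y) + r \<in> R" using left_idealD(3)[OF R xy] by simp_all
    then show "z \<in> coset R y" unfolding coset_def by blast
  qed
  assume xy: "x - y \<in> R"
  then have "y - x \<in> R" using left_idealD(6)[OF R xy] by simp
  with sub xy show ?thesis by blast
qed

lemma coset_zero: "coset R 0 = R"
  by (auto simp: coset_def)

lemma coset_add_coset: "coset_add (coset R x) (coset R y) = coset R (x + y)"
proof (intro set_eqI iffI)
  fix z assume "z \<in> coset_add (coset R x) (coset R y)"
  then obtain r r' where "r \<in> R" "r' \<in> R" "z = (x + r) + (y + r')"
    unfolding coset_add_def coset_def by blast
  then show "z \<in> coset R (x + y)"
    unfolding coset_def using left_idealD(3)[OF R, of r r'] by (auto intro!: exI[of _ "r + r'"])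
next
  fix z assume "z \<in> coset R (x + y)"
  then obtain r where r: "r \<in> R" "z = (x + r) + (y + 0)" by (auto simp: coset_def)
  moreover have "x + r \<in> coset R x" "y + 0 \<in> coset R y"
    unfolding coset_def using r left_idealD(2)[OF R] by blast+
  ultimately show "z \<in> coset_add (coset R x) (coset R y)"
    unfolding coset_add_def by blast
qed

lemma coset_scale_coset: "coset_scale R c (coset R x) = coset R (c *\<^sub>C x)"
proof (intro set_eqI iffI)
  fix z assume "z \<in> coset_scale R c (coset R x)"
  then obtain r r' where r: "r \<in> R" "r' \<in> R" "z = c *\<^sub>C (x + r) + r'"
    unfolding coset_scale_def coset_def by blast
  then have "z = c *\<^sub>C x + (c *\<^sub>C r + r')" by (simp add: scaleC_add_right)
  moreover have "c *\<^sub>C r + r' \<in> R" using r left_idealD(3,4)[OF R] by blast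
  ultimately show "z \<in> coset R (c *\<^sub>C x)" unfolding coset_def by blast
next
  fix z assume "z \<in> coset R (c *\<^sub>C x)"
  then obtain r where "r \<in> R" "z = c *\<^sub>C x + r" by (auto simp: coset_def)
  moreover have "x \<in> coset R x" unfolding coset_def using left_idealD(2)[OF R] by force
  ultimately show "z \<in> coset_scale R c (coset R x)"
    unfolding coset_scale_def by blast
qed

lemma coset_mult_coset:
  assumes xy: "x \<in> A" "y \<in> A"
  shows "coset_mult R (coset R x) (coset R y) = coset R (x o\<^sub>L y)"
proof (intro set_eqI iffI)
  fix z assume "z \<in> coset_mult R (coset R x) (coset R y)"
  then obtain r r' r'' where r: "r \<in> R" "r' \<in> R" "r'' \<in> R" "z = ((x + r) o\<^sub>L (y + r')) + r''"
    unfolding coset_mult_def coset_def by blast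
  then have "z = (x o\<^sub>L y) + ((x o\<^sub>L r') + (r o\<^sub>L y) + (r o\<^sub>L r') + r'')"
    by (simp add: blinfun_compose_ring)
  moreover have rA: "r \<in> A" using r left_idealD(1)[OF R] by blast
  \<comment> \<open>\<open>R\<close> is given as a left ideal; commutativity supplies the right
    multiples.\<close>
  then have "r o\<^sub>L y \<in> R" using commute[OF rA xy(2)] left_idealD(5)[OF R xy(2) r(1)] by simp
  then have "(x o\<^sub>L r') + (r o\<^sub>L y) + (r o\<^sub>L r') + r'' \<in> R"
    using left_idealD(3)[OF R left_idealD(3)[OF R left_idealD(3)[OF R left_idealD(5)[OF R xy(1) r(2)]]
          left_idealD(5)[OF R rA r(2)]] r(3)] by blast
  ultimately show "z \<in> coset R (x o\<^sub>L y)" unfolding coset_def by blast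
next
  fix z assume "z \<in> coset R (x o\<^sub>L y)"
  then obtain r where "r \<in> R" "z = (x o\<^sub>L y) + r" by (auto simp: coset_def)
  moreover have "x \<in> coset R x" "y \<in> coset R y" unfolding coset_def using left_idealD(2)[OF R] by force+
  ultimately show "z \<in> coset_mult R (coset R x) (coset R y)"
    unfolding coset_mult_def by blast
qed

lemma coset_norm_bounds: "0 \<le> coset_norm (coset R x)" "coset_norm (coset R x) \<le> norm x"
proof -
  have x: "x \<in> coset R x" unfolding coset_def using left_idealD(2)[OF R] by force
  show "0 \<le> coset_norm (coset R x)" unfolding coset_norm_def using x by (intro cINF_greatest) auto
  show "coset_norm (coset R x) \<le> norm x" unfolding coset_norm_def
    by (rule cINF_lower[OF _ x]) (intro bdd_belowI[of _ 0], auto)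
qed

lemma quotient_identity_coset:
  assumes p: "p \<in> A" and unit: "\<And>x. x \<in> A \<Longrightarrow> x - (p o\<^sub>L x) \<in> R"
  shows "quotient_identity A R (coset R p)"
  unfolding quotient_identity_def
proof (intro conjI ballI)
  show "coset R p \<in> quotient_algebra A R" using p by (simp add: quotient_algebra_def)
  fix X assume "X \<in> quotient_algebra A R"
  then obtain x where x: "x \<in> A" "X = coset R x" by (auto simp: quotient_algebra_def)
  have "coset R x = coset R (p o\<^sub>L x)" by (rule coset_eqI[OF unit[OF x(1)]])
  then show "coset_mult R (coset R p) X = X" "coset_mult R X (coset R p) = X"
    using commute[OF x(1) p] unfolding x(2) coset_mult_coset[OF p x(1)] coset_mult_coset[OF x(1) p] by simp_all
qed

text \<open>Powers in the quotient start at the identity coset, so they are represented by v n = b^n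
  p with p a representative of the identity. Partial sums of cosets are cosets of partial sums, and
  the coset norm is at most the norm of a representative.\<close>

lemma is_coset_exp_coset:
  assumes v: "\<And>n. v n \<in> A" "v 0 = p" "\<And>n. v (Suc n) = b o\<^sub>L v n" and b: "b \<in> A"
    and E: "(\<lambda>n. (t ^ n / fact n) *\<^sub>C v n) sums E" and x: "E - x \<in> R"
  shows "is_coset_exp R (coset R p) (coset R b) t (coset R x)"
proof -
  have pow: "coset_power R (coset R p) (coset R b) n = coset R (v n)" for n
    by (induction n) (simp_all add: v(2,3) coset_mult_coset b v(1))
  have sum: "coset_exp_sum R (coset R p) (coset R b) t n = coset R (\<Sum>k<n. (t ^ k / fact k) *\<^sub>C v k)" for n
    by (induction n) (simp_all add: coset_zero pow coset_scale_coset coset_add_coset)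
  have eq: "coset_add (coset_exp_sum R (coset R p) (coset R b) t n) (coset_scale R (-1) (coset R x))
      = coset R ((\<Sum>k<n. (t ^ k / fact k) *\<^sub>C v k) - E)" for n
  proof -
    have "coset R ((\<Sum>k<n. (t ^ k / fact k) *\<^sub>C v k) + - x) = coset R ((\<Sum>k<n. (t ^ k / fact k) *\<^sub>C v k) - E)"
      using x by (intro coset_eqI) simp
    then show ?thesis by (simp only: sum coset_scale_coset coset_add_coset scaleC_minus_one)
  qed
  have "(\<lambda>n. norm ((\<Sum>k<n. (t ^ k / fact k) *\<^sub>C v k) - E)) \<longlonglongrightarrow> 0"
    using E unfolding sums_def by (intro tendsto_norm_zero LIM_zero)
  then show ?thesis
    unfolding is_coset_exp_def eq
    by (rule tendsto_sandwich[OF _ _ tendsto_const, rotated 2]) (simp_all add: coset_norm_bounds)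
qed

end

section \<open>Operator semigroups\<close>

lemma Clop_inverse': "complex_linear a \<Longrightarrow> clop_apply (Clop a) = a"
  by (simp add: Clop_inverse)

lemma complex_linear_clop_apply: "complex_linear (clop_apply x)"
  using clop_apply[of x] by simp

lemma dist_clop_apply: "dist (clop_apply x) (clop_apply y) = dist x y"
  unfolding dist_norm by transfer simp

lemma tendsto_clop_apply: "((\<lambda>i. clop_apply (f i)) \<longlongrightarrow> clop_apply x) F \<longleftrightarrow> (f \<longlongrightarrow> x) F"
  by (simp add: tendsto_iff dist_clop_apply)

lemma tendsto_Clop:
  assumes lim: "((\<lambda>i. clop_apply (f i)) \<longlongrightarrow> a) F" and F: "F \<noteq> bot"
  shows "complex_linear a" "(f \<longlongrightarrow> Clop a) F"
proof -
  have "a \<in> {a. complex_linear a}"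
    by (rule Lim_in_closed_set[OF closed_complex_linear _ F lim]) (simp add: complex_linear_clop_apply)
  then show "complex_linear a" by simp
  then show "(f \<longlongrightarrow> Clop a) F"
    using lim tendsto_clop_apply[of f "Clop a" F] by (simp add: Clop_inverse')
qed

lemma clop_apply_sum: "clop_apply (\<Sum>i\<in>I. f i) = (\<Sum>i\<in>I. clop_apply (f i))"
  by (induction I rule: infinite_finite_induct) (simp_all add: zero_clop.rep_eq plus_clop.rep_eq)

lemma closed_subalgebra_clop_image:
  assumes D: "closed D" "0 \<in> D" "\<And>x y. x \<in> D \<Longrightarrow> y \<in> D \<Longrightarrow> x + y \<in> D"
    "\<And>c x. x \<in> D \<Longrightarrow> c *\<^sub>C x \<in> D" "\<And>x y. x \<in> D \<Longrightarrow> y \<in> D \<Longrightarrow> x * y \<in> D"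
  shows "closed_subalgebra (clop_apply ` D)"
  unfolding closed_subalgebra_def
proof (intro conjI ballI allI)
  show "closed (clop_apply ` D)"
    unfolding closed_sequential_limits
  proof (intro allI impI, elim conjE)
    fix x l assume x: "\<forall>n. x n \<in> clop_apply ` D" and l: "x \<longlonglongrightarrow> l"
    then have "\<forall>n. \<exists>d. d \<in> D \<and> x n = clop_apply d" by blast
    then obtain d where d: "\<And>n. d n \<in> D" "\<And>n. x n = clop_apply (d n)" using choice_iff by metis
    then have "(\<lambda>n. clop_apply (d n)) \<longlonglongrightarrow> l" using l by (simp flip: d(2))
    note L = tendsto_Clop[OF this trivial_limit_sequentially]
    have "Clop l \<in> D" by (rule closed_sequentially[OF D(1) _ L(2)]) (rule d(1))
    then show "l \<in> clop_apply ` D" using Clop_inverse'[OF L(1)] by force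
  qed
  show "0 \<in> clop_apply ` D" using D(2) zero_clop.rep_eq by force
  fix a b assume "a \<in> clop_apply ` D" "b \<in> clop_apply ` D"
  then obtain x y where xy: "x \<in> D" "y \<in> D" "a = clop_apply x" "b = clop_apply y" by blast
  show "a + b \<in> clop_apply ` D" unfolding xy plus_clop.rep_eq[symmetric] by (intro imageI D xy)
  show "a o\<^sub>L b \<in> clop_apply ` D" unfolding xy times_clop.rep_eq[symmetric] by (intro imageI D xy)
next
  fix c a assume "a \<in> clop_apply ` D"
  then obtain x where x: "x \<in> D" "a = clop_apply x" by blast
  show "c *\<^sub>C a \<in> clop_apply ` D" unfolding x scaleC_clop.rep_eq[symmetric] by (intro imageI D x)
qed

section \<open>Bicommutants and characters of the semigroup\<close>

definition bicommutant :: "'a::complex_banach_algebra set \<Rightarrow> 'a set" where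
  "bicommutant X = {a. \<forall>c. (\<forall>x\<in>X. c * x = x * c) \<longrightarrow> a * c = c * a}"

lemma subset_bicommutant: "X \<subseteq> bicommutant X"
  by (auto simp: bicommutant_def)

text \<open>As \<open>X\<close> is commutative, its elements are admissible test elements, so every
  y in the bicommutant commutes with \<open>X\<close>. Then y is itself a test element, and
  therefore commutes with the whole bicommutant.\<close>

lemma comm_subalgebra_bicommutant:
  fixes X :: "'a::complex_banach_algebra set"
  assumes X: "\<And>x y. x \<in> X \<Longrightarrow> y \<in> X \<Longrightarrow> x * y = y * x"
  shows "comm_subalgebra (bicommutant X)"
proof
  have D: "a * c = c * a" if "a \<in> bicommutant X" "\<And>x. x \<in> X \<Longrightarrow> c * x = x * c" for a c
    using that by (simp add: bicommutant_def)
  have I: "a \<in> bicommutant X" if "\<And>c. (\<And>x. x \<in> X \<Longrightarrow> c * x = x * c) \<Longrightarrow> a * c = c * a" for a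
    using that by (simp add: bicommutant_def)
  have "bicommutant X = (\<Inter>c\<in>{c. \<forall>x\<in>X. c * x = x * c}. {a. a * c = c * a})"
    by (auto simp: bicommutant_def)
  moreover have "closed {a. a * c = c * a}" for c :: 'a
    by (intro closed_Collect_eq continuous_intros)
  ultimately show "closed (bicommutant X)" by (simp add: closed_INT)
  show "1 \<in> bicommutant X" by (simp add: bicommutant_def)
  fix x y :: 'a and r :: complex
  assume x: "x \<in> bicommutant X"
  show "r *\<^sub>C x \<in> bicommutant X"
    by (rule I) (simp add: scaleC_mult_left scaleC_mult_right D[OF x])
  assume y: "y \<in> bicommutant X"
  show "x + y \<in> bicommutant X"
    by (rule I) (simp add: distrib_left distrib_right D[OF x] D[OF y])
  show "x * y \<in> bicommutant X"
  proof (rule I)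
    fix c assume "\<And>x. x \<in> X \<Longrightarrow> c * x = x * c"
    then have "x * c = c * x" "y * c = c * y" using D x y by blast+
    then show "x * y * c = c * (x * y)" by (metis mult.assoc)
  qed
  have "y * z = z * y" if "z \<in> X" for z using X D[OF y] that by blast
  then show "x * y = y * x" using D[OF x] by blast
qed

lemma inverse_in_bicommutant:
  fixes a b :: "'a::complex_banach_algebra"
  assumes a: "a \<in> bicommutant X" and inv: "a * b = 1" "b * a = 1"
  shows "b \<in> bicommutant X"
  unfolding bicommutant_def
proof (intro CollectI allI impI)
  fix c assume "\<forall>x\<in>X. c * x = x * c"
  then have ac: "a * c = c * a" using a by (simp add: bicommutant_def)
  have "b * c = b * c * (a * b)" by (simp add: inv)
  also have "\<dots> = b * (c * a) * b" by (simp only: mult.assoc)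
  also have "\<dots> = (b * a) * c * b" by (simp only: ac[symmetric] mult.assoc)
  finally show "b * c = c * b" by (simp add: inv)
qed

text \<open>The bicommutant is inverse-closed, so its characters take values in the spectrum without
  any appeal to the spectral radius formula.\<close>

lemma character_le_spectral_radius:
  fixes X :: "'a::complex_banach clop set"
  assumes C: "comm_subalgebra (bicommutant X)"
    and h: "comm_subalgebra.character (bicommutant X) h" and a: "a \<in> bicommutant X"
  shows "ennreal (cmod (h a)) \<le> spectral_radius (clop_apply a)"
proof -
  interpret comm_subalgebra "bicommutant X" by fact
  define d where "d = h a *\<^sub>C 1 - a"
  have d: "d \<in> bicommutant X" unfolding d_def by (intro diff_in scaleC_in one_in a)
  have kd: "h d = 0"
    unfolding d_def using a by (simp add: characterD(2,4,6)[OF h] scaleC_in one_in)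
  have "h a \<in> spectrum (clop_apply a)"
    unfolding spectrum_def
  proof (intro CollectI notI, elim exE conjE)
    fix b assume b: "complex_linear b"
      "b o\<^sub>L (h a *\<^sub>C id_blinfun - clop_apply a) = id_blinfun"
      "(h a *\<^sub>C id_blinfun - clop_apply a) o\<^sub>L b = id_blinfun"
    have dd: "clop_apply d = h a *\<^sub>C id_blinfun - clop_apply a"
      by (simp add: d_def minus_clop.rep_eq scaleC_clop.rep_eq one_clop.rep_eq)
    have inv: "Clop b * d = 1" "d * Clop b = 1"
      using b by (simp_all add: clop_apply_inject[symmetric] times_clop.rep_eq one_clop.rep_eq dd Clop_inverse')
    have "Clop b \<in> bicommutant X" by (rule inverse_in_bicommutant[OF d inv(2,1)])
    then have "h (Clop b * d) = h (Clop b) * h d" by (rule characterD(3)[OF h _ d])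
    then show False using kd by (simp add: inv characterD(4)[OF h])
  qed
  then show ?thesis unfolding spectral_radius_def by (rule SUP_upper)
qed

lemma analytic_semigroup_continuous:
  assumes "analytic_semigroup \<alpha> T" shows "continuous_on (sector \<alpha>) T"
proof (rule continuous_at_imp_continuous_on, rule ballI)
  fix t assume "t \<in> sector \<alpha>"
  then obtain D where D: "((\<lambda>s. inverse (s - t) *\<^sub>C (T s - T t)) \<longlongrightarrow> D) (at t)"
    using assms unfolding analytic_semigroup_def by blast
  have "((\<lambda>s. (s - t) *\<^sub>C (inverse (s - t) *\<^sub>C (T s - T t))) \<longlongrightarrow> (t - t) *\<^sub>C D) (at t)"
    by (intro tendsto_intros D)
  moreover have "\<forall>\<^sub>F s in at t. (s - t) *\<^sub>C (inverse (s - t) *\<^sub>C (T s - T t)) = T s - T t"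
    by (auto simp: eventually_at_filter scaleC_scaleC)
  ultimately have "((\<lambda>s. T s - T t) \<longlongrightarrow> (t - t) *\<^sub>C D) (at t)"
    by (rule Lim_transform_eventually)
  then have "((\<lambda>s. T s - T t) \<longlongrightarrow> 0) (at t)" by simp
  then show "isCont T t" unfolding isCont_def by (rule LIM_zero_cancel)
qed

text \<open>The difference quotients of the semigroup lie in the closed algebra \<open>C\<close>,
  hence so does their limit, and the contractive \<open>h\<close> may be applied to it. The
  composition is a differentiable solution of the exponential functional equation.\<close>

lemma character_semigroup:
  fixes T :: "complex \<Rightarrow> ('a::complex_banach \<Rightarrow>\<^sub>L 'a)"
  assumes \<alpha>: "0 < \<alpha>" "\<alpha> < pi / 2" and T: "analytic_semigroup \<alpha> T"
    and C: "comm_subalgebra C" and in_C: "\<And>t. t \<in> sector \<alpha> \<Longrightarrow> Clop (T t) \<in> C"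
    and h: "comm_subalgebra.character C h"
  shows "(\<forall>t\<in>sector \<alpha>. h (Clop (T t)) = 0) \<or> (\<exists>l. \<forall>t\<in>sector \<alpha>. h (Clop (T t)) = exp (- (l * t)))"
proof (rule sector_semigroup_exponential[OF \<alpha>])
  interpret comm_subalgebra C by fact
  have lin: "complex_linear (T t)" if "t \<in> sector \<alpha>" for t
    using T that by (simp add: analytic_semigroup_def)
  fix s t assume s: "s \<in> sector \<alpha>" and t: "t \<in> sector \<alpha>"
  have "T (s + t) = T s o\<^sub>L T t" using T s t by (simp add: analytic_semigroup_def)
  then have "Clop (T (s + t)) = Clop (T s) * Clop (T t)"
    using lin[OF s] lin[OF t] lin[OF sector_add[OF \<alpha> s t]]
    by (simp add: clop_apply_inject[symmetric] times_clop.rep_eq Clop_inverse')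
  then show "h (Clop (T (s + t))) = h (Clop (T s)) * h (Clop (T t))"
    using characterD(3)[OF h in_C[OF s] in_C[OF t]] by simp
next
  interpret comm_subalgebra C by fact
  have lin: "complex_linear (T t)" if "t \<in> sector \<alpha>" for t
    using T that by (simp add: analytic_semigroup_def)
  fix t assume t: "t \<in> sector \<alpha>"
  then obtain D where D: "((\<lambda>s. inverse (s - t) *\<^sub>C (T s - T t)) \<longlongrightarrow> D) (at t)"
    using T unfolding analytic_semigroup_def by blast
  have ev: "\<forall>\<^sub>F s in at t. s \<in> sector \<alpha>"
    using open_sector[OF \<alpha>] t by (intro eventually_at_in_open') auto
  define q where "q s = inverse (s - t) *\<^sub>C (Clop (T s) - Clop (T t))" for s
  have "((\<lambda>s. clop_apply (q s)) \<longlongrightarrow> D) (at t)"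
  proof (rule Lim_transform_eventually[OF D])
    show "\<forall>\<^sub>F s in at t. inverse (s - t) *\<^sub>C (T s - T t) = clop_apply (q s)"
      using ev by eventually_elim
        (simp add: q_def scaleC_clop.rep_eq minus_clop.rep_eq Clop_inverse' lin t)
  qed
  from tendsto_Clop(2)[OF this] have q: "(q \<longlongrightarrow> Clop D) (at t)" by simp
  have q_in: "q s \<in> C" if "s \<in> sector \<alpha>" for s
    unfolding q_def by (intro scaleC_in diff_in in_C that t)
  then have ev_q: "\<forall>\<^sub>F s in at t. q s \<in> C" using ev by (auto elim: eventually_mono)
  have "Clop D \<in> C" by (rule Lim_in_closed_set[OF closed_C ev_q _ q]) simp
  from character_tendsto[OF h ev_q this q]
  have "((\<lambda>s. (h (Clop (T s)) - h (Clop (T t))) / (s - t)) \<longlongrightarrow> h (Clop D)) (at t)"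
  proof (rule Lim_transform_eventually)
    show "\<forall>\<^sub>F s in at t. h (q s) = (h (Clop (T s)) - h (Clop (T t))) / (s - t)"
      using ev
    proof eventually_elim
      case (elim s)
      then show ?case
        unfolding q_def
        using characterD(2)[OF h diff_in[OF in_C[OF elim] in_C[OF t]]] characterD(6)[OF h in_C[OF elim] in_C[OF t]]
        by (simp add: divide_inverse mult.commute)
    qed
  qed
  then show "(\<lambda>t. h (Clop (T t))) field_differentiable at t"
    unfolding field_differentiable_def has_field_derivative_iff by blast
qed

text \<open>The Riemann sums of \<open>F(-tA)\<close> are finite combinations of values of
  \<open>T\<close>, which \<open>h\<close> maps to Riemann sums of the transform at
  \<open>t * l\<close>. Closedness of \<open>C\<close> puts the operator itself into the domain of
  \<open>h\<close>.\<close>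

lemma character_fb_operator:
  fixes T :: "complex \<Rightarrow> ('a::complex_banach \<Rightarrow>\<^sub>L 'a)"
  assumes ab: "0 < \<beta>" "\<beta> < \<alpha>" "\<alpha> < pi / 2" and \<mu>: "complex_measure \<mu>"
    and supp: "compact (cm_support \<mu>)" "cm_support \<mu> \<subseteq> sector \<beta>"
    and \<phi>: "induced_by (sector \<alpha>) \<mu> \<phi>" and T: "analytic_semigroup \<alpha> T"
    and C: "comm_subalgebra C" and in_C: "\<And>t. t \<in> sector \<alpha> \<Longrightarrow> Clop (T t) \<in> C"
    and h: "comm_subalgebra.character C h"
    and l: "\<And>t. t \<in> sector \<alpha> \<Longrightarrow> h (Clop (T t)) = exp (- (l * t))" and t: "t \<in> sector (\<alpha> - \<beta>)"
  shows "\<exists>a\<in>C. clop_apply a = fb_operator \<mu> \<beta> T t \<and> h a = fourier_borel \<phi> (t * l)"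
proof -
  interpret comm_subalgebra C by fact
  obtain N B \<xi> where P: "partitions (cm_support \<mu>) N B \<xi>" using partitions_exist[OF supp(1)] by blast
  have ts: "t * \<zeta> \<in> sector \<alpha>" if "\<zeta> \<in> sector \<beta>" for \<zeta>
    using sector_mult[OF t that] ab by simp
  have \<xi>: "\<xi> n j \<in> sector \<beta>" if "j < N n" for n j using partitionsD(2)[OF P that] supp(2) by blast
  define X where "X n = (\<Sum>j<N n. \<mu> (B n j) *\<^sub>C Clop (T (t * \<xi> n j)))" for n
  have X_in: "X n \<in> C" for n
    unfolding X_def by (intro sum_in scaleC_in in_C ts \<xi>) simp
  have lin: "complex_linear (T s)" if "s \<in> sector \<alpha>" for s
    using T that by (simp add: analytic_semigroup_def)
  have "clop_apply (X n) = (\<Sum>j<N n. \<mu> (B n j) *\<^sub>C T (t * \<xi> n j))" for n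
    unfolding X_def clop_apply_sum scaleC_clop.rep_eq
    by (intro sum.cong refl) (simp add: Clop_inverse' lin ts \<xi>)
  moreover have "(\<lambda>n. \<Sum>j<N n. \<mu> (B n j) *\<^sub>C T (t * \<xi> n j)) \<longlonglongrightarrow> fb_operator \<mu> \<beta> T t"
    unfolding fb_operator_def
  proof (rule cm_integral_riemann[OF \<mu> supp(1) subset_refl supp(2) _ _ P])
    show "sector \<beta> \<in> sets borel" using open_sector[of \<beta>] ab by (intro borel_open) auto
    show "continuous_on (sector \<beta>) (\<lambda>\<zeta>. T (t * \<zeta>))"
      by (rule continuous_on_compose2[OF analytic_semigroup_continuous[OF T]]) (auto intro!: continuous_intros ts)
  qed
  ultimately have "(\<lambda>n. clop_apply (X n)) \<longlonglongrightarrow> fb_operator \<mu> \<beta> T t" by simp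
  note lim = tendsto_Clop[OF this trivial_limit_sequentially]
  have a: "Clop (fb_operator \<mu> \<beta> T t) \<in> C"
    by (rule closed_sequentially[OF closed_C _ lim(2)]) (rule X_in)
  have "(\<lambda>n. h (X n)) \<longlonglongrightarrow> h (Clop (fb_operator \<mu> \<beta> T t))"
    by (rule character_tendsto[OF h _ a lim(2)]) (simp add: X_in)
  moreover have "h (X n) = (\<Sum>j<N n. \<mu> (B n j) * exp (- (t * l * \<xi> n j)))" for n
  proof -
    have "h (X n) = (\<Sum>j<N n. h (\<mu> (B n j) *\<^sub>C Clop (T (t * \<xi> n j))))"
      unfolding X_def by (intro characterD(9)[OF h] scaleC_in in_C ts \<xi>) simp
    also have "\<dots> = (\<Sum>j<N n. \<mu> (B n j) * exp (- (t * l * \<xi> n j)))"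
      by (intro sum.cong refl) (simp add: characterD(2)[OF h in_C[OF ts[OF \<xi>]]] l[OF ts[OF \<xi>]] mult_ac)
    finally show ?thesis .
  qed
  moreover have "(\<lambda>n. \<Sum>j<N n. \<mu> (B n j) * exp (- (t * l * \<xi> n j))) \<longlonglongrightarrow> fourier_borel \<phi> (t * l)"
    using sector_mono[of \<beta> \<alpha>] supp(2) ab by (intro fourier_borel_riemann[OF _ _ \<mu> \<phi> supp(1) _ _ P]) auto
  ultimately have "h (Clop (fb_operator \<mu> \<beta> T t)) = fourier_borel \<phi> (t * l)"
    using LIMSEQ_unique by simp
  then show ?thesis using a Clop_inverse'[OF lim(1)] by blast
qed

theorem theorem3p2:
  fixes \<alpha> \<beta> :: real
    and \<mu> :: "complex set \<Rightarrow> complex"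
    and \<phi> :: "(complex \<Rightarrow> complex) \<Rightarrow> complex"
    and F :: "complex \<Rightarrow> complex"
    and T :: "complex \<Rightarrow> ('a :: complex_banach \<Rightarrow>\<^sub>L 'a)"
    and A R :: "('a \<Rightarrow>\<^sub>L 'a) set"
  assumes "0 < \<beta>" and "\<beta> < \<alpha>" and "\<alpha> < pi / 2"
    and "complex_measure \<mu>"
    and "symmetric_on (sector \<alpha>) \<mu>"
    and "compact (cm_support \<mu>)" and "cm_support \<mu> \<subseteq> sector \<beta>"
    and "cm_integral \<mu> (sector \<beta>) (\<lambda>z. 1 :: complex) = 0"
    and "\<phi> \<in> holo_dual (sector \<alpha>)" and "induced_by (sector \<alpha>) \<mu> \<phi>"
    and "F = fourier_borel \<phi>"
    and "analytic_semigroup \<alpha> T"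
    and "\<exists>t \<in> sector \<alpha>. \<not> quasinilpotent (T t)"
    and "A = semigroup_algebra \<alpha> T"
    and "R = jacobson_radical A"
    and "\<exists>t0 > 0.
      (SUP t \<in> {t \<in> sector (\<alpha> - \<beta>). cmod t \<le> t0}. spectral_radius (fb_operator \<mu> \<beta> T t))
        < (SUP z \<in> sector (\<alpha> - \<beta>). ennreal (cmod (F z)))"
  shows "\<exists>U. quotient_identity A R U \<and>
    (\<exists>B \<in> quotient_algebra A R. \<forall>t \<in> sector \<alpha>. is_coset_exp R U B t (coset R (T t)))"
proof -
  note ab = assms(1-3) and \<mu> = assms(4) and supp = assms(6,7) and \<phi> = assms(10) and T = assms(12)
  have \<alpha>: "0 < \<alpha>" "\<alpha> < pi / 2" using ab by auto
  define Tc where "Tc t = Clop (T t)" for t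
  have lin: "complex_linear (T t)" if "t \<in> sector \<alpha>" for t
    using T that by (simp add: analytic_semigroup_def)
  have Tc: "clop_apply (Tc t) = T t" if "t \<in> sector \<alpha>" for t
    by (simp add: Tc_def Clop_inverse' lin that)
  define C where "C = bicommutant (Tc ` sector \<alpha>)"
  have C: "comm_subalgebra C"
    unfolding C_def
  proof (rule comm_subalgebra_bicommutant)
    fix x y assume "x \<in> Tc ` sector \<alpha>" "y \<in> Tc ` sector \<alpha>"
    then obtain s t where st: "s \<in> sector \<alpha>" "t \<in> sector \<alpha>" "x = Tc s" "y = Tc t" by blast
    have "T s o\<^sub>L T t = T (s + t)" "T t o\<^sub>L T s = T (t + s)"
      using T st(1,2) by (simp_all add: analytic_semigroup_def)
    then have "T s o\<^sub>L T t = T t o\<^sub>L T s" by (simp add: add.commute)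
    then show "x * y = y * x"
      using st by (simp add: clop_apply_inject[symmetric] times_clop.rep_eq Tc)
  qed
  interpret comm_subalgebra C by (rule C)
  have Tc_in: "Tc t \<in> C" if "t \<in> sector \<alpha>" for t
    using subset_bicommutant[of "Tc ` sector \<alpha>"] that unfolding C_def by blast
  have A_alg: "closed_subalgebra A" using assms(14) closed_subalgebra_hull by (simp add: semigroup_algebra_def)
  note AD = closed_subalgebraD[OF A_alg]
  have A_least: "A \<subseteq> clop_apply ` D"
    if "closed_subalgebra (clop_apply ` D)" "\<And>t. t \<in> sector \<alpha> \<Longrightarrow> Tc t \<in> D" for D
    unfolding assms(14) semigroup_algebra_def
  proof (rule hull_minimal)
    show "closed_subalgebra (clop_apply ` D)" by (rule that(1))
    show "T ` sector \<alpha> \<subseteq> clop_apply ` D" using that(2) Tc by force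
  qed
  have A_C: "A \<subseteq> clop_apply ` C"
    by (rule A_least[OF closed_subalgebra_clop_image[OF closed_C zero_in add_in scaleC_in mult_in] Tc_in])
  have T_A: "T t \<in> A" if "t \<in> sector \<alpha>" for t
    unfolding assms(14) semigroup_algebra_def by (rule hull_inc) (use that in blast)
  define A' where "A' = {x. clop_apply x \<in> A}"
  have A': "A' \<subseteq> C"
    using A_C unfolding A'_def by (auto simp: clop_apply_inject)
  have A'_alg: "closed A'" "0 \<in> A'" "\<And>x y. x \<in> A' \<Longrightarrow> y \<in> A' \<Longrightarrow> x + y \<in> A'"
    "\<And>c x. x \<in> A' \<Longrightarrow> c *\<^sub>C x \<in> A'" "\<And>x y. x \<in> A' \<Longrightarrow> y \<in> A' \<Longrightarrow> x * y \<in> A'"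
  proof -
    show "closed A'"
      unfolding closed_sequential_limits
    proof (intro allI impI, elim conjE)
      fix x l assume x: "\<forall>n. x n \<in> A'" and l: "x \<longlonglongrightarrow> l"
      have "(\<lambda>n. clop_apply (x n)) \<longlonglongrightarrow> clop_apply l" using l by (simp add: tendsto_clop_apply)
      then have "clop_apply l \<in> A"
        by (rule closed_sequentially[OF AD(1), rotated]) (use x in \<open>simp add: A'_def\<close>)
      then show "l \<in> A'" by (simp add: A'_def)
    qed
  qed (simp_all add: A'_def AD zero_clop.rep_eq plus_clop.rep_eq scaleC_clop.rep_eq times_clop.rep_eq)
  have A_rep: "\<exists>x\<in>A'. a = clop_apply x" if "a \<in> A" for a
    using A_C that unfolding A'_def by force
  \<comment> \<open>The kernel of \<open>h\<close> in \<open>C\<close> is a closed subalgebra; if it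
    contains the semigroup, it contains all of \<open>A\<close>.\<close>
  have vanish: "\<forall>x\<in>A'. h x = 0" if h: "character h" and zero: "\<forall>t\<in>sector \<alpha>. h (Tc t) = 0" for h
  proof -
    define D where "D = {x \<in> C. h x = 0}"
    have "closed D"
      unfolding closed_sequential_limits
    proof (intro allI impI, elim conjE)
      fix x l assume x: "\<forall>n. x n \<in> D" and l: "x \<longlonglongrightarrow> l"
      have xC: "x n \<in> C" and x0: "h (x n) = 0" for n using x by (auto simp: D_def)
      have lC: "l \<in> C" by (rule closed_sequentially[OF closed_C _ l]) (rule xC)
      have "(\<lambda>n. h (x n)) \<longlonglongrightarrow> h l" by (rule character_tendsto[OF h _ lC l]) (simp add: xC)
      then have "h l = 0" by (simp add: x0 LIMSEQ_const_iff)
      with lC show "l \<in> D" by (simp add: D_def)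
    qed
    then have "closed_subalgebra (clop_apply ` D)"
      by (rule closed_subalgebra_clop_image)
        (auto simp: D_def characterD(1-3,7)[OF h] zero_in add_in scaleC_in mult_in)
    from A_least[OF this] have "A \<subseteq> clop_apply ` D" using zero Tc_in by (auto simp: D_def)
    then show ?thesis unfolding A'_def D_def by (auto simp: clop_apply_inject)
  qed
  obtain t0 where t0: "t0 > 0"
    "(SUP t \<in> {t \<in> sector (\<alpha> - \<beta>). cmod t \<le> t0}. spectral_radius (fb_operator \<mu> \<beta> T t))
      < (SUP z \<in> sector (\<alpha> - \<beta>). ennreal (cmod (F z)))" (is "?S < _")
    using assms(16) by blast
  obtain z1 where z1: "z1 \<in> sector (\<alpha> - \<beta>)" "?S < ennreal (cmod (F z1))"
    using t0(2) unfolding less_SUP_iff by blast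
  \<comment> \<open>The supremum is finite, being below a real number, so it can serve as the real
    bound on \<open>F\<close> in the estimate of the exponents.\<close>
  define s where "s = enn2real ?S"
  have s: "?S = ennreal s" "s \<ge> 0"
    using z1(2) by (auto simp: s_def less_top[symmetric] dest!: less_trans[OF _ ennreal_less_top])
  have s_less: "s < cmod (F z1)"
    using z1(2) s by (simp add: ennreal_less_iff)
  obtain L where L: "\<And>l. (\<And>t. t \<in> sector \<alpha> \<Longrightarrow> cmod (exp (- (l * t))) \<le> norm (T t)) \<Longrightarrow>
      (\<And>t. t \<in> sector (\<alpha> - \<beta>) \<Longrightarrow> cmod t \<le> t0 \<Longrightarrow> cmod (F (t * l)) \<le> s) \<Longrightarrow> cmod l \<le> L"
    using exponents_bounded[OF ab fourier_borel_entire[OF assms(9)]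
        fourier_borel_properties(1)[OF ab \<mu> assms(5) supp \<phi>]
        fourier_borel_properties(2)[OF ab \<mu> assms(5) supp \<phi>]
        z1(1) s_less[unfolded assms(11)] s(2) t0(1), of "\<lambda>t. norm (T t)"]
    unfolding assms(11) by blast
  have char: "(\<forall>x\<in>A'. h x = 0) \<or> (\<exists>l. cmod l \<le> max 0 L \<and> (\<forall>t\<in>sector \<alpha>. h (Tc t) = exp (- (l * t))))"
    if h: "character h" for h
  proof -
    from character_semigroup[OF \<alpha> T C Tc_in[unfolded Tc_def] h]
    consider "\<forall>t\<in>sector \<alpha>. h (Tc t) = 0" | l where "\<forall>t\<in>sector \<alpha>. h (Tc t) = exp (- (l * t))"
      unfolding Tc_def by blast
    then show ?thesis
    proof cases
      case 1
      then show ?thesis using vanish[OF h] by blast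
    next
      case (2 l)
      have "cmod l \<le> L"
      proof (rule L)
        fix t assume t: "t \<in> sector \<alpha>"
        have "cmod (exp (- (l * t))) = cmod (h (Tc t))" using 2 t by simp
        also have "\<dots> \<le> norm (Tc t)" by (rule characterD(5)[OF h Tc_in[OF t]])
        also have "\<dots> = norm (T t)" by (simp add: norm_clop.rep_eq Tc[OF t])
        finally show "cmod (exp (- (l * t))) \<le> norm (T t)" .
      next
        fix t assume t: "t \<in> sector (\<alpha> - \<beta>)" "cmod t \<le> t0"
        obtain a where a: "a \<in> C" "clop_apply a = fb_operator \<mu> \<beta> T t" "h a = fourier_borel \<phi> (t * l)"
          using character_fb_operator[OF ab \<mu> supp \<phi> T C Tc_in[unfolded Tc_def] h _ t(1), of l] 2
          unfolding Tc_def by blast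
        have "ennreal (cmod (F (t * l))) = ennreal (cmod (h a))" using a(3) assms(11) by simp
        also have "\<dots> \<le> spectral_radius (fb_operator \<mu> \<beta> T t)"
          using character_le_spectral_radius[of "Tc ` sector \<alpha>" h a] C h a(1) unfolding C_def[symmetric] a(2) by blast
        also have "\<dots> \<le> ?S" using t by (intro SUP_upper) simp
        also have "\<dots> = ennreal s" by (rule s(1))
        finally show "cmod (F (t * l)) \<le> s" using s(2) by simp
      qed
      then show ?thesis using 2 by (intro disjI2 exI[of _ l]) auto
    qed
  qed
  have in_sector: "complex_of_real r \<in> sector \<alpha>" if "0 < r" for r
    using of_real_in_sector[OF that \<alpha>(1)] .
  have Tc_A': "Tc t \<in> A'" if "t \<in> sector \<alpha>" for t using T_A[OF that] Tc[OF that] by (simp add: A'_def)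
  have "\<exists>p\<in>A'. \<exists>b\<in>A'. (\<forall>x\<in>A'. spr (x - p * x) = 0) \<and> (\<forall>t\<in>sector \<alpha>. \<exists>E\<in>A'.
      (\<lambda>n. (t ^ n / fact n) *\<^sub>C (b ^ n * p)) sums E \<and> spr (E - Tc t) = 0)"
    by (rule semigroup_logarithm[OF A' A'_alg in_sector Tc_A' max.cobounded1 char])
  then obtain p b where p: "p \<in> A'" and b: "b \<in> A'" and pb: "(\<forall>x\<in>A'. spr (x - p * x) = 0) \<and>
      (\<forall>t\<in>sector \<alpha>. \<exists>E\<in>A'. (\<lambda>n. (t ^ n / fact n) *\<^sub>C (b ^ n * p)) sums E \<and> spr (E - Tc t) = 0)"
    by (elim bexE) (rule that)
  have unit: "spr (x - p * x) = 0" if "x \<in> A'" for x using pb that by simp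
  have expo: "\<exists>E\<in>A'. (\<lambda>n. (t ^ n / fact n) *\<^sub>C (b ^ n * p)) sums E \<and> spr (E - Tc t) = 0"
    if "t \<in> sector \<alpha>" for t using pb that by simp
  have lin_A: "complex_linear c" if "c \<in> A" for c
    using A_rep[OF that] complex_linear_clop_apply by blast
  have pow_in: "x ^ Suc n \<in> A'" if "x \<in> A'" for x n
    by (induction n) (use A'_alg(5) that in auto)
  have diff_in': "x - y \<in> A'" if "x \<in> A'" "y \<in> A'" for x y
    using that AD(7) by (simp add: A'_def minus_clop.rep_eq)
  \<comment> \<open>By commutativity c x + k x again has \<open>spr\<close> zero for all c in
    \<open>A\<close> and scalars k, so its Neumann series converges and provides the quasi-inverse
    that the radical criterion asks for.\<close>
  have quasi_in_R: "clop_apply x \<in> R" if x: "x \<in> A'" and spr: "spr x = 0" for x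
    unfolding assms(15)
  proof (rule in_jacobson_radicalI[OF A_alg lin_A])
    show "clop_apply x \<in> A" using x by (simp add: A'_def)
    fix c k assume "c \<in> A"
    then obtain c' where c': "c' \<in> A'" "c = clop_apply c'" using A_rep by blast
    define q where "q = c' * x + k *\<^sub>C x"
    have q: "q \<in> A'" unfolding q_def by (intro A'_alg c' x)
    have xC: "x \<in> C" "c' \<in> C" "c' * x \<in> C" "k *\<^sub>C x \<in> C" using x c' A' by (auto intro: mult_in scaleC_in)
    have "spr q \<le> spr (c' * x) + spr (k *\<^sub>C x)" unfolding q_def by (rule spr_add[OF comm[OF xC(3,4)]])
    also have "\<dots> \<le> spr c' * spr x + cmod k * spr x"
      using spr_mult[OF comm[OF xC(2,1)]] by (simp add: spr_scaleC)
    finally have "spr q < 1 / 2" using spr by simp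
    then have "growth q (1 / 2)" by (rule growth_if_spr_less)
    from growth_summable[OF this, of "\<lambda>_. 1"] have "summable (\<lambda>n. q ^ n)"
      by (simp add: summable_geometric)
    then have "summable (\<lambda>n. q ^ Suc n)" by (subst summable_Suc_iff)
    \<comment> \<open>The series starts at the first power: y = q + q^2 + ... stays in
      \<open>A\<close> and satisfies y - y q = q.\<close>
    then obtain y where y: "(\<lambda>n. q ^ Suc n) sums y" unfolding summable_def by blast
    have sum_in': "(\<Sum>n<m. q ^ Suc n) \<in> A'" for m
      by (induction m) (use A'_alg pow_in[OF q] in auto)
    have yA: "y \<in> A'"
      using y unfolding sums_def by (rule closed_sequentially[OF A'_alg(1), rotated]) (rule sum_in')
    have "(\<lambda>n. q ^ Suc n * q) sums (y * q)" by (rule sums_mult2[OF y])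
    moreover have "(\<lambda>n. q ^ Suc (Suc n)) sums (y - q)"
      using y by (subst sums_Suc_iff) simp
    moreover have "q ^ Suc n * q = q ^ Suc (Suc n)" for n by (simp only: power_Suc2)
    ultimately have "y * q = y - q" using sums_unique2 by simp
    then have "y - y * q = q" by simp
    then have eq: "clop_apply y - (clop_apply y o\<^sub>L clop_apply q) = clop_apply q"
      unfolding minus_clop.rep_eq[symmetric] times_clop.rep_eq[symmetric] by simp
    have "clop_apply q = (c o\<^sub>L clop_apply x) + k *\<^sub>C clop_apply x"
      unfolding q_def c'(2) by (simp only: times_clop.rep_eq plus_clop.rep_eq scaleC_clop.rep_eq)
    then show "\<exists>s\<in>A. s - (s o\<^sub>L ((c o\<^sub>L clop_apply x) + k *\<^sub>C clop_apply x)) = (c o\<^sub>L clop_apply x) + k *\<^sub>C clop_apply x"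
      using yA eq by (intro bexI[of _ "clop_apply y"]) (simp_all only: A'_def mem_Collect_eq)
  qed
  interpret commutative_quotient A R
  proof
    show "closed_subalgebra A" by (rule A_alg)
    show "left_ideal A R" unfolding assms(15) by (rule left_ideal_jacobson_radical[OF A_alg])
    fix a c assume "a \<in> A" "c \<in> A"
    then obtain x y where xy: "x \<in> A'" "y \<in> A'" "a = clop_apply x" "c = clop_apply y" using A_rep by meson
    have "x * y = y * x" using comm A' xy(1,2) by blast
    then show "a o\<^sub>L c = c o\<^sub>L a" unfolding xy times_clop.rep_eq[symmetric] by simp
  qed
  have "quotient_identity A R (coset R (clop_apply p))"
  proof (rule quotient_identity_coset)
    show "clop_apply p \<in> A" using p by (simp add: A'_def)
    fix a assume "a \<in> A"
    then obtain x where x: "x \<in> A'" "a = clop_apply x" using A_rep by blast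
    have "clop_apply (x - p * x) \<in> R" by (intro quasi_in_R diff_in' A'_alg(5) p x unit)
    then show "a - (clop_apply p o\<^sub>L a) \<in> R" by (simp add: x minus_clop.rep_eq times_clop.rep_eq)
  qed
  moreover have "coset R (clop_apply b) \<in> quotient_algebra A R"
    using b by (simp add: quotient_algebra_def A'_def)
  moreover have "is_coset_exp R (coset R (clop_apply p)) (coset R (clop_apply b)) t (coset R (T t))"
    if t: "t \<in> sector \<alpha>" for t
  proof -
    obtain E where E: "E \<in> A'" "(\<lambda>n. (t ^ n / fact n) *\<^sub>C (b ^ n * p)) sums E" "spr (E - Tc t) = 0"
      using expo[OF t] by blast
    show ?thesis
    proof (rule is_coset_exp_coset[where v = "\<lambda>n. clop_apply (b ^ n * p)" and E = "clop_apply E"])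
      have "b ^ n * p \<in> A'" for n by (cases n) (use A'_alg(5) pow_in b p in auto)
      then show "clop_apply (b ^ n * p) \<in> A" for n by (simp add: A'_def)
      show "clop_apply (b ^ 0 * p) = clop_apply p" by simp
      show "clop_apply (b ^ Suc n * p) = clop_apply b o\<^sub>L clop_apply (b ^ n * p)" for n
        unfolding times_clop.rep_eq[symmetric] by (simp add: mult.assoc)
      show "clop_apply b \<in> A" using b by (simp add: A'_def)
      show "(\<lambda>n. (t ^ n / fact n) *\<^sub>C clop_apply (b ^ n * p)) sums clop_apply E"
        using E(2) unfolding sums_def
        by (subst (asm) tendsto_clop_apply[symmetric]) (simp only: clop_apply_sum scaleC_clop.rep_eq)
      have "clop_apply (E - Tc t) \<in> R" by (intro quasi_in_R diff_in' E Tc_A' t)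
      then show "clop_apply E - T t \<in> R" by (simp add: minus_clop.rep_eq Tc[OF t])
    qed
  qed
  ultimately show ?thesis by blast
qed

end
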